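(* For every integer $n\ge 1$, $$50\,C(n,n-1)+8\,C(n+1,n-1)+2\,C(n+4,n+1)=C(n+5,n+2).$$
   Context: A composition of a positive integer $n$ is a finite sequence $(a_1,\dots,a_m)$ of positive integers with $\sum a_i=n$. Let $V$ be an $n$-dimensional vector space over $\mathbb{C}$ with basis $e_1,\dots,e_n$. For compositions $\mathbf{a}=(a_1,\dots,a_m)$ and $\mathbf{b}=(b_1,\dots,b_t)$ of $n$, the seaweed algebra $\mathfrak{p}^{A}_n(\mathbf{a},\mathbf{b})$ is the subalgebra of $\mathfrak{sl}(n)$ consisting of traceless matrices preserving both flags $V_1\subset\cdots\subset V_m=V$, with $V_i=\mathrm{span}\{e_1,\dots,e_{a_1+\cdots+a_i}\}$, and $V=W_0\supset W_1\supset\cdots\supset W_t=\{0\}$, with $W_j=\mathrm{span}\{e_{b_1+\cdots+b_j+1},\dots,e_n\}$. The index of a finite-dimensional Lie algebra $\mathfrak{g}$ is $\min_{f\in\mathfrak{g}^*}\dim\ker B_f$, where $B_f(x,y)=f([x,y])$. For integers $n\ge1$ and $k$, $C(n,k)$ denotes the number of ordered pairs $(\mathbf{a},\mathbf{b})$ of compositions of $n$ such that $\mathfrak{p}^A_n(\mathbf{a},\mathbf{b})$ has index $k$. *)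

theory Defs
  imports Complex_Main "HOL-Library.Function_Algebras"
begin

text \<open>Complex n x n matrices are represented as functions nat => nat => complex
  (0-indexed), vanishing outside the block {0..<n} x {0..<n}. Basis vector e_(i+1) is index i.\<close>

type_synonym cmat = "nat \<Rightarrow> nat \<Rightarrow> complex"

definition mscale :: "complex \<Rightarrow> cmat \<Rightarrow> cmat" where
  "mscale c X = (\<lambda>i j. c * X i j)"

definition mmul :: "nat \<Rightarrow> cmat \<Rightarrow> cmat \<Rightarrow> cmat" where
  "mmul n X Y = (\<lambda>i j. \<Sum>k<n. X i k * Y k j)"

definition bracket :: "nat \<Rightarrow> cmat \<Rightarrow> cmat \<Rightarrow> cmat" where
  "bracket n X Y = (\<lambda>i j. mmul n X Y i j - mmul n Y X i j)"

definition composition :: "nat \<Rightarrow> nat list \<Rightarrow> bool" where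
  "composition n a \<longleftrightarrow> (\<forall>x\<in>set a. 0 < x) \<and> sum_list a = n"

text \<open>The seaweed algebra p^A_n(a,b): traceless n x n matrices preserving
  V_k = span{e_1..e_{a_1+..+a_k}} and W_k = span{e_{b_1+..+b_k+1}..e_n}.\<close>
definition seaweed :: "nat \<Rightarrow> nat list \<Rightarrow> nat list \<Rightarrow> cmat set" where
  "seaweed n a b = {X.
     (\<forall>i j. (n \<le> i \<or> n \<le> j) \<longrightarrow> X i j = 0) \<and>
     (\<Sum>i<n. X i i) = 0 \<and>
     (\<forall>k\<le>length a. \<forall>r c. c < sum_list (take k a) \<and> sum_list (take k a) \<le> r \<longrightarrow> X r c = 0) \<and>
     (\<forall>k\<le>length b. \<forall>r c. r < sum_list (take k b) \<and> sum_list (take k b) \<le> c \<longrightarrow> X r c = 0)}"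

definition lin_functional_on :: "cmat set \<Rightarrow> (cmat \<Rightarrow> complex) \<Rightarrow> bool" where
  "lin_functional_on g f \<longleftrightarrow>
     (\<forall>x\<in>g. \<forall>y\<in>g. f (x + y) = f x + f y) \<and> (\<forall>c. \<forall>x\<in>g. f (mscale c x) = c * f x)"

definition kerB :: "nat \<Rightarrow> cmat set \<Rightarrow> (cmat \<Rightarrow> complex) \<Rightarrow> cmat set" where
  "kerB n g f = {x\<in>g. \<forall>y\<in>g. f (bracket n x y) = 0}"

definition cdim :: "cmat set \<Rightarrow> nat" where
  "cdim S = vector_space.dim mscale S"

definition lie_index :: "nat \<Rightarrow> cmat set \<Rightarrow> nat" where
  "lie_index n g = (LEAST k. \<exists>f. lin_functional_on g f \<and> cdim (kerB n g f) = k)"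

definition C :: "nat \<Rightarrow> int \<Rightarrow> nat" where
  "C n k = card {(a, b). composition n a \<and> composition n b \<and>
                         int (lie_index n (seaweed n a b)) = k}"

end

theory Submission
  imports Defs "Jordan_Normal_Form.Schur_Decomposition"
begin

text \<open>
  Inside \<open>gl(n)\<close>, a seaweed algebra consists of all matrices supported on a preorder of the basis
  indices, and the index in \<open>sl(n)\<close> is one less than the index of that algebra. For first parts
  \<open>x < y\<close> put \<open>d = min x (y - x)\<close>. If the upper right \<open>d\<close>-by-\<open>d\<close> corner of the first block of the
  second composition carries an invertible part of the functional, conjugation makes this part the
  identity and clears its rows and columns; the kernel of the form is then isomorphic to the kernel of
  a form on a seaweed algebra in \<open>gl(n - d)\<close> (Panyushev's reduction). Invertibility may be assumed
  since kernels do not grow under small perturbations. Equal first parts split off a full matrix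
  block \<open>gl(x)\<close> of index \<open>x\<close>. Hence the index drops below its maximum \<open>n - 1\<close> by the sum of the numbers
  \<open>d\<close>, and the pairs for which this sum is at most 2 can be listed and counted.
\<close>

section \<open>Linear algebra in finite-dimensional subspaces\<close>

text \<open>The index is a minimum, so the kernel must be bounded below for every functional, also
  for one with a singular corner, while a single functional has to reach the bound. Genericity is
  replaced by an explicit perturbation: the form has an identity Gram matrix on a dual system, which
  stays invertible when the form moves a little. The cases \<open>d = x\<close> and
  \<open>d = y - x\<close> differ only in where the first composition has its blocks. One locale
  serves both: either no allowed position lies in \<open>M \<times> P\<close>, or none lies in
  \<open>(D \<union> N) \<times> M\<close>; this is the assumption \<open>R_alt\<close>. For the
  count let \<open>D_d(n)\<close> be the number of pairs of deficiency \<open>d\<close>, and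
  \<open>L_d(n)\<close> the number of those whose first composition has the smaller first part.
  Comparing first parts gives \<open>D_d(n + 1) = 2 D_d(n) + 2 (L_d(n + 1) - L_d(n))\<close> for
  positive \<open>n\<close>; this is the coefficient 2 of the theorem. For \<open>d = 2\<close> and
  \<open>n = m + 5\<close> the difference of the \<open>L\<close> is
  \<open>25 * 2^m + 4 D_1(m + 2)\<close>, whence 50 and 8.\<close>

context vector_space
begin

text \<open>The ambient space of all functions is infinite-dimensional, where \<open>dim\<close> of
  a large set can degenerate to 0 and monotonicity fails; this predicate marks the sets for which
  \<open>dim\<close> behaves.\<close>

definition findim :: "'b set \<Rightarrow> bool" where
  "findim S \<longleftrightarrow> (\<exists>E. finite E \<and> S \<subseteq> local.span E)"

lemma findim_subset: "A \<subseteq> B \<Longrightarrow> local.findim B \<Longrightarrow> local.findim A"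
  unfolding findim_def by blast

lemma findim_independent:
  assumes "local.findim S" "B \<subseteq> S" "local.independent B"
  shows "finite B" "card B \<le> local.dim S"
proof -
  obtain E where E: "finite E" "S \<subseteq> local.span E" using assms(1) by (auto simp: findim_def)
  obtain C where C: "C \<subseteq> S" "local.independent C" "S \<subseteq> local.span C" "card C = local.dim S"
    using basis_exists[of S] by blast
  have "finite C" using independent_span_bound[of E C] E C by blast
  then have "finite B \<and> card B \<le> card C"
    using independent_span_bound[of C B] assms C by blast
  then show "finite B" "card B \<le> local.dim S" using C by auto
qed

lemma findim_basis:
  assumes "local.findim S"
  obtains B where "B \<subseteq> S" "local.independent B" "S \<subseteq> local.span B" "card B = local.dim S" "finite B"
  using basis_exists[of S] findim_independent[OF assms] by metis

lemma findim_dim_mono: "A \<subseteq> B \<Longrightarrow> local.findim B \<Longrightarrow> local.dim A \<le> local.dim B"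
  by (metis findim_basis findim_subset dim_le_card order_trans)

text \<open>One vector \<open>v\<close> outside the kernel suffices: subtracting a multiple of
  \<open>v\<close> moves any element of \<open>S\<close> into it.\<close>

lemma dim_le_kernel_functional:
  assumes S: "local.subspace S" "local.findim S"
    and add: "\<And>x y. x \<in> S \<Longrightarrow> y \<in> S \<Longrightarrow> \<phi> (x + y) = \<phi> x + \<phi> y"
    and sc: "\<And>c x. x \<in> S \<Longrightarrow> \<phi> (scale c x) = c * \<phi> x"
  shows "local.dim S \<le> local.dim {x\<in>S. \<phi> x = 0} + 1"
proof -
  let ?Z = "{x\<in>S. \<phi> x = 0}"
  obtain B where B: "B \<subseteq> ?Z" "local.independent B" "?Z \<subseteq> local.span B" "card B = local.dim ?Z" "finite B"
    using findim_basis[of ?Z] findim_subset[of ?Z S] S by (metis (no_types, lifting) mem_Collect_eq subsetI)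
  show ?thesis
  proof (cases "S \<subseteq> ?Z")
    case True
    then have "?Z = S" by auto
    then show ?thesis by simp
  next
    case False
    then obtain v where v: "v \<in> S" "\<phi> v \<noteq> 0" by auto
    have "S \<subseteq> local.span (insert v B)"
    proof
      fix x assume x: "x \<in> S"
      let ?c = "\<phi> x / \<phi> v"
      have "\<phi> (x + scale (- ?c) v) = 0"
        using add[OF x subspace_scale[OF S(1) v(1)], of "- ?c"] sc[OF v(1), of "- ?c"] v(2) by simp
      moreover have "x + scale (- ?c) v \<in> S"
        by (intro subspace_add[OF S(1)] subspace_scale[OF S(1)] x v(1))
      ultimately have "x - scale ?c v \<in> local.span B" using B by auto
      then show "x \<in> local.span (insert v B)" using span_breakdown_eq by blast
    qed
    then have "local.dim S \<le> card (insert v B)" using B by (intro dim_le_card) auto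
    also have "\<dots> \<le> local.dim ?Z + 1" using B by (simp add: card_insert_if)
    finally show ?thesis .
  qed
qed

lemma dim_le_kernel_functionals:
  assumes "finite J" and S: "local.subspace S" "local.findim S"
    and add: "\<And>j x y. j \<in> J \<Longrightarrow> x \<in> S \<Longrightarrow> y \<in> S \<Longrightarrow> \<phi> j (x + y) = \<phi> j x + \<phi> j y"
    and sc: "\<And>j c x. j \<in> J \<Longrightarrow> x \<in> S \<Longrightarrow> \<phi> j (scale c x) = c * \<phi> j x"
  shows "local.dim S \<le> local.dim {x\<in>S. \<forall>j\<in>J. \<phi> j x = 0} + card J"
  using assms
proof (induction J)
  case empty then show ?case by simp
next
  case (insert j J)
  let ?Z = "{x\<in>S. \<forall>j\<in>J. \<phi> j x = 0}"
  have z: "\<phi> i 0 = 0" if "i \<in> insert j J" for i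
    using insert.prems(4)[OF that subspace_0[OF S(1)], of 0] by simp
  have sub: "local.subspace ?Z"
    unfolding subspace_def using insert.prems(1,3,4) z
    by (auto simp: subspace_0 subspace_add subspace_scale)
  have "local.dim ?Z \<le> local.dim {x\<in>?Z. \<phi> j x = 0} + 1"
    by (rule dim_le_kernel_functional[OF sub])
       (use insert.prems findim_subset[of ?Z S] in auto)
  moreover have "{x\<in>?Z. \<phi> j x = 0} = {x\<in>S. \<forall>i\<in>insert j J. \<phi> i x = 0}" by auto
  moreover have "local.dim S \<le> local.dim ?Z + card J" using insert by auto
  ultimately show ?case using insert.hyps by simp
qed

lemma dim_le_injective:
  assumes "Vector_Spaces.linear scale scale T" "local.subspace S" "local.findim S'"
    and "T ` S \<subseteq> S'" and inj: "\<And>x. x \<in> S \<Longrightarrow> T x = 0 \<Longrightarrow> x = 0"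
  shows "local.dim S \<le> local.dim S'"
proof -
  interpret T: Vector_Spaces.linear scale scale T by fact
  interpret vector_space_pair scale scale ..
  obtain B where B: "B \<subseteq> S" "local.independent B" "S \<subseteq> local.span B" "card B = local.dim S"
    using basis_exists[of S] by blast
  have sp: "local.span B \<subseteq> S" using B(1) assms(2) by (simp add: span_minimal)
  have i: "inj_on T (local.span B)"
  proof (rule inj_onI)
    fix x y assume "x \<in> local.span B" "y \<in> local.span B" "T x = T y"
    then have "x - y \<in> S" "T (x - y) = 0" using sp assms(2) by (auto simp: T.diff subspace_diff)
    then show "x = y" using inj by force
  qed
  have "local.independent (T ` B)"
    using T.independent_injective_image[OF B(2) i] .
  then have "card (T ` B) \<le> local.dim S'"
    using findim_independent[of S' "T ` B"] assms B by blast
  moreover have "card (T ` B) = card B"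
    by (intro card_image inj_on_subset[OF i]) (simp add: span_superset)
  ultimately show ?thesis using B by simp
qed

lemma dim_sum_le_disjoint:
  assumes S: "local.findim S" "A \<subseteq> S" "B \<subseteq> S" "local.subspace A" "local.subspace B" and disj: "A \<inter> B \<subseteq> {0}"
  shows "local.dim A + local.dim B \<le> local.dim S"
proof -
  have fA: "local.findim A" and fB: "local.findim B" using S findim_subset by blast+
  obtain X where X: "X \<subseteq> A" "local.independent X" "A \<subseteq> local.span X" "card X = local.dim A" "finite X"
    using findim_basis[OF fA] by blast
  obtain Y where Y: "Y \<subseteq> B" "local.independent Y" "B \<subseteq> local.span Y" "card Y = local.dim B" "finite Y"
    using findim_basis[OF fB] by blast
  have ind: "local.independent (X \<union> Y')" if "Y' \<subseteq> Y" for Y'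
  proof -
    have "finite Y'" using that Y finite_subset by blast
    then show ?thesis using that
    proof (induction Y')
      case empty then show ?case using X by simp
    next
      case (insert v F)
      have "v \<notin> local.span (X \<union> F)"
      proof
        assume "v \<in> local.span (X \<union> F)"
        then obtain a f where v: "v = a + f" "a \<in> local.span X" "f \<in> local.span F" by (auto simp: span_Un)
        have "a \<in> A" using v X S span_minimal by blast
        have "local.span F \<subseteq> B" using insert.prems Y(1) S(5) by (intro span_minimal) auto
        moreover have "v \<in> B" using insert.prems Y(1) by auto
        ultimately have "a \<in> B" using v S subspace_diff[of B v f] by auto
        then have "a = 0" using disj \<open>a \<in> A\<close> by auto
        then have "v \<in> local.span F" using v by simp
        then have "local.dependent (insert v F)" using insert.hyps
          by (auto simp: dependent_def intro!: bexI[of _ v])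
        then show False using insert.prems Y independent_mono by blast
      qed
      then show ?case using insert by (simp add: independent_insertI)
    qed
  qed
  have "X \<inter> Y = {}"
  proof -
    have "x = 0" if "x \<in> X \<inter> Y" for x using that X Y disj by blast
    moreover have "0 \<notin> X" using X dependent_zero by blast
    ultimately show ?thesis by blast
  qed
  then have "card (X \<union> Y) = local.dim A + local.dim B" using X Y by (simp add: card_Un_disjoint)
  moreover have "card (X \<union> Y) \<le> local.dim S"
    by (rule findim_independent) (use S X Y ind in auto)
  ultimately show ?thesis by simp
qed

lemma dim_sum_ge:
  assumes "local.findim A" "local.findim B" and S: "\<And>x. x \<in> S \<Longrightarrow> \<exists>a\<in>A. \<exists>b\<in>B. x = a + b"
  shows "local.dim S \<le> local.dim A + local.dim B"
proof -
  obtain X where X: "X \<subseteq> A" "local.independent X" "A \<subseteq> local.span X" "card X = local.dim A" "finite X"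
    using findim_basis[OF assms(1)] by blast
  obtain Y where Y: "Y \<subseteq> B" "local.independent Y" "B \<subseteq> local.span Y" "card Y = local.dim B" "finite Y"
    using findim_basis[OF assms(2)] by blast
  have "S \<subseteq> local.span (X \<union> Y)"
  proof
    fix x assume "x \<in> S"
    then obtain a b where "a \<in> A" "b \<in> B" "x = a + b" using S by blast
    then show "x \<in> local.span (X \<union> Y)" using X Y span_mono[of X "X \<union> Y"] span_mono[of Y "X \<union> Y"]
      by (auto intro!: span_add)
  qed
  then have "local.dim S \<le> card (X \<union> Y)" using X Y by (intro dim_le_card) auto
  also have "\<dots> \<le> local.dim A + local.dim B" using card_Un_le[of X Y] X Y by simp
  finally show ?thesis .
qed

text \<open>The radical of a pairing has codimension at least \<open>r\<close> as soon as there is a dual system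
  of size \<open>r\<close>, and dual systems survive small perturbations.\<close>

lemma dual_system:
  fixes B :: "'b \<Rightarrow> 'b \<Rightarrow> 'a"
  assumes S: "local.subspace S" "local.findim S"
    and addl: "\<And>x x' y. B (x + x') y = B x y + B x' y" and scl: "\<And>c x y. B (scale c x) y = c * B x y"
    and addr: "\<And>x y y'. B x (y + y') = B x y + B x y'" and scr: "\<And>c x y. B x (scale c y) = c * B x y"
    and r: "local.dim {x\<in>S. \<forall>y\<in>S. B x y = 0} + r \<le> local.dim S"
  shows "\<exists>x y. (\<forall>i<r. x i \<in> S \<and> y i \<in> S) \<and> (\<forall>i<r. \<forall>j<r. B (x i) (y j) = (if i = (j::nat) then 1 else 0))"
  using r
proof (induction r)
  case 0 then show ?case by auto
next
  case (Suc r)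
  let ?K = "{x\<in>S. \<forall>y\<in>S. B x y = 0}"
  have "local.dim ?K + r \<le> local.dim S" using Suc.prems by simp
  then obtain x y where xy: "\<forall>i<r. x i \<in> S \<and> y i \<in> S"
    "\<forall>i<r. \<forall>j<r. B (x i) (y j) = (if i = j then 1 else 0)" using Suc.IH by blast
  then have S': "\<And>i. i < r \<Longrightarrow> x i \<in> S" "\<And>i. i < r \<Longrightarrow> y i \<in> S"
    and B: "\<And>i j. i < r \<Longrightarrow> j < r \<Longrightarrow> B (x i) (y j) = (if i = j then 1 else 0)"
    by auto
  let ?Z = "{u\<in>S. \<forall>j\<in>{..<r}. B u (y j) = 0}"
  have "local.dim S \<le> local.dim ?Z + card {..<r}"
    by (rule dim_le_kernel_functionals) (use S addl scl in auto)
  \<comment> \<open>The \<open>r\<close> conditions cut the dimension by at most \<open>r\<close>,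
    while the radical has codimension at least \<open>r + 1\<close>, so some \<open>u\<close>
    satisfies them and pairs nontrivially with some \<open>w\<close>.\<close>
  then have "\<not> ?Z \<subseteq> ?K" using findim_dim_mono[of ?Z ?K] findim_subset[of ?K S] Suc.prems S by fastforce
  then obtain u w where u: "u \<in> S" "\<And>j. j < r \<Longrightarrow> B u (y j) = 0" and w: "w \<in> S" "B u w \<noteq> 0" by auto
  have B0: "B a 0 = 0" for a using scr[of a 0 0] by simp
  have sumr: "B a (sum g J) = (\<Sum>j\<in>J. B a (g j))" for a g and J :: "nat set"
    by (induction J rule: infinite_finite_induct) (auto simp: addr B0)
  \<comment> \<open>A Gram-Schmidt correction: multiples of the old \<open>y i\<close> make
    \<open>w\<close> orthogonal to the old \<open>x i\<close> and leave its pairing with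
    \<open>u\<close> alone, as \<open>u\<close> annihilates every \<open>y i\<close>; rescaling then
    makes that pairing 1.\<close>
  define w' where "w' = scale (1 / B u w) (w + (\<Sum>i<r. scale (- B (x i) w) (y i)))"
  have w': "w' \<in> S" unfolding w'_def using S w S'
    by (intro subspace_scale subspace_add subspace_sum) auto
  have 1: "B u w' = 1" using w u by (simp add: w'_def scr addr sumr del: scale_minus_left)
  have 2: "B (x i) w' = 0" if i: "i < r" for i
  proof -
    have "(\<Sum>j<r. - B (x j) w * B (x i) (y j)) = (\<Sum>j<r. if j = i then - B (x i) w else 0)"
      using i B by (intro sum.cong) auto
    then show ?thesis using i by (simp add: w'_def scr addr sumr del: scale_minus_left)
  qed
  show ?case
    by (rule exI[of _ "x(r := u)"], rule exI[of _ "y(r := w')"])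
       (use S' u w' 1 2 B in \<open>auto simp: less_Suc_eq\<close>)
qed

text \<open>The span of the \<open>x i\<close> has dimension \<open>r\<close> and meets the radical
  only in 0. The hypothesis \<open>nondeg\<close> asks for a Gram matrix with trivial kernel instead
  of the identity, since exact duality is lost under a perturbation.\<close>

lemma dim_annihilator_dual_system:
  fixes B :: "'b \<Rightarrow> 'b \<Rightarrow> 'a"
  assumes S: "local.subspace S" "local.findim S"
    and addl: "\<And>x x' y. B (x + x') y = B x y + B x' y" and scl: "\<And>c x y. B (scale c x) y = c * B x y"
    and x: "\<And>i. i < r \<Longrightarrow> x i \<in> S" and y: "\<And>i. i < r \<Longrightarrow> y i \<in> S"
    and nondeg: "\<And>c. (\<And>j. j < r \<Longrightarrow> (\<Sum>i<r. c i * B (x i) (y j)) = 0) \<Longrightarrow> \<forall>i<r. c i = 0"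
  shows "local.dim {x\<in>S. \<forall>y\<in>S. B x y = 0} + r \<le> local.dim S"
proof -
  let ?K = "{x\<in>S. \<forall>y\<in>S. B x y = 0}" and ?X = "range (\<lambda>c. \<Sum>i<r. scale (c i) (x i))"
  have B0: "B 0 a = 0" for a using scl[of 0 0 a] by simp
  have suml: "B (sum g J) a = (\<Sum>j\<in>J. B (g j) a)" for a g and J :: "nat set"
    by (induction J rule: infinite_finite_induct) (auto simp: addl B0)
  have nz: "\<forall>i<r. c i = 0" if "(\<Sum>i<r. scale (c i) (x i)) \<in> ?K" for c
  proof (rule nondeg)
    fix j assume "j < r"
    then have "B (\<Sum>i<r. scale (c i) (x i)) (y j) = 0" using that y by blast
    then show "(\<Sum>i<r. c i * B (x i) (y j)) = 0" by (simp add: suml scl)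
  qed
  have sK: "local.subspace ?K" using S(1) unfolding subspace_def by (auto simp: addl scl B0)
  have z: "(0::'b) = (\<Sum>i<r. scale 0 (x i))" by simp
  have sX: "local.subspace ?X"
    unfolding subspace_def
  proof (intro conjI ballI allI)
    show "0 \<in> ?X" using z by (intro image_eqI[of _ _ "\<lambda>_. 0"]) auto
  next
    fix a b assume "a \<in> ?X" "b \<in> ?X"
    then obtain c c' where "a = (\<Sum>i<r. scale (c i) (x i))" "b = (\<Sum>i<r. scale (c' i) (x i))" by auto
    then show "a + b \<in> ?X"
      by (intro image_eqI[of _ _ "\<lambda>i. c i + c' i"]) (auto simp: scale_left_distrib sum.distrib)
  next
    fix k a assume "a \<in> ?X"
    then obtain c where "a = (\<Sum>i<r. scale (c i) (x i))" by auto
    then show "scale k a \<in> ?X"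
      by (intro image_eqI[of _ _ "\<lambda>i. k * c i"]) (auto simp: scale_sum_right)
  qed
  have XS: "?X \<subseteq> S" using S x by (auto intro!: subspace_sum subspace_scale)
  have inj: "inj_on x {..<r}"
  proof (rule inj_onI, rule ccontr)
    fix i j assume ij: "i \<in> {..<r}" "j \<in> {..<r}" "x i = x j" "i \<noteq> j"
    let ?c = "\<lambda>k. if k = i then 1 else if k = j then -1 else (0::'a)"
    have "(\<Sum>k<r. scale (?c k) (x k)) = (\<Sum>k\<in>{i,j}. scale (?c k) (x k))"
      using ij by (intro sum.mono_neutral_right) auto
    also have "\<dots> = 0" using ij by simp
    finally have "(\<Sum>k<r. scale (?c k) (x k)) \<in> ?K" using subspace_0[OF sK] by simp
    then have "\<forall>i<r. ?c i = 0" by (rule nz)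
    then have "?c i = 0" using ij by blast
    then show False by simp
  qed
  have ind: "local.independent (x ` {..<r})"
  proof (rule independent_if_scalars_zero)
    fix f v assume f: "(\<Sum>v\<in>x ` {..<r}. scale (f v) v) = 0" and v: "v \<in> x ` {..<r}"
    have "(\<Sum>i<r. scale (f (x i)) (x i)) = 0" using f by (simp add: sum.reindex[OF inj])
    then have "(\<Sum>i<r. scale (f (x i)) (x i)) \<in> ?K" using subspace_0[OF sK] by simp
    then have "\<forall>i<r. f (x i) = 0" by (rule nz)
    then show "f v = 0" using v by auto
  qed simp
  have xX: "x ` {..<r} \<subseteq> ?X"
  proof
    fix v assume "v \<in> x ` {..<r}"
    then obtain i where i: "i < r" "v = x i" by auto
    have "(\<Sum>k<r. scale (if k = i then 1 else 0) (x k)) = (\<Sum>k\<in>{i}. scale (if k = i then 1 else 0) (x k))"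
      using i by (intro sum.mono_neutral_right) auto
    then show "v \<in> ?X" using i by (intro image_eqI[of _ _ "\<lambda>k. if k = i then 1 else 0"]) auto
  qed
  have "r \<le> local.dim ?X"
    using findim_independent(2)[of ?X "x ` {..<r}"] findim_subset[OF XS S(2)] xX ind card_image[OF inj] by simp
  moreover have "local.dim ?K + local.dim ?X \<le> local.dim S"
  proof (rule dim_sum_le_disjoint[OF S(2) _ XS sK sX])
    show "?K \<inter> ?X \<subseteq> {0}"
    proof
      fix v assume v: "v \<in> ?K \<inter> ?X"
      then obtain c where c: "v = (\<Sum>i<r. scale (c i) (x i))" by auto
      then have "\<forall>i<r. c i = 0" using nz v by blast
      then show "v \<in> {0}" using c by simp
    qed
  qed auto
  ultimately show ?thesis by simp
qed

end

text \<open>At an index \<open>j\<close> where \<open>norm (c j)\<close> is maximal, the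
  \<open>j\<close>-th equation bounds \<open>norm (c j)\<close> by itself times a factor below
  1.\<close>

lemma diagonally_dominant_kernel:
  fixes N :: "nat \<Rightarrow> nat \<Rightarrow> complex"
  assumes M: "\<And>i j. i < r \<Longrightarrow> j < r \<Longrightarrow> norm (N i j) \<le> M" and t: "norm t * real r * M < 1"
    and c: "\<And>j. j < r \<Longrightarrow> (\<Sum>i<r. c i * ((if i = j then 1 else 0) + t * N i j)) = 0"
  shows "\<forall>i<r. c i = 0"
proof (cases "r = 0")
  case False
  let ?m = "Max ((\<lambda>i. norm (c i)) ` {..<r})"
  have m: "norm (c i) \<le> ?m" if "i < r" for i using that by (intro Max_ge) auto
  have "?m \<in> (\<lambda>i. norm (c i)) ` {..<r}" using False by (intro Max_in) (auto simp: lessThan_empty_iff)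
  then obtain j where j: "j < r" "?m = norm (c j)" by auto
  have "(\<Sum>i<r. c i * (if i = j then 1 else 0)) = (\<Sum>i<r. if i = j then c j else 0)"
    by (intro sum.cong) auto
  then have "c j = - t * (\<Sum>i<r. c i * N i j)"
    using c[OF j(1)] j(1)
    by (simp add: distrib_left sum.distrib sum_distrib_left eq_neg_iff_add_eq_0 sum_negf algebra_simps)
  then have "norm (c j) = norm t * norm (\<Sum>i<r. c i * N i j)" by (simp add: norm_mult)
  also have "norm (\<Sum>i<r. c i * N i j) \<le> (\<Sum>i<r. norm (c i) * norm (N i j))"
    by (rule order_trans[OF norm_sum]) (simp add: norm_mult)
  also have "\<dots> \<le> (\<Sum>i<r. ?m * M)"
    by (intro sum_mono mult_mono) (use m M j in auto)
  finally have "norm (c j) \<le> norm t * (\<Sum>i<r. ?m * M)" by (simp add: mult_left_mono)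
  then have "norm (c j) \<le> (norm t * real r * M) * norm (c j)"
    unfolding j(2) by (simp add: mult_ac)
  then have "norm (c j) = 0" using t mult_strict_right_mono[OF t, of "norm (c j)"]
    by (cases "norm (c j) = 0") auto
  then show ?thesis using m j by auto
qed simp

section \<open>Invertible perturbations and triangularization\<close>

text \<open>Adding \<open>t\<close> to the diagonal gives a singular matrix only if
  \<open>-t\<close> is an eigenvalue. The characteristic polynomial has finitely many roots, so one
  of the infinitely many values \<open>e / (2 + k)\<close> works, and all of them are below
  \<open>e\<close>.\<close>

lemma perturb_invertible:
  fixes A :: "nat \<Rightarrow> nat \<Rightarrow> complex"
  assumes "finite P" and e: "e > 0"
  obtains t G where "norm t < e"
    "\<And>i j. i \<in> P \<Longrightarrow> j \<in> P \<Longrightarrow> (\<Sum>k\<in>P. (A i k + (if i = k then t else 0)) * G k j) = (if i = j then 1 else 0)"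
    "\<And>i j. i \<in> P \<Longrightarrow> j \<in> P \<Longrightarrow> (\<Sum>k\<in>P. G i k * (A k j + (if k = j then t else 0))) = (if i = j then 1 else 0)"
proof -
  obtain f where f: "bij_betw f {0..<card P} P" using ex_bij_betw_nat_finite[OF assms(1)] by blast
  define d where "d = card P"
  let ?u = "inv_into {0..<d} f"
  have u: "?u i < d" "f (?u i) = i" if "i \<in> P" for i
    using that f bij_betw_inv_into_right[OF f] bij_betwE[OF bij_betw_inv_into[OF f]] by (auto simp: d_def)
  have uf: "?u (f i) = i" if "i < d" for i
    using that bij_betw_inv_into_left[OF f, of i] by (auto simp: d_def)
  have ui: "?u i = ?u j \<longleftrightarrow> i = j" if "i \<in> P" "j \<in> P" for i j using u that by metis
  define B where "B = mat d d (\<lambda>(i, j). A (f i) (f j))"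
  have B: "B \<in> carrier_mat d d" by (simp add: B_def)
  have "char_poly B \<noteq> 0" using degree_monic_char_poly[OF B] by auto
  then have "finite {x. poly (char_poly B) x = 0}" by (rule poly_roots_finite)
  moreover have "infinite ((\<lambda>k. complex_of_real (- e / (2 + real k))) ` UNIV)"
    using e by (intro range_inj_infinite) (auto simp: inj_on_def field_simps)
  ultimately obtain k :: nat where k: "poly (char_poly B) (complex_of_real (- e / (2 + real k))) \<noteq> 0"
    by (metis (mono_tags, lifting) finite_subset image_subsetI mem_Collect_eq)
  define t where "t = complex_of_real (e / (2 + real k))"
  have "e / (2 + real k) < e" using e by (simp add: field_simps add_pos_nonneg)
  then have t: "norm t < e" using e unfolding t_def norm_of_real by simp
  define X where "X = char_matrix B (- t)"
  have X: "X \<in> carrier_mat d d" using B by (simp add: X_def char_matrix_def)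
  have "det X \<noteq> 0" using k eigenvalue_det[OF B, of "-t"] eigenvalue_root_char_poly[OF B, of "-t"]
    by (simp add: X_def t_def)
  define Y where "Y = (1 / det X) \<cdot>\<^sub>m adj_mat X"
  have Y: "Y \<in> carrier_mat d d" using adj_mat(1)[OF X] by (simp add: Y_def)
  have XY: "X * Y = 1\<^sub>m d" "Y * X = 1\<^sub>m d"
    using adj_mat[OF X] X \<open>det X \<noteq> 0\<close> unfolding Y_def
    by (auto simp: mult_smult_distrib[of _ d d _ d] mult_smult_assoc_mat[of _ d d _ d])
  have Xe: "X $$ (i, j) = A (f i) (f j) + (if f i = f j then t else 0)" if "i < d" "j < d" for i j
    using that B uf by (auto simp: X_def char_matrix_def B_def) metis
  define G where "G = (\<lambda>i j. Y $$ (?u i, ?u j))"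
  have sum: "(\<Sum>k\<in>P. g k) = (\<Sum>k = 0..<d. g (f k))" for g :: "nat \<Rightarrow> complex"
    using sum.reindex_bij_betw[OF f, of g] by (simp add: d_def)
  show ?thesis
  proof (rule that[OF t])
    fix i j assume ij: "i \<in> P" "j \<in> P"
    have "(\<Sum>k\<in>P. (A i k + (if i = k then t else 0)) * G k j)
        = (\<Sum>k = 0..<d. X $$ (?u i, k) * Y $$ (k, ?u j))"
      unfolding sum by (intro sum.cong) (auto simp: Xe u ij G_def uf)
    also have "\<dots> = (X * Y) $$ (?u i, ?u j)"
      using X Y u ij by (simp add: scalar_prod_def)
    also have "\<dots> = (if i = j then 1 else 0)" unfolding XY using u ij by (simp add: ui)
    finally show "(\<Sum>k\<in>P. (A i k + (if i = k then t else 0)) * G k j) = (if i = j then 1 else 0)" .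
    have "(\<Sum>k\<in>P. G i k * (A k j + (if k = j then t else 0)))
        = (\<Sum>k = 0..<d. Y $$ (?u i, k) * X $$ (k, ?u j))"
      unfolding sum by (intro sum.cong) (auto simp: Xe u ij G_def uf)
    also have "\<dots> = (Y * X) $$ (?u i, ?u j)"
      using X Y u ij by (simp add: scalar_prod_def)
    also have "\<dots> = (if i = j then 1 else 0)" unfolding XY using u ij by (simp add: ui)
    finally show "(\<Sum>k\<in>P. G i k * (A k j + (if k = j then t else 0))) = (if i = j then 1 else 0)" .
  qed
qed

text \<open>The Schur form of a complex matrix, carried over to functions on indices below
  \<open>m\<close>. It feeds the lower bound for full matrix blocks.\<close>

lemma triangularize:
  fixes A :: "nat \<Rightarrow> nat \<Rightarrow> complex"
  obtains S T where
    "\<forall>i<m. \<forall>j<m. (\<Sum>k<m. S i k * T k j) = (if i = j then 1 else 0)"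
    "\<forall>i<m. \<forall>j<m. (\<Sum>k<m. T i k * S k j) = (if i = j then 1 else 0)"
    "\<forall>i<m. \<forall>j<i. (\<Sum>k<m. \<Sum>l<m. S i k * A k l * T l j) = 0"
proof -
  define B where "B = mat m m (\<lambda>(i, j). A i j)"
  have B: "B \<in> carrier_mat m m" by (simp add: B_def)
  obtain es where "char_poly B = (\<Prod>a\<leftarrow>es. [:- a, 1:])" using char_poly_factorized[OF B] by blast
  then obtain U where U: "upper_triangular U" "similar_mat B U" "U \<in> carrier_mat m m"
    using schur_upper_triangular[OF B] by blast
  then obtain X Y where w: "similar_mat_wit B U X Y" by (auto simp: similar_mat_def)
  note W = similar_mat_witD2[OF B w]
  have YBX: "Y * B * X = U"
  proof -
    have "Y * B * X = Y * (X * U * Y) * X" using W(3) by simp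
    also have "\<dots> = (Y * X) * U * (Y * X)"
      using W(5-7) by (simp add: assoc_mult_mat[of _ m m _ m _ m])
    finally show ?thesis using W U(3) by (simp only: left_mult_one_mat right_mult_one_mat)
  qed
  show ?thesis
  proof (rule that[of "\<lambda>i j. Y $$ (i, j)" "\<lambda>i j. X $$ (i, j)"]; intro allI impI)
    fix i j assume ij: "i < m" "j < m"
    have "(\<Sum>k<m. Y $$ (i, k) * X $$ (k, j)) = (Y * X) $$ (i, j)"
      using W(5-7) ij by (simp add: scalar_prod_def lessThan_atLeast0)
    then show "(\<Sum>k<m. Y $$ (i, k) * X $$ (k, j)) = (if i = j then 1 else 0)" using W ij by simp
    have "(\<Sum>k<m. X $$ (i, k) * Y $$ (k, j)) = (X * Y) $$ (i, j)"
      using W(5-7) ij by (simp add: scalar_prod_def lessThan_atLeast0)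
    then show "(\<Sum>k<m. X $$ (i, k) * Y $$ (k, j)) = (if i = j then 1 else 0)" using W ij by simp
  next
    fix i j assume ij: "i < m" "j < i"
    have "(\<Sum>k<m. \<Sum>l<m. Y $$ (i, k) * A k l * X $$ (l, j)) = (Y * (B * X)) $$ (i, j)"
      using W(5-7) ij B by (simp add: scalar_prod_def lessThan_atLeast0 B_def sum_distrib_left mult.assoc)
    also have "\<dots> = U $$ (i, j)" using YBX W(5-7) B by (simp add: assoc_mult_mat[of _ m m _ m _ m])
    also have "\<dots> = 0" using U ij by auto
    finally show "(\<Sum>k<m. \<Sum>l<m. Y $$ (i, k) * A k l * X $$ (l, j)) = 0" .
  qed
qed

section \<open>Kernels of the forms on matrix algebras of preorders\<close>

interpretation cm: vector_space mscale
  by unfold_locales (auto simp: mscale_def fun_eq_iff algebra_simps)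

definition supported :: "(nat \<Rightarrow> nat \<Rightarrow> bool) \<Rightarrow> cmat set" where
  "supported R = {X. \<forall>i j. X i j \<noteq> 0 \<longrightarrow> R i j}"

definition unit_mat :: "nat \<Rightarrow> nat \<Rightarrow> cmat" where
  "unit_mat k l = (\<lambda>i j. if i = k \<and> j = l then 1 else 0)"

text \<open>Entrywise, not as the trace of a product: without the transpose, the matrix that
  represents a functional can be taken with the same support as the algebra.\<close>

definition pairing :: "nat \<Rightarrow> cmat \<Rightarrow> cmat \<Rightarrow> complex" where
  "pairing n F X = (\<Sum>i<n. \<Sum>j<n. F i j * X i j)"

text \<open>The kernel of \<open>B_f\<close> for the functional \<open>f = pairing n F\<close> on
  the associative algebra of \<open>R\<close>, before passing to trace zero.\<close>

definition rad :: "nat \<Rightarrow> (nat \<Rightarrow> nat \<Rightarrow> bool) \<Rightarrow> cmat \<Rightarrow> cmat set" where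
  "rad n R F = {X\<in>supported R. \<forall>Y\<in>supported R.
     pairing n F (mmul n X Y) = pairing n F (mmul n Y X)}"

lemma supported_zero: "X \<in> supported R \<Longrightarrow> \<not> R i j \<Longrightarrow> X i j = 0"
  by (auto simp: supported_def)

lemma unit_mat_apply: "unit_mat k l i j = (if i = k \<and> j = l then 1 else 0)"
  by (simp add: unit_mat_def)

lemma unit_mat_supported: "R k l \<Longrightarrow> unit_mat k l \<in> supported R"
  by (auto simp: supported_def unit_mat_def)

lemma subspace_supported: "cm.subspace (supported R)"
  by (auto simp: cm.subspace_def supported_def mscale_def) (metis add.right_neutral)

lemma sum_cmat_apply: "(\<Sum>q\<in>Q. f q) i j = (\<Sum>q\<in>Q. f q i j)" for f :: "'a \<Rightarrow> cmat"
  by (induction Q rule: infinite_finite_induct) auto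

lemma supported_span:
  assumes "finite {(i, j). R i j}"
  shows "supported R \<subseteq> cm.span ((\<lambda>(i, j). unit_mat i j) ` {(i, j). R i j})"
proof
  fix X assume X: "X \<in> supported R"
  have "X = (\<Sum>(k, l)\<in>{(i, j). R i j}. mscale (X k l) (unit_mat k l))"
  proof (intro ext)
    fix i j
    have "(\<Sum>(k, l)\<in>{(i, j). R i j}. mscale (X k l) (unit_mat k l)) i j
       = (\<Sum>q\<in>{(i, j). R i j}. if q = (i, j) then X i j else 0)"
      unfolding sum_cmat_apply by (intro sum.cong) (auto simp: mscale_def unit_mat_apply split: if_splits)
    also have "\<dots> = X i j" using assms supported_zero[OF X] by (auto simp: sum.delta)
    finally show "X i j = (\<Sum>(k, l)\<in>{(i, j). R i j}. mscale (X k l) (unit_mat k l)) i j" by simp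
  qed
  also have "\<dots> \<in> cm.span ((\<lambda>(i, j). unit_mat i j) ` {(i, j). R i j})"
    by (intro cm.span_sum) (auto intro!: cm.span_scale[OF cm.span_base])
  finally show "X \<in> cm.span ((\<lambda>(i, j). unit_mat i j) ` {(i, j). R i j})" .
qed

lemma findim_supported: "finite {(i, j). R i j} \<Longrightarrow> cm.findim (supported R)"
  unfolding cm.findim_def using supported_span by blast

lemma dim_supported:
  assumes "finite {(i, j). R i j}"
  shows "cm.dim (supported R) = card {(i, j). R i j}"
proof (rule antisym)
  show "cm.dim (supported R) \<le> card {(i, j). R i j}"
    by (rule order_trans[OF cm.dim_le_card[OF supported_span[OF assms]]])
       (use assms in \<open>auto intro: card_image_le\<close>)
  have inj: "inj_on (\<lambda>(i, j). unit_mat i j) {(i, j). R i j}"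
    by (auto simp: inj_on_def unit_mat_def fun_eq_iff split: if_splits)
  have "cm.independent ((\<lambda>(i, j). unit_mat i j) ` {(i, j). R i j})"
  proof (rule cm.independent_if_scalars_zero)
    fix f v assume z: "(\<Sum>v\<in>(\<lambda>(i, j). unit_mat i j) ` {(i, j). R i j}. mscale (f v) v) = 0"
      and "v \<in> (\<lambda>(i, j). unit_mat i j) ` {(i, j). R i j}"
    then obtain k l where v: "v = unit_mat k l" "R k l" by auto
    have "0 = (\<Sum>q\<in>{(i, j). R i j}. mscale (f (case q of (i, j) \<Rightarrow> unit_mat i j)) (case q of (i, j) \<Rightarrow> unit_mat i j)) k l"
      using z by (simp add: sum.reindex[OF inj])
    also have "\<dots> = (\<Sum>q\<in>{(i, j). R i j}. if q = (k, l) then f v else 0)"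
      unfolding sum_cmat_apply by (intro sum.cong) (auto simp: mscale_def unit_mat_apply v split: if_splits)
    also have "\<dots> = f v" using assms v by (auto simp: sum.delta)
    finally show "f v = 0" by simp
  qed (use assms in auto)
  then show "card {(i, j). R i j} \<le> cm.dim (supported R)"
    using cm.findim_independent(2)[OF findim_supported[OF assms]] card_image[OF inj]
    by (metis (no_types, lifting) case_prod_beta image_subsetI mem_Collect_eq unit_mat_supported)
qed

lemma mmul_assoc: "mmul n (mmul n X Y) Z = mmul n X (mmul n Y Z)"
proof (intro ext)
  fix i j
  have "mmul n (mmul n X Y) Z i j = (\<Sum>k<n. \<Sum>l<n. X i l * Y l k * Z k j)"
    by (simp add: mmul_def sum_distrib_right)
  also have "\<dots> = (\<Sum>l<n. \<Sum>k<n. X i l * Y l k * Z k j)" by (rule sum.swap)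
  finally show "mmul n (mmul n X Y) Z i j = mmul n X (mmul n Y Z) i j"
    by (simp add: mmul_def sum_distrib_left mult.assoc)
qed

lemma mmul_supported:
  assumes "X \<in> supported R" "Y \<in> supported R" and tr: "\<And>i j k. R i j \<Longrightarrow> R j k \<Longrightarrow> R i k"
  shows "mmul n X Y \<in> supported R"
proof -
  have "R i j" if "(\<Sum>k<n. X i k * Y k j) \<noteq> 0" for i j
  proof -
    obtain k where "X i k * Y k j \<noteq> 0" using \<open>(\<Sum>k<n. X i k * Y k j) \<noteq> 0\<close> by (meson sum.not_neutral_contains_not_neutral)
    then have "R i k" "R k j" using assms(1,2) by (auto simp: supported_def)
    then show ?thesis by (rule tr)
  qed
  then show ?thesis by (simp add: supported_def mmul_def)
qed

lemma pairing_add: "pairing n F (X + Y) = pairing n F X + pairing n F Y"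
  by (simp add: pairing_def distrib_left sum.distrib)

lemma pairing_scale: "pairing n F (mscale c X) = c * pairing n F X"
  by (simp add: pairing_def mscale_def sum_distrib_left mult_ac)

lemma mmul_add: "mmul n (X + X') Y = mmul n X Y + mmul n X' Y" "mmul n Y (X + X') = mmul n Y X + mmul n Y X'"
  by (auto simp: mmul_def fun_eq_iff distrib_left distrib_right sum.distrib)

lemma mmul_scale: "mmul n (mscale c X) Y = mscale c (mmul n X Y)" "mmul n Y (mscale c X) = mscale c (mmul n Y X)"
  by (auto simp: mmul_def mscale_def fun_eq_iff sum_distrib_left mult_ac)

lemma pairing_mmul_left:
  "pairing n F (mmul n X Y) = (\<Sum>k<n. \<Sum>l<n. Y k l * (\<Sum>i<n. X i k * F i l))"
proof -
  have "pairing n F (mmul n X Y) = (\<Sum>i<n. \<Sum>l<n. \<Sum>k<n. F i l * (X i k * Y k l))"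
    by (simp add: pairing_def mmul_def sum_distrib_left)
  also have "\<dots> = (\<Sum>i<n. \<Sum>k<n. \<Sum>l<n. F i l * (X i k * Y k l))"
    by (rule sum.cong[OF refl], rule sum.swap)
  also have "\<dots> = (\<Sum>k<n. \<Sum>i<n. \<Sum>l<n. F i l * (X i k * Y k l))"
    by (rule sum.swap)
  also have "\<dots> = (\<Sum>k<n. \<Sum>l<n. \<Sum>i<n. F i l * (X i k * Y k l))"
    by (rule sum.cong[OF refl], rule sum.swap)
  finally show ?thesis by (simp add: sum_distrib_left mult_ac)
qed

lemma pairing_mmul_right:
  "pairing n F (mmul n Y X) = (\<Sum>k<n. \<Sum>l<n. Y k l * (\<Sum>j<n. F k j * X l j))"
proof -
  have "pairing n F (mmul n Y X) = (\<Sum>k<n. \<Sum>j<n. \<Sum>l<n. F k j * (Y k l * X l j))"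
    by (simp add: pairing_def mmul_def sum_distrib_left)
  also have "\<dots> = (\<Sum>k<n. \<Sum>l<n. \<Sum>j<n. F k j * (Y k l * X l j))"
    by (rule sum.cong[OF refl], rule sum.swap)
  finally show ?thesis by (simp add: sum_distrib_left mult_ac)
qed

lemma sum_unit_mat:
  assumes "k < n" "l < n"
  shows "(\<Sum>i<n. \<Sum>j<n. unit_mat k l i j * G i j) = G k l"
proof -
  have "(\<Sum>i<n. \<Sum>j<n. unit_mat k l i j * G i j) = (\<Sum>i<n. if i = k then G k l else 0)"
  proof (rule sum.cong[OF refl])
    fix i assume "i \<in> {..<n}"
    have "(\<Sum>j<n. unit_mat k l i j * G i j) = (\<Sum>j<n. if j = l then (if i = k then G k l else 0) else 0)"
      by (intro sum.cong) (auto simp: unit_mat_def)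
    then show "(\<Sum>j<n. unit_mat k l i j * G i j) = (if i = k then G k l else 0)" using assms by simp
  qed
  then show ?thesis using assms by simp
qed

text \<open>Testing against matrix units is enough; at the position \<open>(k, l)\<close> the
  condition is the corresponding entry of \<open>X^T F = F X^T\<close>.\<close>

lemma rad_iff:
  assumes R: "\<And>i j. R i j \<Longrightarrow> i < n \<and> j < n"
  shows "X \<in> rad n R F \<longleftrightarrow> X \<in> supported R \<and>
    (\<forall>k l. R k l \<longrightarrow> (\<Sum>i<n. X i k * F i l) = (\<Sum>j<n. F k j * X l j))"
proof (rule iffI; (intro conjI allI impI)?)
  assume "X \<in> rad n R F" then show "X \<in> supported R" by (simp add: rad_def)
next
  fix k l assume X: "X \<in> rad n R F" and kl: "R k l"
  then have "pairing n F (mmul n X (unit_mat k l)) = pairing n F (mmul n (unit_mat k l) X)"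
    by (auto simp: rad_def unit_mat_supported)
  then show "(\<Sum>i<n. X i k * F i l) = (\<Sum>j<n. F k j * X l j)"
    unfolding pairing_mmul_left[of n F X] pairing_mmul_right[of n F _ X] using R[OF kl] by (simp only: sum_unit_mat)
next
  assume X: "X \<in> supported R \<and>
    (\<forall>k l. R k l \<longrightarrow> (\<Sum>i<n. X i k * F i l) = (\<Sum>j<n. F k j * X l j))"
  have "pairing n F (mmul n X Y) = pairing n F (mmul n Y X)" if Y: "Y \<in> supported R" for Y
    unfolding pairing_mmul_left[of n F X] pairing_mmul_right[of n F _ X]
  proof (intro sum.cong refl)
    fix k l show "Y k l * (\<Sum>i<n. X i k * F i l) = Y k l * (\<Sum>j<n. F k j * X l j)"
      using X supported_zero[OF Y] by (cases "R k l") auto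
  qed
  then show "X \<in> rad n R F" using X by (auto simp: rad_def)
qed

section \<open>Dependence of the radical on the form\<close>

definition commutator_form :: "nat \<Rightarrow> cmat \<Rightarrow> cmat \<Rightarrow> cmat \<Rightarrow> complex" where
  "commutator_form n F X Y = pairing n F (mmul n X Y) - pairing n F (mmul n Y X)"

lemma commutator_form_bilinear:
  "commutator_form n F (X + X') Y = commutator_form n F X Y + commutator_form n F X' Y"
  "commutator_form n F (mscale c X) Y = c * commutator_form n F X Y"
  "commutator_form n F X (Y + Y') = commutator_form n F X Y + commutator_form n F X Y'"
  "commutator_form n F X (mscale c Y) = c * commutator_form n F X Y"
  unfolding commutator_form_def mmul_add mmul_scale pairing_add pairing_scale by (simp_all add: algebra_simps)

lemma rad_commutator_form:
  "rad n R F = {X\<in>supported R. \<forall>Y\<in>supported R. commutator_form n F X Y = 0}"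
  by (simp add: rad_def commutator_form_def)

lemma commutator_form_perturb:
  "commutator_form n (F + mscale t G) X Y = commutator_form n F X Y + t * commutator_form n G X Y"
  by (simp add: commutator_form_def pairing_def mscale_def distrib_right sum.distrib
      sum_distrib_left algebra_simps)

lemma subspace_rad: "cm.subspace (rad n R F)"
proof -
  have z: "commutator_form n F 0 Y = 0" for Y using commutator_form_bilinear(2)[of n F 0 0 Y] by simp
  show ?thesis
    using subspace_supported[of R] unfolding cm.subspace_def rad_commutator_form
    by (auto simp only: mem_Collect_eq commutator_form_bilinear z) simp_all
qed

lemma rad_subset: "rad n R F \<subseteq> supported R"
  by (auto simp: rad_def)

text \<open>Take a dual system for \<open>F\<close> whose size \<open>r\<close> is the codimension
  of the radical. For \<open>F + t G\<close> its Gram matrix is the identity plus \<open>t\<close>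
  times a fixed matrix, which is still invertible for small \<open>t\<close>, so the codimension
  cannot fall.\<close>

lemma dim_rad_perturb:
  assumes fin: "finite {(i, j). R i j}"
  shows "\<exists>e>0. \<forall>t. norm t < e \<longrightarrow> cm.dim (rad n R (F + mscale t G)) \<le> cm.dim (rad n R F)"
proof -
  let ?S = "supported R"
  note S = subspace_supported[of R] findim_supported[OF fin]
  define r where "r = cm.dim ?S - cm.dim (rad n R F)"
  have le: "cm.dim (rad n R F) \<le> cm.dim ?S" by (rule cm.findim_dim_mono[OF rad_subset S(2)])
  have "\<exists>x y. (\<forall>i<r. x i \<in> ?S \<and> y i \<in> ?S) \<and>
      (\<forall>i<r. \<forall>j<r. commutator_form n F (x i) (y j) = (if i = (j::nat) then 1 else 0))"
  proof (rule cm.dual_system[OF S])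
    show "cm.dim {X \<in> ?S. \<forall>Y\<in>?S. commutator_form n F X Y = 0} + r \<le> cm.dim ?S"
      using le unfolding rad_commutator_form r_def by simp
  qed (rule commutator_form_bilinear)+
  then obtain x y where xy: "\<And>i. i < r \<Longrightarrow> x i \<in> ?S" "\<And>i. i < r \<Longrightarrow> y i \<in> ?S"
    and B: "\<And>i j. i < r \<Longrightarrow> j < r \<Longrightarrow> commutator_form n F (x i) (y j) = (if i = j then 1 else 0)"
    by blast
  let ?N = "\<lambda>i j. commutator_form n G (x i) (y j)"
  define M where "M = (\<Sum>i<r. \<Sum>j<r. norm (?N i j))"
  have M: "norm (?N i j) \<le> M" if "i < r" "j < r" for i j
  proof -
    have "norm (?N i j) \<le> (\<Sum>j<r. norm (?N i j))" using that by (intro member_le_sum) auto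
    also have "\<dots> \<le> M" unfolding M_def using that by (intro member_le_sum) (auto intro: sum_nonneg)
    finally show ?thesis .
  qed
  have "M \<ge> 0" unfolding M_def by (intro sum_nonneg) auto
  define e where "e = 1 / (real r * M + 1)"
  have "e > 0" using \<open>M \<ge> 0\<close> by (auto simp: e_def add_nonneg_pos)
  moreover have "cm.dim (rad n R (F + mscale t G)) \<le> cm.dim (rad n R F)" if t: "norm t < e" for t
  proof -
    have "norm t * (real r * M + 1) < 1"
      using t \<open>M \<ge> 0\<close> unfolding e_def by (simp add: pos_less_divide_eq add_nonneg_pos)
    then have small: "norm t * real r * M < 1" by (simp add: algebra_simps) (smt (verit) norm_ge_zero)
    have "cm.dim {X\<in>?S. \<forall>Y\<in>?S. commutator_form n (F + mscale t G) X Y = 0} + r \<le> cm.dim ?S"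
    proof (rule cm.dim_annihilator_dual_system[OF S, where x = x and y = y])
      fix c assume "\<And>j. j < r \<Longrightarrow> (\<Sum>i<r. c i * commutator_form n (F + mscale t G) (x i) (y j)) = 0"
      then have "\<And>j. j < r \<Longrightarrow> (\<Sum>i<r. c i * ((if i = j then 1 else 0) + t * ?N i j)) = 0"
        by (simp add: commutator_form_perturb B)
      then show "\<forall>i<r. c i = 0" using diagonally_dominant_kernel[of r ?N, OF M small] by blast
    qed (rule commutator_form_bilinear | erule xy)+
    then show ?thesis using le by (simp add: rad_commutator_form[of n R "F + mscale t G"] r_def)
  qed
  ultimately show ?thesis by blast
qed

text \<open>The unit of the algebra of \<open>R\<close>. It may differ from the
  \<open>n\<close>-by-\<open>n\<close> identity, because in the reduction \<open>R\<close> occupies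
  only some of the indices below \<open>n\<close>.\<close>

definition restrict_unit :: "(nat \<Rightarrow> nat \<Rightarrow> bool) \<Rightarrow> cmat" where
  "restrict_unit R = (\<lambda>i j. if i = j \<and> R i i then 1 else 0)"

lemma mmul_restrict_unit:
  assumes R: "\<And>i j. R i j \<Longrightarrow> i < n \<and> j < n \<and> R i i \<and> R j j" and X: "X \<in> supported R"
  shows "mmul n (restrict_unit R) X = X" "mmul n X (restrict_unit R) = X"
proof -
  have "(\<Sum>k<n. restrict_unit R i k * X k j) = X i j" for i j
  proof (cases "R i j")
    case True
    have "(\<Sum>k<n. restrict_unit R i k * X k j) = (\<Sum>k<n. if k = i then X i j else 0)"
      using R[OF True] by (intro sum.cong) (auto simp: restrict_unit_def)
    then show ?thesis using R[OF True] by simp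
  next
    case False
    then have "restrict_unit R i k * X k j = 0" for k
      using supported_zero[OF X False] by (auto simp: restrict_unit_def)
    then show ?thesis using supported_zero[OF X False] by (simp only: sum.neutral_const)
  qed
  then show "mmul n (restrict_unit R) X = X" by (simp add: mmul_def)
  have "(\<Sum>k<n. X i k * restrict_unit R k j) = X i j" for i j
  proof (cases "R i j")
    case True
    have "(\<Sum>k<n. X i k * restrict_unit R k j) = (\<Sum>k<n. if k = j then X i j else 0)"
      using R[OF True] by (intro sum.cong) (auto simp: restrict_unit_def)
    then show ?thesis using R[OF True] by simp
  next
    case False
    then have "X i k * restrict_unit R k j = 0" for k
      using supported_zero[OF X False] by (auto simp: restrict_unit_def)
    then show ?thesis using supported_zero[OF X False] by (simp only: sum.neutral_const)
  qed
  then show "mmul n X (restrict_unit R) = X" by (simp add: mmul_def)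
qed

text \<open>The form \<open>X \<mapsto> f (g X h)\<close> for \<open>f = pairing n F\<close>; when
  \<open>h\<close> is inverse to \<open>g\<close>, it is a coadjoint translate of
  \<open>f\<close>.\<close>

definition conj_form :: "nat \<Rightarrow> cmat \<Rightarrow> cmat \<Rightarrow> cmat \<Rightarrow> cmat" where
  "conj_form n g h F = (\<lambda>i j. \<Sum>k<n. \<Sum>l<n. F k l * g k i * h j l)"

lemma pairing_conj_form: "pairing n (conj_form n g h F) X = pairing n F (mmul n (mmul n g X) h)"
proof -
  have "pairing n F (mmul n (mmul n g X) h)
      = (\<Sum>k<n. \<Sum>l<n. \<Sum>j<n. \<Sum>i<n. F k l * g k i * h j l * X i j)"
    by (simp add: pairing_def mmul_def sum_distrib_left sum_distrib_right mult_ac)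
  also have "\<dots> = (\<Sum>k<n. \<Sum>j<n. \<Sum>l<n. \<Sum>i<n. F k l * g k i * h j l * X i j)"
    by (rule sum.cong[OF refl], rule sum.swap)
  also have "\<dots> = (\<Sum>j<n. \<Sum>k<n. \<Sum>l<n. \<Sum>i<n. F k l * g k i * h j l * X i j)"
    by (rule sum.swap)
  also have "\<dots> = (\<Sum>j<n. \<Sum>k<n. \<Sum>i<n. \<Sum>l<n. F k l * g k i * h j l * X i j)"
    by (rule sum.cong[OF refl], rule sum.cong[OF refl], rule sum.swap)
  also have "\<dots> = (\<Sum>j<n. \<Sum>i<n. \<Sum>k<n. \<Sum>l<n. F k l * g k i * h j l * X i j)"
    by (rule sum.cong[OF refl], rule sum.swap)
  also have "\<dots> = (\<Sum>i<n. \<Sum>j<n. \<Sum>k<n. \<Sum>l<n. F k l * g k i * h j l * X i j)"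
    by (rule sum.swap)
  finally show ?thesis by (simp add: pairing_def conj_form_def sum_distrib_right)
qed

lemma linear_mmul_both: "Vector_Spaces.linear mscale mscale (\<lambda>X. mmul n (mmul n g X) h)"
  by unfold_locales (simp_all add: mmul_add mmul_scale)

text \<open>The map \<open>X \<mapsto> g X h\<close> is an automorphism of the algebra and carries
  the radical of the conjugated form injectively into that of \<open>F\<close>. This is the
  direction that a lower bound needs when it replaces \<open>F\<close> by a normal form.\<close>

lemma dim_rad_conj:
  assumes R: "\<And>i j. R i j \<Longrightarrow> i < n \<and> j < n \<and> R i i \<and> R j j" "\<And>i j k. R i j \<Longrightarrow> R j k \<Longrightarrow> R i k"
    and g: "g \<in> supported R" "h \<in> supported R"
    and inv: "mmul n g h = restrict_unit R" "mmul n h g = restrict_unit R"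
  shows "cm.dim (rad n R (conj_form n g h F)) \<le> cm.dim (rad n R F)"
proof (rule cm.dim_le_injective[OF linear_mmul_both[of n g h] subspace_rad])
  have fin: "finite {(i, j). R i j}"
    by (rule finite_subset[of _ "{..<n} \<times> {..<n}"]) (use R in auto)
  show "cm.findim (rad n R F)" by (rule cm.findim_subset[OF rad_subset findim_supported[OF fin]])
  have sup: "mmul n X Y \<in> supported R" if "X \<in> supported R" "Y \<in> supported R" for X Y
    using mmul_supported[OF that] R(2) by blast
  note un = mmul_restrict_unit[of R n, OF R(1)]
  show "(\<lambda>X. mmul n (mmul n g X) h) ` rad n R (conj_form n g h F) \<subseteq> rad n R F"
  proof clarify
    fix X assume X: "X \<in> rad n R (conj_form n g h F)"
    then have Xs: "X \<in> supported R" by (simp add: rad_def)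
    show "mmul n (mmul n g X) h \<in> rad n R F"
      unfolding rad_def
    proof (intro CollectI conjI ballI)
      show "mmul n (mmul n g X) h \<in> supported R" using g Xs sup by simp
      fix Y assume Y: "Y \<in> supported R"
      let ?Y = "mmul n (mmul n h Y) g"
      have Ys: "?Y \<in> supported R" using g Y sup by simp
      have YY: "mmul n (mmul n g ?Y) h = Y"
      proof -
        have "mmul n (mmul n g ?Y) h = mmul n (mmul n (mmul n g h) Y) (mmul n g h)"
          by (simp add: mmul_assoc)
        then show ?thesis using inv un Y by simp
      qed
      have 1: "mmul n (mmul n g (mmul n X ?Y)) h = mmul n (mmul n (mmul n g X) h) Y"
      proof -
        have "mmul n (mmul n g (mmul n X ?Y)) h = mmul n (mmul n g X) (mmul n h (mmul n Y (mmul n g h)))"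
          by (simp add: mmul_assoc)
        then show ?thesis using inv un Y by (simp add: mmul_assoc)
      qed
      have 2: "mmul n (mmul n g (mmul n ?Y X)) h = mmul n Y (mmul n (mmul n g X) h)"
      proof -
        have "mmul n (mmul n g (mmul n ?Y X)) h = mmul n (mmul n g h) (mmul n Y (mmul n (mmul n g X) h))"
          by (simp add: mmul_assoc)
        then show ?thesis using inv un(1)[of "mmul n Y (mmul n (mmul n g X) h)"] Y Xs g sup by simp
      qed
      show "pairing n F (mmul n (mmul n (mmul n g X) h) Y) = pairing n F (mmul n Y (mmul n (mmul n g X) h))"
      proof -
        have "pairing n (conj_form n g h F) (mmul n X ?Y) = pairing n (conj_form n g h F) (mmul n ?Y X)"
          using X Ys unfolding rad_def by blast
        then show ?thesis unfolding pairing_conj_form 1 2 .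
      qed
    qed
  qed
  fix X assume X: "X \<in> rad n R (conj_form n g h F)" and z: "mmul n (mmul n g X) h = 0"
  have Xs: "X \<in> supported R" using X by (simp add: rad_def)
  have "X = mmul n (mmul n h g) (mmul n X (mmul n h g))" using inv un Xs by simp
  also have "\<dots> = mmul n h (mmul n (mmul n (mmul n g X) h) g)" by (simp add: mmul_assoc)
  also have "\<dots> = 0" unfolding z by (simp add: mmul_def fun_eq_iff)
  finally show "X = 0" .
qed

section \<open>One step of the reduction\<close>

text \<open>\<open>P\<close> and \<open>D\<close> are the row and column indices of the corner, matched by \<open>\<tau>\<close>, \<open>M\<close> are the indices
  between them in the same block and \<open>N\<close> the indices after them. In \<open>R'\<close> the rows \<open>P\<close> are gone, and the
  positions \<open>M \<times> P\<close> have replaced \<open>M \<times> D\<close>.\<close>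

locale meander_step =
  fixes n :: nat and P M D N :: "nat set" and \<tau> \<upsilon> :: "nat \<Rightarrow> nat"
    and R R' :: "nat \<Rightarrow> nat \<Rightarrow> bool"
  assumes sub: "P \<union> M \<union> D \<union> N \<subseteq> {..<n}"
    and disj: "P \<inter> M = {}" "P \<inter> D = {}" "P \<inter> N = {}" "M \<inter> D = {}" "M \<inter> N = {}" "D \<inter> N = {}"
    and \<tau>: "\<And>j. j \<in> D \<Longrightarrow> \<tau> j \<in> P" "\<And>j. j \<in> D \<Longrightarrow> \<upsilon> (\<tau> j) = j"
    and \<upsilon>: "\<And>i. i \<in> P \<Longrightarrow> \<upsilon> i \<in> D" "\<And>i. i \<in> P \<Longrightarrow> \<tau> (\<upsilon> i) = i"
    and R_dom: "\<And>i j. R i j \<Longrightarrow> i \<in> P \<union> M \<union> D \<union> N \<and> j \<in> P \<union> M \<union> D \<union> N"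
    and R_row_P: "\<And>i j. i \<in> P \<Longrightarrow> R i j \<longleftrightarrow> j \<in> P \<union> M \<union> D"
    and R_col_P: "\<And>i j. R i j \<Longrightarrow> j \<in> P \<Longrightarrow> i \<in> P \<union> M"
    and R_MD: "\<And>i j. i \<in> M \<Longrightarrow> j \<in> D \<Longrightarrow> R i j"
    and R_col_N: "\<And>i j. R i j \<Longrightarrow> j \<in> N \<Longrightarrow> i \<in> N"
    and R_alt: "\<And>i j k l. R i j \<Longrightarrow> i \<in> M \<Longrightarrow> j \<in> P \<Longrightarrow> k \<in> D \<union> N \<Longrightarrow> l \<in> M \<Longrightarrow> \<not> R k l"
    and R': "\<And>i j. R' i j \<longleftrightarrow> i \<in> M \<union> D \<union> N \<and> j \<in> M \<union> D \<union> N \<and>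
        (if i \<in> M \<and> j \<in> D then R i (\<tau> j) else R i j)"
begin

lemma fin: "finite P" "finite M" "finite D" "finite N"
  using sub finite_subset[of _ "{..<n}"] by blast+

lemma R_less: "R i j \<Longrightarrow> i < n \<and> j < n"
  using R_dom sub by blast

lemma R'_less: "R' i j \<Longrightarrow> i < n \<and> j < n"
  using R' sub by blast

lemma mem_disj:
  "i \<in> P \<Longrightarrow> i \<notin> M" "i \<in> P \<Longrightarrow> i \<notin> D" "i \<in> P \<Longrightarrow> i \<notin> N"
  "i \<in> M \<Longrightarrow> i \<notin> P" "i \<in> M \<Longrightarrow> i \<notin> D" "i \<in> M \<Longrightarrow> i \<notin> N"
  "i \<in> D \<Longrightarrow> i \<notin> P" "i \<in> D \<Longrightarrow> i \<notin> M" "i \<in> D \<Longrightarrow> i \<notin> N"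
  "i \<in> N \<Longrightarrow> i \<notin> P" "i \<in> N \<Longrightarrow> i \<notin> M" "i \<in> N \<Longrightarrow> i \<notin> D"
  using disj by blast+

lemma only_P: "i \<in> P \<Longrightarrow> i \<notin> M \<and> i \<notin> D \<and> i \<notin> N"
  and only_M: "i \<in> M \<Longrightarrow> i \<notin> P \<and> i \<notin> D \<and> i \<notin> N"
  and only_D: "i \<in> D \<Longrightarrow> i \<notin> P \<and> i \<notin> M \<and> i \<notin> N"
  and only_N: "i \<in> N \<Longrightarrow> i \<notin> P \<and> i \<notin> M \<and> i \<notin> D"
  using disj by blast+

lemma sum_split:
  fixes g :: "nat \<Rightarrow> complex"
  assumes "\<And>i. i \<notin> P \<union> M \<union> D \<union> N \<Longrightarrow> g i = 0"
  shows "(\<Sum>i<n. g i) = sum g P + sum g M + sum g D + sum g N"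
proof -
  have "(\<Sum>i<n. g i) = sum g (P \<union> M \<union> D \<union> N)"
    by (rule sum.mono_neutral_right) (use sub assms in auto)
  also have "\<dots> = sum g (P \<union> M \<union> D) + sum g N"
    by (rule sum.union_disjoint) (use fin disj in auto)
  also have "sum g (P \<union> M \<union> D) = sum g (P \<union> M) + sum g D"
    by (rule sum.union_disjoint) (use fin disj in auto)
  also have "sum g (P \<union> M) = sum g P + sum g M"
    by (rule sum.union_disjoint) (use fin disj in auto)
  finally show ?thesis .
qed

lemma sum_P: "(\<Sum>i\<in>P. g i) = (\<Sum>j\<in>D. g (\<tau> j))" for g :: "nat \<Rightarrow> complex"
  by (rule sum.reindex_bij_witness[of _ \<tau> \<upsilon>]) (use \<tau> \<upsilon> in auto)

text \<open>The positions \<open>M \<times> D\<close> take over what stood at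
  \<open>M \<times> P\<close>, with columns renamed by \<open>\<tau>\<close>; the old entries at
  \<open>M \<times> D\<close> and the rows of \<open>P\<close> are dropped.\<close>

definition contract :: "cmat \<Rightarrow> cmat" where
  "contract X = (\<lambda>i j. if i \<in> M \<and> j \<in> D then X i (\<tau> j)
     else if i \<in> M \<union> D \<union> N \<and> j \<in> M \<union> D \<union> N then X i j else 0)"

lemma contract_supported: "X \<in> supported R \<Longrightarrow> contract X \<in> supported R'"
  unfolding supported_def contract_def R' using disj by auto

lemma zero_P_col: "X \<in> supported R \<Longrightarrow> i \<in> D \<union> N \<Longrightarrow> j \<in> P \<Longrightarrow> X i j = 0"
  using R_col_P[of i j] mem_disj supported_zero by blast

lemma zero_N_col: "X \<in> supported R \<Longrightarrow> i \<in> P \<union> M \<union> D \<Longrightarrow> j \<in> N \<Longrightarrow> X i j = 0"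
  using R_col_N[of i j] mem_disj supported_zero by blast

lemma zero_dom: "X \<in> supported R \<Longrightarrow> i \<notin> P \<union> M \<union> D \<union> N \<or> j \<notin> P \<union> M \<union> D \<union> N \<Longrightarrow> X i j = 0"
  using R_dom[of i j] supported_zero by blast

end

text \<open>Normal form of a functional. With this identity and these zeros, each equation of the
  radical in a row of \<open>P\<close> or at \<open>M \<times> D\<close> contains exactly one entry
  lost under \<open>contract\<close>, with coefficient 1, and can be solved for it.\<close>

locale meander_step_form = meander_step +
  fixes F :: cmat
  assumes F: "F \<in> supported R"
    and F_PD: "\<And>i j. i \<in> P \<Longrightarrow> j \<in> D \<Longrightarrow> F i j = (if i = \<tau> j then 1 else 0)"
    and F_PP: "\<And>i j. i \<in> P \<Longrightarrow> j \<in> P \<Longrightarrow> F i j = 0"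
    and F_PM: "\<And>i j. i \<in> P \<Longrightarrow> j \<in> M \<Longrightarrow> F i j = 0"
    and F_MD: "\<And>i j. i \<in> M \<Longrightarrow> j \<in> D \<Longrightarrow> F i j = 0"
begin

lemmas F_zero = zero_P_col[OF F] zero_N_col[OF F] zero_dom[OF F] F_PP F_PM F_MD

definition lhs :: "cmat \<Rightarrow> nat \<Rightarrow> nat \<Rightarrow> complex" where
  "lhs X k l = (\<Sum>i<n. X i k * F i l)"

definition rhs :: "cmat \<Rightarrow> nat \<Rightarrow> nat \<Rightarrow> complex" where
  "rhs X k l = (\<Sum>j<n. F k j * X l j)"

lemma lhs_split: "lhs X k l = (\<Sum>i\<in>P. X i k * F i l) + (\<Sum>i\<in>M. X i k * F i l) + (\<Sum>i\<in>D. X i k * F i l) + (\<Sum>i\<in>N. X i k * F i l)"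
  unfolding lhs_def by (rule sum_split) (simp add: F_zero)

lemma rhs_split: "rhs X k l = (\<Sum>j\<in>P. F k j * X l j) + (\<Sum>j\<in>M. F k j * X l j) + (\<Sum>j\<in>D. F k j * X l j) + (\<Sum>j\<in>N. F k j * X l j)"
  unfolding rhs_def by (rule sum_split) (simp add: F_zero)

lemma lhs_P: "l \<in> P \<Longrightarrow> lhs X k l = (\<Sum>i\<in>M. X i k * F i l)"
  unfolding lhs_split by (simp add: F_zero)

lemma lhs_M: "l \<in> M \<Longrightarrow> lhs X k l = (\<Sum>i\<in>M. X i k * F i l) + (\<Sum>i\<in>D. X i k * F i l) + (\<Sum>i\<in>N. X i k * F i l)"
  unfolding lhs_split by (simp add: F_zero)

lemma lhs_D: "l \<in> D \<Longrightarrow> lhs X k l = X (\<tau> l) k + (\<Sum>i\<in>D. X i k * F i l) + (\<Sum>i\<in>N. X i k * F i l)"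
proof -
  assume l: "l \<in> D"
  have "(\<Sum>i\<in>P. X i k * F i l) = (\<Sum>i\<in>P. if i = \<tau> l then X (\<tau> l) k else 0)"
    using l by (intro sum.cong) (auto simp: F_PD)
  then show ?thesis unfolding lhs_split using l \<tau> fin by (simp add: F_zero)
qed

lemma lhs_N: "l \<in> N \<Longrightarrow> lhs X k l = (\<Sum>i\<in>N. X i k * F i l)"
  unfolding lhs_split by (simp add: F_zero)

lemma rhs_P: "k \<in> P \<Longrightarrow> rhs X k l = X l (\<upsilon> k)"
proof -
  assume k: "k \<in> P"
  have "(\<Sum>j\<in>D. F k j * X l j) = (\<Sum>j\<in>D. if j = \<upsilon> k then X l (\<upsilon> k) else 0)"
    using k \<tau> \<upsilon> by (intro sum.cong) (auto simp: F_PD)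
  then show ?thesis unfolding rhs_split using k \<upsilon> fin by (simp add: F_zero)
qed

lemma rhs_M: "k \<in> M \<Longrightarrow> rhs X k l = (\<Sum>j\<in>P. F k j * X l j) + (\<Sum>j\<in>M. F k j * X l j)"
  unfolding rhs_split by (simp add: F_zero)

lemma rhs_D: "k \<in> D \<Longrightarrow> rhs X k l = (\<Sum>j\<in>M. F k j * X l j) + (\<Sum>j\<in>D. F k j * X l j)"
  unfolding rhs_split by (simp add: F_zero)

lemma rhs_N: "k \<in> N \<Longrightarrow> rhs X k l = (\<Sum>j\<in>M. F k j * X l j) + (\<Sum>j\<in>D. F k j * X l j) + (\<Sum>j\<in>N. F k j * X l j)"
  unfolding rhs_split by (simp add: F_zero)

definition lhs' :: "cmat \<Rightarrow> nat \<Rightarrow> nat \<Rightarrow> complex" where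
  "lhs' X k l = (\<Sum>i<n. contract X i k * contract F i l)"

definition rhs' :: "cmat \<Rightarrow> nat \<Rightarrow> nat \<Rightarrow> complex" where
  "rhs' X k l = (\<Sum>j<n. contract F k j * contract X l j)"

lemma lhs'_split: "lhs' X k l = (\<Sum>i\<in>M. contract X i k * contract F i l)
    + (\<Sum>i\<in>D. contract X i k * contract F i l) + (\<Sum>i\<in>N. contract X i k * contract F i l)"
proof -
  have "(\<Sum>i\<in>P. contract X i k * contract F i l) = 0"
    using disj by (intro sum.neutral ballI) (simp add: contract_def, blast)
  moreover have "contract X i k * contract F i l = 0" if "i \<notin> P \<union> M \<union> D \<union> N" for i
    using that by (simp add: contract_def)
  then have "lhs' X k l = (\<Sum>i\<in>P. contract X i k * contract F i l) + (\<Sum>i\<in>M. contract X i k * contract F i l)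
    + (\<Sum>i\<in>D. contract X i k * contract F i l) + (\<Sum>i\<in>N. contract X i k * contract F i l)"
    unfolding lhs'_def by (rule sum_split)
  ultimately show ?thesis by simp
qed

lemma rhs'_split: "rhs' X k l = (\<Sum>j\<in>M. contract F k j * contract X l j)
    + (\<Sum>j\<in>D. contract F k j * contract X l j) + (\<Sum>j\<in>N. contract F k j * contract X l j)"
proof -
  have "(\<Sum>j\<in>P. contract F k j * contract X l j) = 0"
    using disj by (intro sum.neutral ballI) (simp add: contract_def, blast)
  moreover have "contract F k j * contract X l j = 0" if "j \<notin> P \<union> M \<union> D \<union> N" for j
    using that by (simp add: contract_def)
  then have "rhs' X k l = (\<Sum>j\<in>P. contract F k j * contract X l j) + (\<Sum>j\<in>M. contract F k j * contract X l j)
    + (\<Sum>j\<in>D. contract F k j * contract X l j) + (\<Sum>j\<in>N. contract F k j * contract X l j)"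
    unfolding rhs'_def by (rule sum_split)
  ultimately show ?thesis by simp
qed

text \<open>The equations for the entries of a radical element whose positions are lost in the contraction.\<close>

definition lost_entries :: "cmat \<Rightarrow> bool" where
  "lost_entries X \<longleftrightarrow>
     (\<forall>m\<in>M. \<forall>d\<in>D. X m d = (\<Sum>i\<in>M. X i (\<tau> d) * F i m)) \<and>
     (\<forall>m\<in>M. \<forall>d\<in>D. X (\<tau> d) m = (\<Sum>j\<in>M. F m j * X d j)
        - (\<Sum>i\<in>D. X i m * F i d) - (\<Sum>i\<in>N. X i m * F i d)) \<and>
     (\<forall>p\<in>P. \<forall>d\<in>D. X (\<tau> d) p = X d (\<upsilon> p)) \<and>
     (\<forall>p\<in>P. \<forall>q\<in>P. X q (\<upsilon> p) = (\<Sum>i\<in>M. X i p * F i q))"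

lemma lost_entriesD:
  assumes "lost_entries X"
  shows "m \<in> M \<Longrightarrow> d \<in> D \<Longrightarrow> X m d = (\<Sum>i\<in>M. X i (\<tau> d) * F i m)"
    "m \<in> M \<Longrightarrow> d \<in> D \<Longrightarrow> X (\<tau> d) m = (\<Sum>j\<in>M. F m j * X d j)
        - (\<Sum>i\<in>D. X i m * F i d) - (\<Sum>i\<in>N. X i m * F i d)"
    "p \<in> P \<Longrightarrow> d \<in> D \<Longrightarrow> X (\<tau> d) p = X d (\<upsilon> p)"
    "p \<in> P \<Longrightarrow> q \<in> P \<Longrightarrow> X q (\<upsilon> p) = (\<Sum>i\<in>M. X i p * F i q)"
  using assms unfolding lost_entries_def by blast+

lemma lost_entries_of_equations:
  assumes X: "X \<in> supported R" and E: "\<And>k l. R k l \<Longrightarrow> lhs X k l = rhs X k l"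
  shows "lost_entries X"
  unfolding lost_entries_def
proof (intro conjI ballI)
  note z = zero_P_col[OF X] zero_N_col[OF X]
  fix m d assume md: "m \<in> M" "d \<in> D"
  have "lhs X (\<tau> d) m = rhs X (\<tau> d) m" using E R_row_P \<tau> md by blast
  then show "X m d = (\<Sum>i\<in>M. X i (\<tau> d) * F i m)"
    using md \<tau> z by (simp add: lhs_M rhs_P)
  have "lhs X m d = rhs X m d" using E R_MD md by blast
  then show "X (\<tau> d) m = (\<Sum>j\<in>M. F m j * X d j) - (\<Sum>i\<in>D. X i m * F i d) - (\<Sum>i\<in>N. X i m * F i d)"
    using md \<tau> z by (simp add: lhs_D rhs_M algebra_simps)
next
  note z = zero_P_col[OF X] zero_N_col[OF X]
  fix p d assume md: "p \<in> P" "d \<in> D"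
  have "lhs X p d = rhs X p d" using E R_row_P md by blast
  then show "X (\<tau> d) p = X d (\<upsilon> p)" using md \<tau> z by (simp add: lhs_D rhs_P)
next
  fix p q assume md: "p \<in> P" "q \<in> P"
  have "lhs X p q = rhs X p q" using E R_row_P md by blast
  then show "X q (\<upsilon> p) = (\<Sum>i\<in>M. X i p * F i q)" using md by (simp add: lhs_P rhs_P)
qed

lemma contract_simps:
  "i \<in> M \<Longrightarrow> j \<in> D \<Longrightarrow> contract X i j = X i (\<tau> j)"
  "i \<in> M \<Longrightarrow> j \<in> M \<Longrightarrow> contract X i j = X i j"
  "i \<in> M \<Longrightarrow> j \<in> N \<Longrightarrow> contract X i j = X i j"
  "i \<in> D \<Longrightarrow> j \<in> M \<Longrightarrow> contract X i j = X i j"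
  "i \<in> D \<Longrightarrow> j \<in> D \<Longrightarrow> contract X i j = X i j"
  "i \<in> D \<Longrightarrow> j \<in> N \<Longrightarrow> contract X i j = X i j"
  "i \<in> N \<Longrightarrow> j \<in> M \<Longrightarrow> contract X i j = X i j"
  "i \<in> N \<Longrightarrow> j \<in> D \<Longrightarrow> contract X i j = X i j"
  "i \<in> N \<Longrightarrow> j \<in> N \<Longrightarrow> contract X i j = X i j"
  subgoal premises p using p only_M[OF p(1)] only_D[OF p(2)] by (simp add: contract_def)
  subgoal premises p using p only_M[OF p(1)] only_M[OF p(2)] by (simp add: contract_def)
  subgoal premises p using p only_M[OF p(1)] only_N[OF p(2)] by (simp add: contract_def)
  subgoal premises p using p only_D[OF p(1)] only_M[OF p(2)] by (simp add: contract_def)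
  subgoal premises p using p only_D[OF p(1)] only_D[OF p(2)] by (simp add: contract_def)
  subgoal premises p using p only_D[OF p(1)] only_N[OF p(2)] by (simp add: contract_def)
  subgoal premises p using p only_N[OF p(1)] only_M[OF p(2)] by (simp add: contract_def)
  subgoal premises p using p only_N[OF p(1)] only_D[OF p(2)] by (simp add: contract_def)
  subgoal premises p using p only_N[OF p(1)] only_N[OF p(2)] by (simp add: contract_def)
  done

text \<open>Both sides split into sums over \<open>P\<close>, \<open>M\<close>, \<open>D\<close> and
  \<open>N\<close>. Terms with lost entries are rewritten by \<open>lost_entries\<close>, and those
  that would spoil the match vanish by \<open>R_alt\<close>.\<close>

lemma contract_equations:
  assumes X: "X \<in> supported R" and L: "lost_entries X" and kl: "R' k l"
  shows "lhs' X k l = lhs X k (if k \<in> M \<and> l \<in> D then \<tau> l else l)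
       \<and> rhs' X k l = rhs X k (if k \<in> M \<and> l \<in> D then \<tau> l else l)"
proof -
  note z = zero_P_col[OF X] zero_N_col[OF X] F_zero
  note D = lost_entriesD[OF L]
  have alt: "X i j = 0" if "R k l" "k \<in> D \<union> N" "l \<in> M" "i \<in> M" "j \<in> P" for i j
    using R_alt[of i j k l] that supported_zero[OF X] by blast
  have alt': "X i j = 0" if "R m p" "m \<in> M" "p \<in> P" "i \<in> D \<union> N" "j \<in> M" for i j m p
    using R_alt[of m p i j] that supported_zero[OF X] by blast
  note kl' = kl[unfolded R']
  consider "k \<in> M" "l \<in> D" | "k \<in> M" "l \<in> M" | "k \<in> D" "l \<in> M" | "k \<in> N" "l \<in> M"
    | "k \<in> D" "l \<in> D" | "k \<in> N" "l \<in> D" | "k \<in> N" "l \<in> N"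
    using kl' R_col_N[of k l] disj by (smt (verit) Un_iff disjoint_iff)
  then show ?thesis
  proof cases
    case 1
    then have R: "R k (\<tau> l)" using kl' by simp
    note a = alt'[OF R 1(1) \<tau>(1)[OF 1(2)]]
    \<comment> \<open>An allowed position in \<open>M \<times> P\<close> empties
      \<open>(D \<union> N) \<times> M\<close>, and \<open>X (\<tau> l) j\<close> is a combination
      of entries there.\<close>
    have "X (\<tau> l) j = 0" if "j \<in> M" for j
      using D(2)[OF that 1(2)] a that 1 by simp
    then show ?thesis using 1 \<tau> a
      by (simp add: lhs'_split rhs'_split lhs_P rhs_M contract_simps sum_P D(3) z)
  next
    case 2
    have "l \<notin> D" using 2 mem_disj by blast
    then show ?thesis using 2
      by (simp add: lhs'_split rhs'_split lhs_M rhs_M contract_simps sum_P z)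
  next
    case 3
    have nM: "k \<notin> M" using 3 mem_disj by blast
    then have R: "R k l" using kl' by simp
    note a = alt[OF R _ 3(2), simplified]
    \<comment> \<open>Conversely, an allowed position in \<open>D \<times> M\<close> empties
      \<open>M \<times> P\<close>, and the entries at \<open>M \<times> D\<close> are combinations
      of those at \<open>M \<times> P\<close>.\<close>
    have "X i j = 0" if "i \<in> M" "j \<in> D" for i j
      using D(1)[OF that] a 3 \<tau> that by simp
    then show ?thesis using 3 nM \<tau> a
      by (simp add: lhs'_split rhs'_split lhs_M rhs_D contract_simps z)
  next
    case 4
    have nM: "k \<notin> M" using 4 mem_disj by blast
    then have R: "R k l" using kl' by simp
    note a = alt[OF R _ 4(2), simplified]
    have "X i j = 0" if "i \<in> M" "j \<in> D" for i j
      using D(1)[OF that] a 4 \<tau> that by simp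
    then show ?thesis using 4 nM \<tau> a
      by (simp add: lhs'_split rhs'_split lhs_M rhs_N contract_simps z)
  next
    case 5
    \<comment> \<open>This lost entry equals the sum over \<open>M\<close> that the renamed columns
      contribute to \<open>lhs'\<close>.\<close>
    have "X (\<tau> l) k = (\<Sum>i\<in>M. X i (\<tau> k) * F i (\<tau> l))"
      using D(4)[of "\<tau> k" "\<tau> l"] 5 \<tau> by simp
    moreover have "k \<notin> M" using 5 mem_disj by blast
    ultimately show ?thesis using 5 \<tau>
      by (simp add: lhs'_split rhs'_split lhs_D rhs_D contract_simps z)
  next
    case 6
    have "k \<notin> M" using 6 mem_disj by blast
    then show ?thesis using 6 \<tau>
      by (simp add: lhs'_split rhs'_split lhs_D rhs_N contract_simps z)
  next
    case 7
    have "k \<notin> M" using 7 mem_disj by blast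
    then show ?thesis using 7
      by (simp add: lhs'_split rhs'_split lhs_N rhs_N contract_simps z)
  qed
qed

lemma rad_equations: "X \<in> rad n R F \<longleftrightarrow> X \<in> supported R \<and> (\<forall>k l. R k l \<longrightarrow> lhs X k l = rhs X k l)"
  unfolding lhs_def rhs_def by (rule rad_iff) (use R_less in blast)

lemma rad_contract_equations: "contract X \<in> rad n R' (contract F) \<longleftrightarrow>
    contract X \<in> supported R' \<and> (\<forall>k l. R' k l \<longrightarrow> lhs' X k l = rhs' X k l)"
  unfolding lhs'_def rhs'_def by (rule rad_iff) (use R'_less in blast)

lemma rad_contract:
  assumes X: "X \<in> rad n R F"
  shows "contract X \<in> rad n R' (contract F)" "lost_entries X"
proof -
  have Xs: "X \<in> supported R" and E: "\<And>k l. R k l \<Longrightarrow> lhs X k l = rhs X k l"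
    using X rad_equations by blast+
  show L: "lost_entries X" by (rule lost_entries_of_equations[OF Xs E])
  have "lhs' X k l = rhs' X k l" if kl: "R' k l" for k l
  proof -
    have "R k (if k \<in> M \<and> l \<in> D then \<tau> l else l)" using kl by (auto simp: R')
    then show ?thesis using contract_equations[OF Xs L kl] E by simp
  qed
  then show "contract X \<in> rad n R' (contract F)"
    using contract_supported[OF Xs] by (simp add: rad_contract_equations)
qed

text \<open>The equations in rows of \<open>P\<close> and at \<open>M \<times> D\<close> are those
  solved by \<open>lost_entries\<close>; all others are equations of the contracted form, where
  those at \<open>M \<times> P\<close> appear at \<open>M \<times> D\<close>.\<close>

lemma rad_of_contract:
  assumes X: "X \<in> supported R" and L: "lost_entries X" and C: "contract X \<in> rad n R' (contract F)"
  shows "X \<in> rad n R F"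
proof -
  note z = zero_P_col[OF X] zero_N_col[OF X]
  note D = lost_entriesD[OF L]
  have E': "lhs X k l = rhs X k l" if "R' k l" "\<not> (k \<in> M \<and> l \<in> D)" for k l
  proof -
    have "lhs' X k l = rhs' X k l" using C that rad_contract_equations by blast
    then show ?thesis using contract_equations[OF X L that(1)] that(2) by simp
  qed
  have "lhs X k l = rhs X k l" if kl: "R k l" for k l
  proof -
    consider "k \<in> P" "l \<in> P" | "k \<in> P" "l \<in> M" | "k \<in> P" "l \<in> D" | "k \<in> M" "l \<in> P"
      | "k \<in> M" "l \<in> D" | "k \<in> M \<union> D \<union> N" "l \<in> M \<union> D \<union> N" "\<not> (k \<in> M \<and> l \<in> D)"
      using R_dom[OF kl] R_col_P[OF kl] R_col_N[OF kl] R_row_P[of k l] by blast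
    then show ?thesis
    proof cases
      case 1 then show ?thesis using D(4) by (simp add: lhs_P rhs_P)
    next
      case 2 then show ?thesis using D(1)[of l "\<upsilon> k"] \<upsilon> z by (simp add: lhs_M rhs_P)
    next
      case 3 then show ?thesis using D(3) z by (simp add: lhs_D rhs_P)
    next
      case 4
      then have R': "R' k (\<upsilon> l)" using kl \<upsilon> by (auto simp: R')
      then have "lhs' X k (\<upsilon> l) = rhs' X k (\<upsilon> l)" using C rad_contract_equations by blast
      then show ?thesis using contract_equations[OF X L R'] 4 \<upsilon> by simp
    next
      case 5 then show ?thesis using D(2) z by (simp add: lhs_D rhs_M)
    next
      case 6
      then have "R' k l" using kl by (auto simp: R')
      then show ?thesis using E' 6 by blast
    qed
  qed
  then show ?thesis using X rad_equations by blast
qed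

text \<open>Every lost entry is a linear expression in retained ones; so \<open>contract\<close> is
  injective on the radical.\<close>

lemma lost_entries_zero:
  assumes X: "X \<in> supported R" and L: "lost_entries X" and C: "contract X = 0"
  shows "X = 0"
proof -
  note D = lost_entriesD[OF L]
  have c: "contract X i j = 0" for i j using C by simp
  have MP: "X i j = 0" if "i \<in> M" "j \<in> P" for i j using contract_simps(1)[OF that(1), of "\<upsilon> j" X] c \<upsilon> that by simp
  have old: "X i j = 0" if "i \<in> M \<union> D \<union> N" "j \<in> M \<union> D \<union> N" "\<not> (i \<in> M \<and> j \<in> D)" for i j
    using c[of i j] that by (simp add: contract_def split: if_splits)
  have "X i j = 0" if R: "R i j" for i j
  proof -
    consider "i \<in> P" "j \<in> P" | "i \<in> P" "j \<in> M" | "i \<in> P" "j \<in> D" | "i \<in> M" "j \<in> P"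
      | "i \<in> M" "j \<in> D" | "i \<in> M \<union> D \<union> N" "j \<in> M \<union> D \<union> N" "\<not> (i \<in> M \<and> j \<in> D)"
      using R_dom[OF R] R_col_P[OF R] R_col_N[OF R] R_row_P[of i j] by blast
    then show ?thesis
    proof cases
      case 1 then show ?thesis using D(3)[of j "\<upsilon> i"] \<upsilon> old[of "\<upsilon> i" "\<upsilon> j"] mem_disj(8)[of "\<upsilon> i"] by simp
    next
      case 2
      then have d: "\<upsilon> i \<in> D" using \<upsilon> by simp
      have "(\<Sum>k\<in>M. F j k * X (\<upsilon> i) k) = 0" "(\<Sum>k\<in>D. X k j * F k (\<upsilon> i)) = 0" "(\<Sum>k\<in>N. X k j * F k (\<upsilon> i)) = 0"
        using d 2 mem_disj(5,8) by (auto intro!: sum.neutral old)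
      then show ?thesis using D(2)[of j "\<upsilon> i"] 2 \<upsilon> by simp
    next
      case 3 then show ?thesis using D(4)[of "\<tau> j" i] \<tau> MP by simp
    next
      case 4 then show ?thesis using MP by simp
    next
      case 5 then show ?thesis using D(1)[of i j] MP \<tau> by simp
    next
      case 6 then show ?thesis using old by blast
    qed
  qed
  then show ?thesis using supported_zero[OF X] by (intro ext) auto
qed

lemma linear_contract: "Vector_Spaces.linear mscale mscale contract"
  by unfold_locales (auto simp: contract_def mscale_def fun_eq_iff)

lemma findim_rad: "cm.findim (rad n R F)" and findim_rad': "cm.findim (rad n R' G)"
proof -
  have "finite {(i, j). R i j}" "finite {(i, j). R' i j}"
    by (rule finite_subset[of _ "{..<n} \<times> {..<n}"]; use R_less R'_less in auto)+
  then show "cm.findim (rad n R F)" "cm.findim (rad n R' G)"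
    using cm.findim_subset[OF rad_subset findim_supported] by blast+
qed

lemma dim_rad_le_contract: "cm.dim (rad n R F) \<le> cm.dim (rad n R' (contract F))"
  by (rule cm.dim_le_injective[OF linear_contract subspace_rad findim_rad'])
     (use rad_contract lost_entries_zero rad_subset in blast)+

text \<open>Inverse of \<open>contract\<close> on radicals: the lost entries are filled in from the
  equations of \<open>lost_entries\<close>, where \<open>X\<close> at \<open>M \<times> D\<close>
  stands for the entries at \<open>M \<times> P\<close>.\<close>

definition expand :: "cmat \<Rightarrow> cmat" where
  "expand X = (\<lambda>i j.
     if i \<in> P \<and> j \<in> P then X (\<upsilon> i) (\<upsilon> j)
     else if i \<in> P \<and> j \<in> M then (\<Sum>k\<in>M. F j k * X (\<upsilon> i) k)
       - (\<Sum>k\<in>D. X k j * F k (\<upsilon> i)) - (\<Sum>k\<in>N. X k j * F k (\<upsilon> i))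
     else if i \<in> P \<union> M \<and> j \<in> D then (\<Sum>k\<in>M. X k j * F k i)
     else if i \<in> M \<and> j \<in> P then X i (\<upsilon> j)
     else if i \<in> P \<or> j \<in> P then 0 else X i j)"

lemma linear_expand: "Vector_Spaces.linear mscale mscale expand"
  by unfold_locales
     (auto simp: expand_def mscale_def fun_eq_iff sum.distrib sum_distrib_left algebra_simps)

lemma expand_simps:
  "i \<in> P \<Longrightarrow> j \<in> P \<Longrightarrow> expand X i j = X (\<upsilon> i) (\<upsilon> j)"
  "i \<in> P \<Longrightarrow> j \<in> M \<Longrightarrow> expand X i j = (\<Sum>k\<in>M. F j k * X (\<upsilon> i) k)
       - (\<Sum>k\<in>D. X k j * F k (\<upsilon> i)) - (\<Sum>k\<in>N. X k j * F k (\<upsilon> i))"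
  "i \<in> P \<Longrightarrow> j \<in> D \<Longrightarrow> expand X i j = (\<Sum>k\<in>M. X k j * F k i)"
  "i \<in> M \<Longrightarrow> j \<in> D \<Longrightarrow> expand X i j = (\<Sum>k\<in>M. X k j * F k i)"
  "i \<in> M \<Longrightarrow> j \<in> P \<Longrightarrow> expand X i j = X i (\<upsilon> j)"
  "i \<in> M \<Longrightarrow> j \<in> M \<Longrightarrow> expand X i j = X i j"
  "i \<in> M \<Longrightarrow> j \<in> N \<Longrightarrow> expand X i j = X i j"
  "i \<in> D \<Longrightarrow> j \<in> M \<Longrightarrow> expand X i j = X i j"
  "i \<in> D \<Longrightarrow> j \<in> D \<Longrightarrow> expand X i j = X i j"
  "i \<in> D \<Longrightarrow> j \<in> N \<Longrightarrow> expand X i j = X i j"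
  "i \<in> N \<Longrightarrow> j \<in> M \<Longrightarrow> expand X i j = X i j"
  "i \<in> N \<Longrightarrow> j \<in> D \<Longrightarrow> expand X i j = X i j"
  "i \<in> N \<Longrightarrow> j \<in> N \<Longrightarrow> expand X i j = X i j"
  subgoal premises p using p only_P[OF p(1)] only_P[OF p(2)] by (simp add: expand_def)
  subgoal premises p using p only_P[OF p(1)] only_M[OF p(2)] by (simp add: expand_def)
  subgoal premises p using p only_P[OF p(1)] only_D[OF p(2)] by (simp add: expand_def)
  subgoal premises p using p only_M[OF p(1)] only_D[OF p(2)] by (simp add: expand_def)
  subgoal premises p using p only_M[OF p(1)] only_P[OF p(2)] by (simp add: expand_def)
  subgoal premises p using p only_M[OF p(1)] only_M[OF p(2)] by (simp add: expand_def)
  subgoal premises p using p only_M[OF p(1)] only_N[OF p(2)] by (simp add: expand_def)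
  subgoal premises p using p only_D[OF p(1)] only_M[OF p(2)] by (simp add: expand_def)
  subgoal premises p using p only_D[OF p(1)] only_D[OF p(2)] by (simp add: expand_def)
  subgoal premises p using p only_D[OF p(1)] only_N[OF p(2)] by (simp add: expand_def)
  subgoal premises p using p only_N[OF p(1)] only_M[OF p(2)] by (simp add: expand_def)
  subgoal premises p using p only_N[OF p(1)] only_D[OF p(2)] by (simp add: expand_def)
  subgoal premises p using p only_N[OF p(1)] only_N[OF p(2)] by (simp add: expand_def)
  done

lemma expand_supported:
  assumes X: "X \<in> supported R'"
  shows "expand X \<in> supported R"
  unfolding supported_def
proof (intro CollectI allI impI)
  fix i j assume nz: "expand X i j \<noteq> 0"
  consider "i \<in> P" "j \<in> P \<union> M \<union> D" | "i \<in> M" "j \<in> D" | "i \<in> M" "j \<in> P"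
    | "i \<notin> P" "j \<notin> P" "\<not> (i \<in> M \<and> j \<in> D)"
    using nz by (auto simp: expand_def split: if_splits)
  then show "R i j"
  proof cases
    case 1 then show ?thesis using R_row_P by blast
  next
    case 2 then show ?thesis using R_MD by blast
  next
    case 3
    then have "X i (\<upsilon> j) \<noteq> 0" using nz by (simp add: expand_simps)
    then have "R' i (\<upsilon> j)" using supported_zero[OF X] by blast
    then show ?thesis using 3 \<upsilon> by (simp add: R')
  next
    case 4
    then have "expand X i j = X i j" by (auto simp: expand_def)
    then have "R' i j" using nz supported_zero[OF X] by metis
    then show ?thesis using 4 by (auto simp: R')
  qed
qed

lemma contract_expand:
  assumes X: "X \<in> supported R'"
  shows "contract (expand X) = X"
proof (intro ext)
  fix i j
  show "contract (expand X) i j = X i j"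
  proof (cases "i \<in> M \<union> D \<union> N \<and> j \<in> M \<union> D \<union> N")
    case True
    then consider "i \<in> M" "j \<in> D" | "i \<in> M" "j \<in> M \<union> N" | "i \<in> D \<union> N" "j \<in> M \<union> D \<union> N" by blast
    then show ?thesis using \<tau> by cases (auto simp: contract_simps expand_simps)
  next
    case False
    then have "X i j = 0" using supported_zero[OF X] R' by blast
    then show ?thesis using False by (auto simp: contract_def)
  qed
qed

lemma lost_entries_expand: "lost_entries (expand X)"
  unfolding lost_entries_def
proof (intro conjI ballI)
  fix m d assume md: "m \<in> M" "d \<in> D"
  show "expand X m d = (\<Sum>i\<in>M. expand X i (\<tau> d) * F i m)"
    using md \<tau> by (simp add: expand_simps)
  show "expand X (\<tau> d) m = (\<Sum>j\<in>M. F m j * expand X d j)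
        - (\<Sum>i\<in>D. expand X i m * F i d) - (\<Sum>i\<in>N. expand X i m * F i d)"
    using md \<tau> by (simp add: expand_simps)
next
  fix p d assume "p \<in> P" "d \<in> D"
  then show "expand X (\<tau> d) p = expand X d (\<upsilon> p)" using \<tau> \<upsilon> by (simp add: expand_simps)
next
  fix p q assume "p \<in> P" "q \<in> P"
  then show "expand X q (\<upsilon> p) = (\<Sum>i\<in>M. expand X i p * F i q)" using \<upsilon> by (simp add: expand_simps)
qed

lemma dim_contract_le_rad: "cm.dim (rad n R' (contract F)) \<le> cm.dim (rad n R F)"
proof (rule cm.dim_le_injective[OF linear_expand subspace_rad findim_rad])
  show "expand ` rad n R' (contract F) \<subseteq> rad n R F"
  proof clarify
    fix X assume X: "X \<in> rad n R' (contract F)"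
    then have Xs: "X \<in> supported R'" using rad_subset by blast
    show "expand X \<in> rad n R F"
      by (rule rad_of_contract[OF expand_supported[OF Xs] lost_entries_expand])
         (simp add: contract_expand[OF Xs] X)
  qed
  fix X assume X: "X \<in> rad n R' (contract F)" and z: "expand X = 0"
  have "X = contract 0" using contract_expand[of X] X z rad_subset by auto
  then show "X = 0" by (simp add: contract_def fun_eq_iff)
qed

end

section \<open>Bringing an arbitrary form into normal form\<close>

definition clip :: "(nat \<Rightarrow> nat \<Rightarrow> bool) \<Rightarrow> cmat \<Rightarrow> cmat" where
  "clip R F = (\<lambda>i j. if R i j then F i j else 0)"

lemma clip_supported: "clip R F \<in> supported R"
  by (simp add: clip_def supported_def)

lemma pairing_clip: "X \<in> supported R \<Longrightarrow> pairing n (clip R F) X = pairing n F X"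
  unfolding pairing_def by (intro sum.cong refl) (auto simp: clip_def supported_def)

text \<open>By transitivity products stay supported on \<open>R\<close>, so the values of a form off
  \<open>R\<close> are never read. Conjugation can spoil the support of a form; clipping restores
  it.\<close>

lemma rad_clip:
  assumes "\<And>i j k. R i j \<Longrightarrow> R j k \<Longrightarrow> R i k"
  shows "rad n R (clip R F) = rad n R F"
  unfolding rad_def using mmul_supported[of _ R _ n, OF _ _ assms] by (auto simp: pairing_clip)

locale finite_preorder =
  fixes n :: nat and R :: "nat \<Rightarrow> nat \<Rightarrow> bool"
  assumes R_less': "\<And>i j. R i j \<Longrightarrow> i < n \<and> j < n"
    and R_refl: "\<And>i j. R i j \<Longrightarrow> R i i \<and> R j j"
    and R_trans: "\<And>i j k. R i j \<Longrightarrow> R j k \<Longrightarrow> R i k"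
begin

lemma dim_rad_conj_clip:
  assumes "g \<in> supported R" "h \<in> supported R"
    and "mmul n g h = restrict_unit R" "mmul n h g = restrict_unit R"
  shows "cm.dim (rad n R (clip R (conj_form n g h F))) \<le> cm.dim (rad n R F)"
proof -
  have "rad n R (clip R X) = rad n R X" for X by (rule rad_clip) (rule R_trans)
  moreover have "cm.dim (rad n R (conj_form n g h F)) \<le> cm.dim (rad n R F)"
  proof (rule dim_rad_conj[OF _ _ assms])
    show "R i j \<Longrightarrow> i < n \<and> j < n \<and> R i i \<and> R j j" for i j using R_less'[of i j] R_refl[of i j] by simp
  qed (rule R_trans)
  ultimately show ?thesis by simp
qed

lemma restrict_unit_supported: "restrict_unit R \<in> supported R"
  by (auto simp: restrict_unit_def supported_def)

text \<open>As \<open>Z\<close> squares to zero, \<open>1 + Z\<close> has the inverse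
  \<open>1 - Z\<close>; the formula for \<open>F'\<close> is the expanded conjugation by this
  pair.\<close>

lemma dim_rad_shear:
  assumes Z: "Z \<in> supported R" "mmul n Z Z = 0"
  obtains F' where "F' \<in> supported R" "cm.dim (rad n R F') \<le> cm.dim (rad n R F)"
    "\<forall>i j. R i j \<longrightarrow> F' i j = F i j + (\<Sum>k<n. F k j * Z k i) - (\<Sum>l<n. F i l * Z j l)
       - (\<Sum>k<n. \<Sum>l<n. F k l * Z k i * Z j l)"
proof -
  let ?u = "restrict_unit R"
  define g where "g = ?u + Z"
  define h where "h = ?u + mscale (- 1) Z"
  note u = restrict_unit_supported
  have un: "mmul n ?u X = X" "mmul n X ?u = X" if "X \<in> supported R" for X
    using mmul_restrict_unit[of R n X] R_less' R_refl that by blast+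
  have gh: "g \<in> supported R" "h \<in> supported R"
    unfolding g_def h_def using u Z(1) subspace_supported cm.subspace_add cm.subspace_scale by blast+
  have inv: "mmul n g h = ?u" "mmul n h g = ?u"
    unfolding g_def h_def mmul_add mmul_scale un[OF u] un[OF Z(1)] Z(2) by (simp_all add: mscale_def fun_eq_iff)
  show ?thesis
  proof (rule that[OF clip_supported dim_rad_conj_clip[OF gh inv]], intro allI impI)
    fix i j assume ij: "R i j"
    have i: "R i i" "i < n" and j: "R j j" "j < n" using ij R_refl R_less' by blast+
    have hsum: "(\<Sum>l<n. F k l * h j l) = F k j - (\<Sum>l<n. F k l * Z j l)" for k
    proof -
      have "(\<Sum>l<n. F k l * h j l) = (\<Sum>l<n. (if l = j then F k j else 0) - F k l * Z j l)"
        using j by (intro sum.cong) (auto simp: h_def mscale_def restrict_unit_def algebra_simps)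
      then show ?thesis using j by (simp add: sum_subtractf)
    qed
    have "conj_form n g h F i j = (\<Sum>k<n. g k i * (\<Sum>l<n. F k l * h j l))"
      unfolding conj_form_def by (simp add: sum_distrib_left mult_ac)
    also have "\<dots> = (\<Sum>k<n. (if k = i then F i j - (\<Sum>l<n. F i l * Z j l) else 0)
         + Z k i * (F k j - (\<Sum>l<n. F k l * Z j l)))"
      unfolding hsum using i by (intro sum.cong) (auto simp: g_def restrict_unit_def algebra_simps)
    also have "\<dots> = F i j - (\<Sum>l<n. F i l * Z j l) + (\<Sum>k<n. Z k i * (F k j - (\<Sum>l<n. F k l * Z j l)))"
      using i by (simp add: sum.distrib)
    also have "(\<Sum>k<n. Z k i * (F k j - (\<Sum>l<n. F k l * Z j l)))
        = (\<Sum>k<n. F k j * Z k i) - (\<Sum>k<n. \<Sum>l<n. F k l * Z k i * Z j l)"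
      by (simp add: right_diff_distrib sum_subtractf sum_distrib_left mult_ac)
    finally show "clip R (conj_form n g h F) i j = F i j + (\<Sum>k<n. F k j * Z k i) - (\<Sum>l<n. F i l * Z j l)
       - (\<Sum>k<n. \<Sum>l<n. F k l * Z k i * Z j l)"
      using ij by (simp add: clip_def)
  qed
qed

end

locale meander_step_preorder = meander_step n P M D N \<tau> \<upsilon> R R' + finite_preorder n R
  for n P M D N \<tau> \<upsilon> R R'
begin

lemma normalize_corner:
  assumes F: "F \<in> supported R"
    and G: "\<And>i j. i \<in> P \<Longrightarrow> j \<in> P \<Longrightarrow> (\<Sum>k\<in>P. F i (\<upsilon> k) * G k j) = (if i = j then 1 else 0)"
    "\<And>i j. i \<in> P \<Longrightarrow> j \<in> P \<Longrightarrow> (\<Sum>k\<in>P. G i k * F k (\<upsilon> j)) = (if i = j then 1 else 0)"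
  obtains F' where "F' \<in> supported R" "cm.dim (rad n R F') \<le> cm.dim (rad n R F)"
    "\<forall>i\<in>P. \<forall>j\<in>D. F' i j = (if i = \<tau> j then 1 else 0)"
proof -
  \<comment> \<open>On \<open>P\<close> the conjugating pair is the inverse of the corner and the
    corner itself, both transposed since \<open>conj_form\<close> computes \<open>g^T F h^T\<close>;
    elsewhere it is the unit. The new corner is the inverse times the old one.\<close>
  define g where "g = (\<lambda>k i. if k \<in> P \<and> i \<in> P then G i k else if k = i \<and> k \<notin> P \<and> R k k then 1 else 0)"
  define h where "h = (\<lambda>j l. if j \<in> P \<and> l \<in> P then F l (\<upsilon> j) else if j = l \<and> j \<notin> P \<and> R j j then 1 else 0)"
  have Pn: "P \<subseteq> {..<n}" using sub by blast
  have gh: "g \<in> supported R" "h \<in> supported R"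
    using R_row_P by (auto simp: g_def h_def supported_def split: if_splits)
  have prod: "mmul n a b = restrict_unit R"
    if "\<And>i j. i \<in> P \<Longrightarrow> j \<in> P \<Longrightarrow> (\<Sum>k\<in>P. a i k * b k j) = (if i = j then 1 else 0)"
      "\<And>i j. i \<notin> P \<or> j \<notin> P \<Longrightarrow> a i j = (if i = j \<and> R i i then 1 else 0)"
      "\<And>i j. i \<notin> P \<or> j \<notin> P \<Longrightarrow> b i j = (if i = j \<and> R i i then 1 else 0)" for a b :: cmat
  proof (intro ext)
    fix i j
    show "mmul n a b i j = restrict_unit R i j"
    proof (cases "i \<in> P")
      case True
      have "mmul n a b i j = (\<Sum>k\<in>P. a i k * b k j)"
        unfolding mmul_def by (rule sum.mono_neutral_right) (use Pn True that(2) in auto)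
      also have "\<dots> = (if i = j then 1 else 0)"
      proof (cases "j \<in> P")
        case False
        then have "(\<Sum>k\<in>P. a i k * b k j) = 0" using that(3) by (intro sum.neutral) auto
        then show ?thesis using False True by auto
      qed (use True that(1) in simp)
      finally show ?thesis using True R_row_P by (auto simp: restrict_unit_def)
    next
      case False
      have "mmul n a b i j = (\<Sum>k<n. if k = i then (if R i i then b i j else 0) else 0)"
        unfolding mmul_def using that(2) False by (intro sum.cong) auto
      also have "\<dots> = (if R i i then b i j else 0)" using R_less' by auto
      finally show ?thesis using False that(3) by (auto simp: restrict_unit_def)
    qed
  qed
  have inv: "mmul n g h = restrict_unit R" "mmul n h g = restrict_unit R"
    by (rule prod; use G in \<open>auto simp: g_def h_def mult.commute\<close>)+
  show ?thesis
  proof (rule that[OF clip_supported dim_rad_conj_clip[OF gh inv]], intro ballI)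
    fix i j assume ij: "i \<in> P" "j \<in> D"
    have j: "j \<notin> P" "R j j" "j < n" using ij only_D R_row_P R_refl R_less' by blast+
    have "conj_form n g h F i j = (\<Sum>k<n. \<Sum>l<n. if l = j then F k j * g k i else 0)"
      unfolding conj_form_def using j by (intro sum.cong refl) (auto simp: h_def)
    also have "\<dots> = (\<Sum>k<n. F k j * g k i)" using j by simp
    also have "\<dots> = (\<Sum>k\<in>P. F k j * g k i)"
      by (rule sum.mono_neutral_right) (use Pn ij in \<open>auto simp: g_def\<close>)
    also have "\<dots> = (\<Sum>k\<in>P. G i k * F k (\<upsilon> (\<tau> j)))"
      using ij \<tau> by (intro sum.cong) (auto simp: g_def)
    also have "\<dots> = (if i = \<tau> j then 1 else 0)" using G(2)[of i "\<tau> j"] ij \<tau> by auto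
    finally show "clip R (conj_form n g h F) i j = (if i = \<tau> j then 1 else 0)"
      using ij R_row_P by (simp add: clip_def)
  qed
qed

lemma normalize_form:
  assumes F: "F \<in> supported R" "\<And>i j. i \<in> P \<Longrightarrow> j \<in> D \<Longrightarrow> F i j = (if i = \<tau> j then 1 else 0)"
  obtains F' where "meander_step_form n P M D N \<tau> \<upsilon> R R' F'" "cm.dim (rad n R F') \<le> cm.dim (rad n R F)"
proof -
  have D_less: "j < n" if "j \<in> D" for j using that sub by blast
  \<comment> \<open>Subtracts multiples of the columns \<open>D\<close> from the columns
    \<open>P \<union> M\<close>; against the identity in the corner this clears the rows of
    \<open>P\<close> outside it.\<close>
  define Z where "Z = (\<lambda>j d. if j \<in> P \<union> M \<and> d \<in> D then F (\<tau> d) j else 0)"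
  have "Z \<in> supported R" using R_row_P R_MD by (auto simp: Z_def supported_def split: if_splits)
  moreover have "mmul n Z Z = 0"
    unfolding mmul_def fun_eq_iff using disj by (auto intro!: sum.neutral simp: Z_def)
  ultimately obtain F1 where F1: "F1 \<in> supported R" "cm.dim (rad n R F1) \<le> cm.dim (rad n R F)"
    "\<forall>i j. R i j \<longrightarrow> F1 i j = F i j + (\<Sum>k<n. F k j * Z k i) - (\<Sum>l<n. F i l * Z j l)
       - (\<Sum>k<n. \<Sum>l<n. F k l * Z k i * Z j l)"
    by (rule dim_rad_shear[where F = F])
  have row: "F1 i j = F i j - (\<Sum>l<n. F i l * Z j l)" if i: "i \<in> P" and j: "j \<in> P \<union> M \<union> D" for i j
  proof -
    have "Z k i = 0" for k using only_P[OF i] by (simp add: Z_def)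
    then show ?thesis using F1(3)[rule_format, of i j] R_row_P[OF i] j by simp
  qed
  have F1_PD: "F1 i j = (if i = \<tau> j then 1 else 0)" if ij: "i \<in> P" "j \<in> D" for i j
  proof -
    have "Z j l = 0" for l using only_D[OF ij(2)] by (simp add: Z_def)
    then show ?thesis using row[of i j] ij F(2) by simp
  qed
  have F1_P0: "F1 i j = 0" if ij: "i \<in> P" "j \<in> P \<union> M" for i j
  proof -
    have "(\<Sum>l<n. F i l * Z j l) = (\<Sum>l<n. if l = \<upsilon> i then F i j else 0)"
      using ij \<tau> \<upsilon> F(2)[OF ij(1)] by (intro sum.cong) (auto simp: Z_def)
    also have "\<dots> = F i j" using \<upsilon> D_less ij by simp
    finally show ?thesis using row[of i j] ij by auto
  qed
  \<comment> \<open>Adds multiples of the rows \<open>P\<close> to the rows \<open>M\<close>;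
    against the identity in the corner this clears \<open>M \<times> D\<close>.\<close>
  define W where "W = (\<lambda>p m. if p \<in> P \<and> m \<in> M then - F1 m (\<upsilon> p) else 0)"
  have "W \<in> supported R" using R_row_P by (auto simp: W_def supported_def split: if_splits)
  moreover have "mmul n W W = 0"
    unfolding mmul_def fun_eq_iff using disj by (auto intro!: sum.neutral simp: W_def)
  ultimately obtain F2 where F2: "F2 \<in> supported R" "cm.dim (rad n R F2) \<le> cm.dim (rad n R F1)"
    "\<forall>i j. R i j \<longrightarrow> F2 i j = F1 i j + (\<Sum>k<n. F1 k j * W k i) - (\<Sum>l<n. F1 i l * W j l)
       - (\<Sum>k<n. \<Sum>l<n. F1 k l * W k i * W j l)"
    by (rule dim_rad_shear[where F = F1])
  \<comment> \<open>The rows of \<open>P\<close> survive the second shear: it would change them only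
    through entries at \<open>P \<times> M\<close>, which are already zero.\<close>
  have row2: "F2 i j = F1 i j" if i: "i \<in> P" and j: "j \<in> P \<union> M \<union> D" for i j
  proof -
    have "W k i = 0" for k using only_P[OF i] by (simp add: W_def)
    moreover have "F1 i l * W j l = 0" for l using F1_P0[OF i, of l] by (simp add: W_def)
    then have "(\<Sum>l<n. F1 i l * W j l) = 0" by (intro sum.neutral) blast
    ultimately show ?thesis using F2(3)[rule_format, of i j] R_row_P[OF i] j by simp
  qed
  have MD: "F2 i j = 0" if ij: "i \<in> M" "j \<in> D" for i j
  proof -
    have "W j l = 0" for l using only_D[OF ij(2)] by (simp add: W_def)
    then have "F2 i j = F1 i j + (\<Sum>k<n. F1 k j * W k i)" using F2(3)[rule_format, OF R_MD[OF ij]] by simp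
    also have "(\<Sum>k<n. F1 k j * W k i) = (\<Sum>k<n. if k = \<tau> j then - F1 i j else 0)"
      using ij \<tau> F1_PD[OF _ ij(2)] by (intro sum.cong) (auto simp: W_def)
    also have "\<dots> = - F1 i j" using \<tau>(1)[OF ij(2)] sub by auto
    finally show ?thesis by simp
  qed
  have "meander_step_form n P M D N \<tau> \<upsilon> R R' F2"
    by unfold_locales (simp_all add: F2(1) row2 F1_PD F1_P0 MD)
  then show ?thesis using that F2(2) F1(2) by (meson order_trans)
qed

lemma dim_rad_ge:
  assumes k: "\<And>F'. F' \<in> supported R' \<Longrightarrow> k \<le> cm.dim (rad n R' F')" and F: "F \<in> supported R"
  shows "k \<le> cm.dim (rad n R F)"
proof -
  \<comment> \<open>With columns matched to rows by \<open>\<upsilon>\<close>, adding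
    \<open>t J\<close> adds \<open>t\<close> to the diagonal of the corner, which is the shape that
    \<open>perturb_invertible\<close> handles.\<close>
  define J where "J = (\<lambda>i j. if i \<in> P \<and> j \<in> D \<and> i = \<tau> j then 1 else (0::complex))"
  have J: "J \<in> supported R" using R_row_P by (auto simp: J_def supported_def split: if_splits)
  have "finite {(i, j). R i j}"
    by (rule finite_subset[of _ "{..<n} \<times> {..<n}"]) (use R_less in auto)
  then obtain e where e: "e > 0" "\<And>t. norm t < e \<Longrightarrow>
      cm.dim (rad n R (F + mscale t J)) \<le> cm.dim (rad n R F)"
    using dim_rad_perturb[of R n F J] by blast
  let ?A = "\<lambda>t i k. F i (\<upsilon> k) + (if i = k then t else 0)"
  have "\<exists>t G. norm t < e
      \<and> (\<forall>i\<in>P. \<forall>j\<in>P. (\<Sum>k\<in>P. ?A t i k * G k j) = (if i = j then 1 else 0))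
      \<and> (\<forall>i\<in>P. \<forall>j\<in>P. (\<Sum>k\<in>P. G i k * ?A t k j) = (if i = j then 1 else 0))"
    by (rule perturb_invertible[OF fin(1) e(1), of "\<lambda>i k. F i (\<upsilon> k)"]) blast
  then obtain t G where t: "norm t < e"
    and G: "\<And>i j. i \<in> P \<Longrightarrow> j \<in> P \<Longrightarrow> (\<Sum>k\<in>P. ?A t i k * G k j) = (if i = j then 1 else 0)"
    "\<And>i j. i \<in> P \<Longrightarrow> j \<in> P \<Longrightarrow> (\<Sum>k\<in>P. G i k * ?A t k j) = (if i = j then 1 else 0)"
    by blast
  define E where "E = F + mscale t J"
  have v: "E i (\<upsilon> k) = F i (\<upsilon> k) + (if i = k then t else 0)" if "i \<in> P" "k \<in> P" for i k
    using that \<upsilon> by (auto simp: E_def mscale_def J_def)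
  have "E \<in> supported R"
    unfolding E_def using F J subspace_supported cm.subspace_add cm.subspace_scale by blast
  moreover have "(\<Sum>k\<in>P. E i (\<upsilon> k) * G k j) = (if i = j then 1 else 0)"
    "(\<Sum>k\<in>P. G i k * E k (\<upsilon> j)) = (if i = j then 1 else 0)" if ij: "i \<in> P" "j \<in> P" for i j
  proof -
    have "(\<Sum>k\<in>P. E i (\<upsilon> k) * G k j) = (\<Sum>k\<in>P. ?A t i k * G k j)"
      "(\<Sum>k\<in>P. G i k * E k (\<upsilon> j)) = (\<Sum>k\<in>P. G i k * ?A t k j)"
      by (rule sum.cong; simp add: v ij)+
    then show "(\<Sum>k\<in>P. E i (\<upsilon> k) * G k j) = (if i = j then 1 else 0)"
      "(\<Sum>k\<in>P. G i k * E k (\<upsilon> j)) = (if i = j then 1 else 0)"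
      using G[OF ij] by simp_all
  qed
  ultimately obtain F1 where F1: "F1 \<in> supported R" "cm.dim (rad n R F1) \<le> cm.dim (rad n R E)"
    "\<forall>i\<in>P. \<forall>j\<in>D. F1 i j = (if i = \<tau> j then 1 else 0)"
    by (rule normalize_corner)
  obtain F2 where F2: "meander_step_form n P M D N \<tau> \<upsilon> R R' F2" "cm.dim (rad n R F2) \<le> cm.dim (rad n R F1)"
    by (rule normalize_form[OF F1(1)]) (use F1(3) in blast)+
  interpret S: meander_step_form n P M D N \<tau> \<upsilon> R R' F2 by fact
  have "k \<le> cm.dim (rad n R' (contract F2))" using k contract_supported[OF S.F] by blast
  also have "\<dots> \<le> cm.dim (rad n R F2)" by (rule S.dim_contract_le_rad)
  also have "\<dots> \<le> cm.dim (rad n R F)" using F2(2) F1(2) e(2)[OF t] unfolding E_def by linarith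
  finally show ?thesis .
qed

end

text \<open>The upper bound concerns one form only, so \<open>F\<close> is written down directly in
  normal form with contraction \<open>F'\<close>.\<close>

lemma (in meander_step) dim_rad_le:
  assumes F': "F' \<in> supported R'"
  obtains F where "F \<in> supported R" "cm.dim (rad n R F) \<le> cm.dim (rad n R' F')"
proof -
  define F where "F = (\<lambda>i j. if i \<in> P \<and> j \<in> D then (if i = \<tau> j then 1 else 0)
    else if i \<in> M \<and> j \<in> P then F' i (\<upsilon> j)
    else if i \<in> P \<or> j \<in> P \<or> (i \<in> M \<and> j \<in> D) then 0 else F' i j)"
  have s: "F \<in> supported R"
    unfolding supported_def
  proof (intro CollectI allI impI)
    fix i j assume nz: "F i j \<noteq> 0"
    consider "i \<in> P" "j \<in> D" | "i \<in> M" "j \<in> P" "F' i (\<upsilon> j) \<noteq> 0" | "\<not> (i \<in> M \<and> j \<in> D)" "F' i j \<noteq> 0"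
      using nz by (auto simp: F_def split: if_splits)
    then show "R i j"
    proof cases
      case 1 then show ?thesis using R_row_P by blast
    next
      case 2
      then have "R' i (\<upsilon> j)" using supported_zero[OF F'] by blast
      then show ?thesis using 2 \<upsilon> by (simp add: R')
    next
      case 3
      then have "R' i j" using supported_zero[OF F'] by blast
      then show ?thesis using 3 by (auto simp: R')
    qed
  qed
  have "meander_step_form n P M D N \<tau> \<upsilon> R R' F"
  proof unfold_locales
    fix i j
    show "i \<in> P \<Longrightarrow> j \<in> D \<Longrightarrow> F i j = (if i = \<tau> j then 1 else 0)" by (simp add: F_def)
    show "i \<in> P \<Longrightarrow> j \<in> P \<Longrightarrow> F i j = 0" using only_P[of i] only_P[of j] by (simp add: F_def)
    show "i \<in> P \<Longrightarrow> j \<in> M \<Longrightarrow> F i j = 0" using only_P[of i] only_M[of j] by (simp add: F_def)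
    show "i \<in> M \<Longrightarrow> j \<in> D \<Longrightarrow> F i j = 0" using only_M[of i] only_D[of j] by (simp add: F_def)
  qed fact
  then interpret S: meander_step_form n P M D N \<tau> \<upsilon> R R' F .
  have "contract F = F'"
  proof (intro ext)
    fix i j
    show "contract F i j = F' i j"
    proof (cases "R' i j")
      case True
      then have ij: "i \<in> M \<union> D \<union> N" "j \<in> M \<union> D \<union> N" by (auto simp: R')
      then have "i \<notin> P" "j \<notin> P" using disj by blast+
      then show ?thesis using ij \<tau>[of j] only_P[of "\<tau> j"] by (auto simp: contract_def F_def)
    next
      case False
      then have "contract F i j = 0" "F' i j = 0"
        using supported_zero[OF contract_supported[OF s]] supported_zero[OF F'] by blast+
      then show ?thesis by simp
    qed
  qed
  then show ?thesis using that s S.dim_rad_le_contract by metis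
qed

section \<open>Direct sums and full blocks\<close>

context finite_preorder
begin

lemma finite_R: "finite {(i, j). R i j}"
  by (rule finite_subset[of _ "{..<n} \<times> {..<n}"]) (use R_less' in auto)

lemma rad_iff': "X \<in> rad n R F \<longleftrightarrow> X \<in> supported R \<and>
    (\<forall>k l. R k l \<longrightarrow> (\<Sum>i<n. X i k * F i l) = (\<Sum>j<n. F k j * X l j))"
  by (rule rad_iff[OF R_less'])

lemma findim_rad_R: "cm.findim (rad n R F)"
  using cm.findim_subset[OF rad_subset findim_supported[OF finite_R]] .

end

text \<open>Transposition reverses products and so only changes the sign of the commutator form. For
  seaweeds it exchanges the two compositions.\<close>

lemma dim_rad_transpose_le:
  assumes R: "\<And>i j. R i j \<Longrightarrow> i < n \<and> j < n"
  shows "cm.dim (rad n R F) \<le> cm.dim (rad n (\<lambda>i j. R j i) (\<lambda>i j. F j i))"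
proof (rule cm.dim_le_injective[where T = "\<lambda>(X :: cmat) i j. X j i", OF _ subspace_rad])
  show "Vector_Spaces.linear mscale mscale (\<lambda>(X :: cmat) i j. X j i)"
    by unfold_locales (auto simp: mscale_def fun_eq_iff)
  have "finite {(i, j). R j i}"
    by (rule finite_subset[of _ "{..<n} \<times> {..<n}"]) (use R in auto)
  then show "cm.findim (rad n (\<lambda>i j. R j i) (\<lambda>i j. F j i))"
    using cm.findim_subset[OF rad_subset findim_supported] by blast
  show "(\<lambda>X i j. X j i) ` rad n R F \<subseteq> rad n (\<lambda>i j. R j i) (\<lambda>i j. F j i)"
  proof clarify
    fix X assume "X \<in> rad n R F"
    then have X: "X \<in> supported R" "\<And>k l. R k l \<Longrightarrow> (\<Sum>i<n. X i k * F i l) = (\<Sum>j<n. F k j * X l j)"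
      using rad_iff[of R n X F] R by blast+
    have "(\<lambda>i j. X j i) \<in> supported (\<lambda>i j. R j i)" using X(1) by (auto simp: supported_def)
    moreover have "(\<Sum>i<n. X k i * F l i) = (\<Sum>j<n. F j k * X j l)" if "R l k" for k l
      using X(2)[OF that] by (simp add: mult.commute)
    ultimately show "(\<lambda>i j. X j i) \<in> rad n (\<lambda>i j. R j i) (\<lambda>i j. F j i)"
      using rad_iff[of "\<lambda>i j. R j i" n "\<lambda>i j. X j i" "\<lambda>i j. F j i"] R by blast
  qed
  show "X = 0" if "(\<lambda>i j. X j i) = (0 :: cmat)" for X :: cmat
    using that by (auto simp: fun_eq_iff)
qed

locale relation_sum = finite_preorder n R for n R +
  fixes R1 R2 :: "nat \<Rightarrow> nat \<Rightarrow> bool" and P N :: "nat set"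
  assumes dom1: "\<And>i j. R1 i j \<Longrightarrow> i \<in> P \<and> j \<in> P" and dom2: "\<And>i j. R2 i j \<Longrightarrow> i \<in> N \<and> j \<in> N"
    and disj: "P \<inter> N = {}" and R_sum: "\<And>i j. R i j \<longleftrightarrow> R1 i j \<or> R2 i j"
begin

lemma rad_summand:
  assumes X: "X \<in> rad n R1 (clip R1 F)"
  shows "X \<in> rad n R F"
proof -
  have R1: "R1 i j \<Longrightarrow> i < n \<and> j < n" for i j using R_sum R_less' by blast
  have Xs: "X \<in> supported R1" and E: "\<And>k l. R1 k l \<Longrightarrow>
      (\<Sum>i<n. X i k * clip R1 F i l) = (\<Sum>j<n. clip R1 F k j * X l j)"
    using X rad_iff[OF R1] by blast+
  have s: "X \<in> supported R" using Xs R_sum by (auto simp: supported_def)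
  have "(\<Sum>i<n. X i k * F i l) = (\<Sum>j<n. F k j * X l j)" if "R k l" for k l
  proof (cases "R1 k l")
    case True
    have "X i k * F i l = X i k * clip R1 F i l" for i
    proof (cases "R1 i k")
      case T: True
      then have "R i l" using R_trans True R_sum by blast
      then have "R1 i l" using R_sum dom2 dom1 T disj by blast
      then show ?thesis by (simp add: clip_def)
    qed (use supported_zero[OF Xs] in simp)
    moreover have "F k j * X l j = clip R1 F k j * X l j" for j
    proof (cases "R1 l j")
      case T: True
      then have "R k j" using R_trans True R_sum by blast
      then have "R1 k j" using R_sum dom2 dom1 T disj by blast
      then show ?thesis by (simp add: clip_def)
    qed (use supported_zero[OF Xs] in simp)
    ultimately have "(\<Sum>i<n. X i k * F i l) = (\<Sum>i<n. X i k * clip R1 F i l)"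
      "(\<Sum>j<n. F k j * X l j) = (\<Sum>j<n. clip R1 F k j * X l j)"
      by (intro sum.cong refl; blast)+
    then show ?thesis using E[OF True] by simp
  next
    case False
    then have kl: "k \<in> N" "l \<in> N" using that R_sum dom2 by blast+
    then have "X i k = 0" "X l i = 0" for i
      using supported_zero[OF Xs] dom1 disj by blast+
    then show ?thesis by simp
  qed
  then show ?thesis using s rad_iff' by blast
qed

lemma clip_rad:
  assumes X: "X \<in> rad n R F" and F: "F \<in> supported R"
  shows "clip R1 X \<in> rad n R1 (clip R1 F)"
proof -
  have R1: "R1 i j \<Longrightarrow> i < n \<and> j < n" for i j using R_sum R_less' by blast
  have Xs: "X \<in> supported R" and E: "\<And>k l. R k l \<Longrightarrow> (\<Sum>i<n. X i k * F i l) = (\<Sum>j<n. F k j * X l j)"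
    using X rad_iff' by blast+
  have c: "clip R1 Y i j = Y i j" if "i \<in> P \<or> j \<in> P" "Y \<in> supported R" for i j and Y :: cmat
    using that supported_zero[OF that(2), of i j] R_sum[of i j] dom2[of i j] disj by (auto simp: clip_def)
  have "(\<Sum>i<n. clip R1 X i k * clip R1 F i l) = (\<Sum>j<n. clip R1 F k j * clip R1 X l j)" if "R1 k l" for k l
    using E[of k l] c[OF _ Xs] c[OF _ F] dom1[OF that] that R_sum by simp
  then show ?thesis using rad_iff[OF R1] clip_supported by blast
qed

end

lemma dim_rad_sum_ge:
  assumes "relation_sum n R R1 R2 P N"
  shows "cm.dim (rad n R1 (clip R1 F)) + cm.dim (rad n R2 (clip R2 F)) \<le> cm.dim (rad n R F)"
proof -
  interpret A: relation_sum n R R1 R2 P N by fact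
  interpret B: relation_sum n R R2 R1 N P
    by unfold_locales (use A.dom1 A.dom2 A.disj A.R_sum in blast)+
  show ?thesis
  proof (rule cm.dim_sum_le_disjoint[OF A.findim_rad_R _ _ subspace_rad subspace_rad])
    show "rad n R1 (clip R1 F) \<subseteq> rad n R F" using A.rad_summand by blast
    show "rad n R2 (clip R2 F) \<subseteq> rad n R F" using B.rad_summand by blast
    show "rad n R1 (clip R1 F) \<inter> rad n R2 (clip R2 F) \<subseteq> {0}"
    proof
      fix X assume "X \<in> rad n R1 (clip R1 F) \<inter> rad n R2 (clip R2 F)"
      then have "X \<in> supported R1" "X \<in> supported R2" using rad_subset by blast+
      then have "X i j = 0" for i j using supported_zero A.dom1[of i j] A.dom2[of i j] A.disj by blast
      then show "X \<in> {0}" by (auto simp: fun_eq_iff)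
    qed
  qed
qed

lemma dim_rad_sum_le:
  assumes "relation_sum n R R1 R2 P N" and F: "F1 \<in> supported R1" "F2 \<in> supported R2"
  shows "F1 + F2 \<in> supported R" "cm.dim (rad n R (F1 + F2)) \<le> cm.dim (rad n R1 F1) + cm.dim (rad n R2 F2)"
proof -
  interpret A: relation_sum n R R1 R2 P N by fact
  interpret B: relation_sum n R R2 R1 N P
    by unfold_locales (use A.dom1 A.dom2 A.disj A.R_sum in blast)+
  show s: "F1 + F2 \<in> supported R"
    using F A.R_sum by (auto simp: supported_def) (metis add_0)
  have z: "F1 i j = 0" if "R2 i j" for i j
    using that supported_zero[OF F(1)] A.dom1 A.dom2 A.disj by blast
  have z': "F2 i j = 0" if "R1 i j" for i j
    using that supported_zero[OF F(2)] A.dom1 A.dom2 A.disj by blast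
  have c: "clip R1 (F1 + F2) = F1" "clip R2 (F1 + F2) = F2"
    using z z' supported_zero[OF F(1)] supported_zero[OF F(2)] by (auto simp: clip_def fun_eq_iff)
  have fin: "finite {(i, j). R1 i j}" "finite {(i, j). R2 i j}"
    using A.finite_R by (auto elim!: finite_subset[rotated] simp: A.R_sum)
  show "cm.dim (rad n R (F1 + F2)) \<le> cm.dim (rad n R1 F1) + cm.dim (rad n R2 F2)"
  proof (rule cm.dim_sum_ge)
    fix X assume X: "X \<in> rad n R (F1 + F2)"
    then have Xs: "X \<in> supported R" using rad_subset by blast
    have "X = clip R1 X + clip R2 X"
    proof (intro ext)
      fix i j
      have "\<not> (R1 i j \<and> R2 i j)" using A.dom1 A.dom2 A.disj by blast
      then show "X i j = (clip R1 X + clip R2 X) i j"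
        using supported_zero[OF Xs, of i j] A.R_sum[of i j] by (auto simp: clip_def)
    qed
    then show "\<exists>a\<in>rad n R1 F1. \<exists>b\<in>rad n R2 F2. X = a + b"
      using A.clip_rad[OF X s] B.clip_rad[OF X s] unfolding c by blast
  qed (use cm.findim_subset[OF rad_subset findim_supported] fin in blast)+
qed

definition full_on :: "nat set \<Rightarrow> nat \<Rightarrow> nat \<Rightarrow> bool" where
  "full_on P i j \<longleftrightarrow> i \<in> P \<and> j \<in> P"

lemma finite_preorder_full_on: "P \<subseteq> {..<n} \<Longrightarrow> finite_preorder n (full_on P)"
  by unfold_locales (auto simp: full_on_def)

text \<open>The witness is diagonal with the distinct entries \<open>i\<close>, and the equations of
  its radical force a matrix to be diagonal.\<close>

lemma dim_rad_full_le:
  assumes P: "P \<subseteq> {..<n}"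
  shows "\<exists>F\<in>supported (full_on P). cm.dim (rad n (full_on P) F) \<le> card P"
proof -
  interpret finite_preorder n "full_on P" by (rule finite_preorder_full_on[OF P])
  define F where "F = (\<lambda>i j. if i = j \<and> i \<in> P then of_nat i else (0::complex))"
  let ?D = "\<lambda>i j. i = j \<and> i \<in> P"
  have "rad n (full_on P) F \<subseteq> supported ?D"
  proof
    fix X assume X: "X \<in> rad n (full_on P) F"
    then have Xs: "X \<in> supported (full_on P)" using rad_subset by blast
    have "X l k = 0" if "k \<noteq> l" for k l
    proof (cases "full_on P l k")
      case True
      then have kl: "k \<in> P" "l \<in> P" by (auto simp: full_on_def)
      then have kn: "k < n" "l < n" using P by auto
      have "(\<Sum>i<n. X i k * F i l) = (\<Sum>j<n. F k j * X l j)"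
        using X rad_iff' kl by (auto simp: full_on_def)
      moreover have "(\<Sum>i<n. X i k * F i l) = (\<Sum>i<n. if i = l then X l k * of_nat l else 0)"
        using kl by (intro sum.cong) (auto simp: F_def)
      moreover have "(\<Sum>j<n. F k j * X l j) = (\<Sum>j<n. if j = k then of_nat k * X l k else 0)"
        using kl by (intro sum.cong) (auto simp: F_def)
      ultimately have "X l k * of_nat l = of_nat k * X l k" using kn by simp
      then show ?thesis using that by (simp add: mult.commute)
    qed (use supported_zero[OF Xs] in blast)
    then show "X \<in> supported ?D"
      unfolding supported_def
    proof (intro CollectI allI impI)
      fix i j assume nz: "X i j \<noteq> 0"
      then have "i = j" using \<open>\<And>k l. k \<noteq> l \<Longrightarrow> X l k = 0\<close>[of j i] by auto
      moreover have "full_on P i j" using nz supported_zero[OF Xs] by blast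
      ultimately show "i = j \<and> i \<in> P" by (simp add: full_on_def)
    qed
  qed
  moreover have "card {(i, j). ?D i j} = card P"
    by (rule bij_betw_same_card[of fst]) (auto simp: bij_betw_def inj_on_def image_iff)
  moreover have fin: "finite {(i, j). ?D i j}"
    by (rule finite_subset[of _ "P \<times> P"]) (use P finite_subset[OF P] in auto)
  ultimately have "cm.dim (rad n (full_on P) F) \<le> card P"
    using cm.findim_dim_mono[of "rad n (full_on P) F" "supported ?D", OF _ findim_supported[OF fin]]
      dim_supported[OF fin] by simp
  moreover have "F \<in> supported (full_on P)" by (auto simp: F_def supported_def full_on_def)
  ultimately show ?thesis by blast
qed

text \<open>For a triangular form, the triangular matrices of the opposite shape satisfy the defining
  equations of the radical except for those on one side of the diagonal.\<close>

lemma dim_rad_triangular_ge: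
  assumes P: "P \<subseteq> {..<n}" and F: "\<And>i j. i \<in> P \<Longrightarrow> j \<in> P \<Longrightarrow> j < i \<Longrightarrow> F i j = 0"
    and Fs: "F \<in> supported (full_on P)"
  shows "card P \<le> cm.dim (rad n (full_on P) F)"
proof -
  interpret finite_preorder n "full_on P" by (rule finite_preorder_full_on[OF P])
  have finP: "finite P" using P finite_subset by blast
  let ?L = "\<lambda>i j. i \<in> P \<and> j \<in> P \<and> j \<le> i"
  let ?J = "{(k, l). k \<in> P \<and> l \<in> P \<and> k < l}"
  define \<phi> where "\<phi> = (\<lambda>(k, l) X. (\<Sum>i<n. X i k * F i l) - (\<Sum>j<n. F k j * X l j))"
  have finL: "finite {(i, j). ?L i j}" and finJ: "finite ?J"
    by (rule finite_subset[of _ "P \<times> P"]; use finP in auto)+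
  have lin: "\<phi> q (X + Y) = \<phi> q X + \<phi> q Y" "\<phi> q (mscale c X) = c * \<phi> q X" for q X Y c
    by (auto simp: \<phi>_def mscale_def split_beta algebra_simps sum.distrib sum_distrib_left)
  have "cm.dim (supported ?L) \<le> cm.dim {X\<in>supported ?L. \<forall>q\<in>?J. \<phi> q X = 0} + card ?J"
    by (rule cm.dim_le_kernel_functionals[OF finJ subspace_supported findim_supported[OF finL]])
       (rule lin)+
  moreover have "{X\<in>supported ?L. \<forall>q\<in>?J. \<phi> q X = 0} \<subseteq> rad n (full_on P) F"
  proof clarify
    fix X assume X: "X \<in> supported ?L" and J: "\<forall>q\<in>?J. \<phi> q X = 0"
    have low: "X i j = 0" if "i < j" for i j using supported_zero[OF X, of i j] that by simp
    have up: "F i j = 0" if "j < i" for i j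
      using supported_zero[OF Fs, of i j] F[of i j] that by (auto simp: full_on_def)
    have "(\<Sum>i<n. X i k * F i l) = (\<Sum>j<n. F k j * X l j)" if kl: "k \<in> P" "l \<in> P" for k l
    proof (rule linorder_cases[of k l])
      assume "k < l"
      then show ?thesis using J kl by (auto simp: \<phi>_def)
    next
      assume "k = l"
      then have "(\<Sum>i<n. X i k * F i l) = (\<Sum>i<n. if i = k then X k k * F k k else 0)"
        "(\<Sum>j<n. F k j * X l j) = (\<Sum>i<n. if i = k then X k k * F k k else 0)"
        by (intro sum.cong refl; metis low up linorder_neqE_nat mult_zero_left mult_zero_right mult.commute)+
      then show ?thesis by simp
    next
      assume lk: "l < k"
      have "X i k * F i l = 0" "F k i * X l i = 0" for i
        using low[of i k] up[of l i] low[of l i] up[of i k] lk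
        by (cases "i < k"; cases "l < i"; simp)+
      then have "(\<Sum>i<n. X i k * F i l) = 0" "(\<Sum>j<n. F k j * X l j) = 0"
        by (intro sum.neutral ballI; blast)+
      then show ?thesis by simp
    qed
    moreover have "X \<in> supported (full_on P)" using X by (auto simp: supported_def full_on_def)
    ultimately show "X \<in> rad n (full_on P) F" using rad_iff' by (auto simp: full_on_def)
  qed
  then have "cm.dim {X\<in>supported ?L. \<forall>q\<in>?J. \<phi> q X = 0} \<le> cm.dim (rad n (full_on P) F)"
    by (rule cm.findim_dim_mono[OF _ findim_rad_R])
  \<comment> \<open>Transposition matches the strictly lower positions with the remaining equations,
    which leaves one dimension per diagonal position.\<close>
  moreover have "card {(i, j). ?L i j} = card ?J + card P"
  proof -
    let ?S = "{(i, j). i \<in> P \<and> j \<in> P \<and> j < i}" and ?D = "{(i, j). i \<in> P \<and> j = i}"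
    have "{(i, j). ?L i j} = ?S \<union> ?D" by auto
    moreover have "finite ?S" "finite ?D" by (rule finite_subset[of _ "P \<times> P"]; use finP in auto)+
    ultimately have "card {(i, j). ?L i j} = card ?S + card ?D"
      by (simp only:) (rule card_Un_disjoint, auto)
    moreover have "card ?S = card ?J"
      by (rule bij_betw_same_card[of "\<lambda>(i, j). (j, i)"]) (auto simp: bij_betw_def inj_on_def image_iff)
    moreover have "card ?D = card P"
      by (rule bij_betw_same_card[of fst]) (auto simp: bij_betw_def inj_on_def image_iff)
    ultimately show ?thesis by simp
  qed
  ultimately show ?thesis using dim_supported[OF finL] by linarith
qed

text \<open>Every form on a full block is conjugate to a triangular one, for which counting
  equations suffices; thus degenerate forms are covered as well as generic ones. The block starts at
  \<open>s\<close>, hence the index shifts.\<close>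

lemma dim_rad_full_ge:
  assumes n: "s + m \<le> n" and F: "F \<in> supported (full_on {s..<s + m})"
  shows "m \<le> cm.dim (rad n (full_on {s..<s + m}) F)"
proof -
  let ?P = "{s..<s + m}"
  have P: "?P \<subseteq> {..<n}" using n by auto
  interpret finite_preorder n "full_on ?P" by (rule finite_preorder_full_on[OF P])
  have shift: "(\<Sum>k\<in>?P. f k) = (\<Sum>k<m. f (s + k))" for f :: "nat \<Rightarrow> complex"
    by (rule sum.reindex_bij_witness[of _ "\<lambda>k. s + k" "\<lambda>k. k - s"]) auto
  have restr: "(\<Sum>k<n. f k) = (\<Sum>k<m. f (s + k))" if "\<And>k. k \<notin> ?P \<Longrightarrow> f k = 0" for f :: "nat \<Rightarrow> complex"
    unfolding shift[symmetric] by (rule sum.mono_neutral_right) (use P that in auto)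
  obtain S T where ST: "\<forall>i<m. \<forall>j<m. (\<Sum>k<m. S i k * T k j) = (if i = j then 1 else 0)"
    "\<forall>i<m. \<forall>j<m. (\<Sum>k<m. T i k * S k j) = (if i = j then 1 else 0)"
    "\<forall>i<m. \<forall>j<i. (\<Sum>k<m. \<Sum>l<m. S i k * F (s + k) (s + l) * T l j) = 0"
    by (rule triangularize[of m "\<lambda>k l. F (s + k) (s + l)"])
  define g where "g = (\<lambda>k i. if k \<in> ?P \<and> i \<in> ?P then S (i - s) (k - s) else 0)"
  define h where "h = (\<lambda>j l. if j \<in> ?P \<and> l \<in> ?P then T (l - s) (j - s) else 0)"
  have gh: "g \<in> supported (full_on ?P)" "h \<in> supported (full_on ?P)"
    by (auto simp: g_def h_def supported_def full_on_def)
  have inv: "mmul n g h = restrict_unit (full_on ?P)" "mmul n h g = restrict_unit (full_on ?P)"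
  proof -
    have "(\<Sum>k<n. g i k * h k j) = restrict_unit (full_on ?P) i j
        \<and> (\<Sum>k<n. h i k * g k j) = restrict_unit (full_on ?P) i j" for i j
    proof (cases "i \<in> ?P \<and> j \<in> ?P")
      case True
      have "(\<Sum>k<n. g i k * h k j) = (\<Sum>k<m. g i (s + k) * h (s + k) j)"
        "(\<Sum>k<n. h i k * g k j) = (\<Sum>k<m. h i (s + k) * g (s + k) j)"
        by (rule restr; force simp: g_def h_def)+
      moreover have "(\<Sum>k<m. g i (s + k) * h (s + k) j) = (\<Sum>k<m. T (j - s) k * S k (i - s))"
        "(\<Sum>k<m. h i (s + k) * g (s + k) j) = (\<Sum>k<m. S (j - s) k * T k (i - s))"
        using True by (simp_all add: g_def h_def mult.commute)
      moreover have "(\<Sum>k<m. T (j - s) k * S k (i - s)) = (if i = j then 1 else 0)"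
        "(\<Sum>k<m. S (j - s) k * T k (i - s)) = (if i = j then 1 else 0)"
        using True ST(1,2)[rule_format, of "j - s" "i - s"] by auto
      ultimately show ?thesis using True by (simp add: restrict_unit_def full_on_def)
    next
      case False
      then have "g i k * h k j = 0" "h i k * g k j = 0" for k by (auto simp: g_def h_def)
      then have "(\<Sum>k<n. g i k * h k j) = 0" "(\<Sum>k<n. h i k * g k j) = 0"
        by (simp_all only: sum.neutral_const)
      moreover have "restrict_unit (full_on ?P) i j = 0"
        using False by (auto simp: restrict_unit_def full_on_def)
      ultimately show ?thesis by simp
    qed
    then show "mmul n g h = restrict_unit (full_on ?P)" "mmul n h g = restrict_unit (full_on ?P)"
      by (simp_all add: mmul_def)
  qed
  have "card ?P \<le> cm.dim (rad n (full_on ?P) (clip (full_on ?P) (conj_form n g h F)))"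
  proof (rule dim_rad_triangular_ge[OF P _ clip_supported])
    fix i j assume ij: "i \<in> ?P" "j \<in> ?P" "j < i"
    have "conj_form n g h F i j = (\<Sum>k<m. \<Sum>l<n. F (s + k) l * g (s + k) i * h j l)"
      unfolding conj_form_def by (rule restr) (auto simp: g_def)
    also have "\<dots> = (\<Sum>k<m. \<Sum>l<m. F (s + k) (s + l) * g (s + k) i * h j (s + l))"
      by (intro sum.cong refl restr) (auto simp: h_def)
    also have "\<dots> = (\<Sum>k<m. \<Sum>l<m. S (i - s) k * F (s + k) (s + l) * T l (j - s))"
      using ij by (intro sum.cong refl) (auto simp: g_def h_def)
    also have "\<dots> = 0" using ij by (intro ST(3)[rule_format]) auto
    finally show "clip (full_on ?P) (conj_form n g h F) i j = 0" by (simp add: clip_def)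
  qed
  also have "\<dots> \<le> cm.dim (rad n (full_on ?P) F)" by (rule dim_rad_conj_clip[OF gh inv])
  finally show ?thesis by simp
qed

section \<open>The index of seaweed algebras\<close>

fun same_block :: "nat \<Rightarrow> nat list \<Rightarrow> nat \<Rightarrow> nat \<Rightarrow> bool" where
  "same_block s [] i j \<longleftrightarrow> False"
| "same_block s (x # a) i j \<longleftrightarrow> (s \<le> i \<and> i < s + x \<and> s \<le> j \<and> j < s + x) \<or> same_block (s + x) a i j"

lemma same_block_bounds:
  "same_block s a i j \<Longrightarrow> s \<le> i \<and> i < s + sum_list a \<and> s \<le> j \<and> j < s + sum_list a"
  by (induction a arbitrary: s) force+

lemma same_block_sym: "same_block s a i j \<Longrightarrow> same_block s a j i"
  by (induction a arbitrary: s) auto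

lemma same_block_trans: "same_block s a i j \<Longrightarrow> same_block s a j k \<Longrightarrow> same_block s a i k"
proof (induction a arbitrary: s)
  case (Cons x a)
  then show ?case using same_block_bounds[of "s + x" a i j] same_block_bounds[of "s + x" a j k] by auto
qed simp

lemma same_block_convex: "same_block s a i k \<Longrightarrow> i \<le> j \<Longrightarrow> j \<le> k \<Longrightarrow> same_block s a i j"
proof (induction a arbitrary: s)
  case (Cons x a) then show ?case by (cases "same_block (s + x) a i k") auto
qed simp

lemma same_block_refl: "s \<le> i \<Longrightarrow> i < s + sum_list a \<Longrightarrow> same_block s a i i"
proof (induction a arbitrary: s)
  case (Cons x a) then show ?case by (cases "i < s + x") auto
qed simp

text \<open>Basis indices are shifted by an offset \<open>s\<close>, so that the Lie algebras met in the reduction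
  all live inside the same matrix algebra.\<close>

definition seaweed_rel :: "nat \<Rightarrow> nat list \<Rightarrow> nat list \<Rightarrow> nat \<Rightarrow> nat \<Rightarrow> bool" where
  "seaweed_rel s a b i j \<longleftrightarrow> (i \<le> j \<and> same_block s b i j) \<or> (j \<le> i \<and> same_block s a i j)"

lemma seaweed_rel_transpose: "seaweed_rel s b a i j = seaweed_rel s a b j i"
  unfolding seaweed_rel_def using same_block_sym by blast

text \<open>For transitivity, two steps in the same direction stay in one block. If the second step
  turns back, the interval between \<open>i\<close> and \<open>k\<close> lies inside one of the two
  steps, and blocks are convex.\<close>

lemma finite_preorder_seaweed_rel:
  assumes "s + sum_list a = n" "s + sum_list b = n"
  shows "finite_preorder n (seaweed_rel s a b)"
proof
  fix i j k
  show "i < n \<and> j < n" if "seaweed_rel s a b i j"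
    using that assms same_block_bounds[of s a i j] same_block_bounds[of s b i j]
    by (auto simp: seaweed_rel_def)
  show "seaweed_rel s a b i i \<and> seaweed_rel s a b j j" if "seaweed_rel s a b i j"
    using that assms same_block_bounds[of s a i j] same_block_bounds[of s b i j]
    by (auto simp: seaweed_rel_def intro!: same_block_refl)
  assume ij: "seaweed_rel s a b i j" and jk: "seaweed_rel s a b j k"
  have up: "same_block s c i k" if "same_block s c i j" "same_block s c j k" for c
    using that by (rule same_block_trans)
  have 1: "same_block s b i k" if "same_block s b i j" "i \<le> k" "k \<le> j"
    using same_block_convex[OF that(1-3)] .
  have 2: "same_block s a i k" if "same_block s a j k" "k \<le> i" "i \<le> j"
    using same_block_convex[OF same_block_sym[OF that(1)] that(2,3)] same_block_sym by blast
  have 3: "same_block s b i k" if "same_block s b j k" "j \<le> i" "i \<le> k"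
    using same_block_convex[OF that] same_block_trans[OF same_block_sym that(1)] by blast
  have 4: "same_block s a i k" if "same_block s a i j" "j \<le> k" "k \<le> i"
    using same_block_convex[OF same_block_sym[OF that(1)] that(2,3)] same_block_trans[OF that(1)] by blast
  show "seaweed_rel s a b i k"
    using ij jk unfolding seaweed_rel_def
    by (meson 1 2 3 4 up le_trans nat_le_linear)
qed

text \<open>The case \<open>2 * x \<le> y\<close> with \<open>e = y - 2 * x\<close>. Here
  \<open>P\<close> is the whole first block of the first composition, so \<open>M \<times> P\<close>
  has no allowed position; \<open>M \<times> D\<close> disappears, and the remaining block of size
  \<open>x + e\<close> splits into \<open>e\<close> and \<open>x\<close>.\<close>

lemma meander_step_disjoint:
  assumes pos: "0 < x" and n: "s + x + sum_list a = n" "s + (2 * x + e) + sum_list b = n"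
  shows "meander_step_preorder n {s..<s + x} {s + x..<s + x + e} {s + x + e..<s + (2 * x + e)} {s + (2 * x + e)..<n}
    (\<lambda>j. j - (x + e)) (\<lambda>i. i + (x + e)) (seaweed_rel s (x # a) ((2 * x + e) # b))
    (seaweed_rel (s + x) a (e # x # b))"
proof -
  interpret finite_preorder n "seaweed_rel s (x # a) ((2 * x + e) # b)"
    by (rule finite_preorder_seaweed_rel) (use n in auto)
  have A: "\<not> same_block (s + x) a i j \<or> (s + x \<le> i \<and> i < n \<and> s + x \<le> j \<and> j < n)" for i j
    using same_block_bounds[of "s + x" a i j] n by (auto simp: add.assoc)
  have B: "\<not> same_block (s + (2 * x + e)) b i j \<or> (s + (2 * x + e) \<le> i \<and> i < n \<and> s + (2 * x + e) \<le> j \<and> j < n)" for i j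
    using same_block_bounds[of "s + (2 * x + e)" b i j] n by (auto simp: add.assoc)
  have shift: "s + x + e + x = s + (2 * x + e)"
    by simp_all
  note defs = seaweed_rel_def same_block.simps shift Un_iff atLeastLessThan_iff
  show ?thesis
  proof (unfold_locales, goal_cases)
    case 1 show ?case using n by auto
  next
    case (12 i j) then show ?case using n A[of i j] B[of i j] unfolding defs by linarith
  next
    case (13 i j) then show ?case using n A[of i j] B[of i j] unfolding defs by linarith
  next
    case (14 i j) then show ?case using n A[of i j] B[of i j] unfolding defs by linarith
  next
    case (15 i j) then show ?case unfolding defs by linarith
  next
    case (16 i j) then show ?case using n A[of i j] B[of i j] unfolding defs by linarith
  next
    case (17 i j k l)
    have "s + x \<le> i" "j < s + x" using 17(2,3) by auto
    then have "\<not> seaweed_rel s (x # a) ((2 * x + e) # b) i j"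
      using A[of i j] B[of i j] unfolding defs by linarith
    then show ?case using 17(1) by blast
  next
    case (18 i j)
    have "\<not> seaweed_rel s (x # a) ((2 * x + e) # b) i (j - (x + e))"
      if "s + x \<le> i" "s + x + e \<le> j" "j < s + (2 * x + e)"
    proof -
      have "j - (x + e) < s + x" using that pos by linarith
      then show ?thesis using that A[of i "j - (x + e)"] B[of i "j - (x + e)"] unfolding defs by linarith
    qed
    note tau = this
    have U: "i \<in> {s + x..<s + x + e} \<union> {s + x + e..<s + (2 * x + e)} \<union> {s + (2 * x + e)..<n} \<longleftrightarrow> s + x \<le> i \<and> i < n" for i
      using n by auto
    show ?case
    proof (cases "i \<in> {s + x..<s + x + e} \<and> j \<in> {s + x + e..<s + (2 * x + e)}")
      case True
      then have "\<not> seaweed_rel (s + x) a (e # x # b) i j"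
        using n A[of i j] B[of i j] unfolding defs by linarith
      moreover note tau
      ultimately show ?thesis unfolding if_P[OF True] U using True n by simp
    next
      case False
      have "seaweed_rel (s + x) a (e # x # b) i j \<longleftrightarrow> (s + x \<le> i \<and> i < n) \<and> (s + x \<le> j \<and> j < n) \<and> seaweed_rel s (x # a) ((2 * x + e) # b) i j"
      proof (cases i j rule: linorder_cases)
        case less
        then have *: "i \<le> j" "\<not> j \<le> i" by simp_all
        show ?thesis using False less n A[of i j] B[of i j] unfolding defs * simp_thms by linarith
      next
        case equal
        show ?thesis using False n A[of i j] B[of i j] unfolding defs equal by linarith
      next
        case greater
        then have *: "\<not> i \<le> j" "j \<le> i" by simp_all
        show ?thesis using False greater n A[of i j] B[of i j] unfolding defs * simp_thms by linarith
      qed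
      then show ?thesis unfolding if_not_P[OF False] U .
    qed
  qed auto
qed

text \<open>The case \<open>x < y < 2 * x\<close> with \<open>d = y - x\<close> and
  \<open>e = 2 * x - y\<close>. The first block of the first composition is
  \<open>P \<union> M\<close>, so \<open>M \<times> P\<close> is full and
  \<open>M \<times> D\<close> stays full after the renaming.\<close>

lemma meander_step_overlap:
  assumes n: "s + (d + e) + sum_list a = n" "s + (2 * d + e) + sum_list b = n"
  shows "meander_step_preorder n {s..<s + d} {s + d..<s + (d + e)} {s + (d + e)..<s + (2 * d + e)} {s + (2 * d + e)..<n}
    (\<lambda>j. j - (d + e)) (\<lambda>i. i + (d + e)) (seaweed_rel s ((d + e) # a) ((2 * d + e) # b))
    (seaweed_rel (s + d) (e # a) ((d + e) # b))"
proof -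
  interpret finite_preorder n "seaweed_rel s ((d + e) # a) ((2 * d + e) # b)"
    by (rule finite_preorder_seaweed_rel) (use n in auto)
  have A: "\<not> same_block (s + (d + e)) a i j \<or> (s + (d + e) \<le> i \<and> i < n \<and> s + (d + e) \<le> j \<and> j < n)" for i j
    using same_block_bounds[of "s + (d + e)" a i j] n by (auto simp: add.assoc)
  have B: "\<not> same_block (s + (2 * d + e)) b i j \<or> (s + (2 * d + e) \<le> i \<and> i < n \<and> s + (2 * d + e) \<le> j \<and> j < n)" for i j
    using same_block_bounds[of "s + (2 * d + e)" b i j] n by (auto simp: add.assoc)
  have shift: "s + d + e = s + (d + e)" "s + d + (d + e) = s + (2 * d + e)"
    by simp_all
  note defs = seaweed_rel_def same_block.simps shift Un_iff atLeastLessThan_iff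
  show ?thesis
  proof (unfold_locales, goal_cases)
    case 1 show ?case using n by auto
  next
    case (12 i j) then show ?case using n A[of i j] B[of i j] unfolding defs by linarith
  next
    case (13 i j) then show ?case using n A[of i j] B[of i j] unfolding defs by linarith
  next
    case (14 i j) then show ?case using n A[of i j] B[of i j] unfolding defs by linarith
  next
    case (15 i j) then show ?case unfolding defs by linarith
  next
    case (16 i j) then show ?case using n A[of i j] B[of i j] unfolding defs by linarith
  next
    case (17 i j k l)
    have "l < s + (d + e)" "s + (d + e) \<le> k" using 17(4,5) by auto
    then show ?case using A[of k l] B[of k l] unfolding defs by linarith
  next
    case (18 i j)
    have "seaweed_rel s ((d + e) # a) ((2 * d + e) # b) i (j - (d + e))"
      if "s + d \<le> i" "i < s + (d + e)" "s + (d + e) \<le> j" "j < s + (2 * d + e)"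
    proof -
      have "s \<le> j - (d + e)" "j - (d + e) \<le> i" "j - (d + e) < s + (d + e)" using that by linarith+
      then show ?thesis using that by (simp add: seaweed_rel_def)
    qed
    note tau = this
    have U: "i \<in> {s + d..<s + (d + e)} \<union> {s + (d + e)..<s + (2 * d + e)} \<union> {s + (2 * d + e)..<n} \<longleftrightarrow> s + d \<le> i \<and> i < n" for i
      using n by auto
    show ?case
    proof (cases "i \<in> {s + d..<s + (d + e)} \<and> j \<in> {s + (d + e)..<s + (2 * d + e)}")
      case True
      then have "seaweed_rel (s + d) (e # a) ((d + e) # b) i j"
        using n A[of i j] B[of i j] unfolding defs by linarith
      moreover note tau
      ultimately show ?thesis unfolding if_P[OF True] U using True n by simp
    next
      case False
      have "seaweed_rel (s + d) (e # a) ((d + e) # b) i j \<longleftrightarrow> (s + d \<le> i \<and> i < n) \<and> (s + d \<le> j \<and> j < n) \<and> seaweed_rel s ((d + e) # a) ((2 * d + e) # b) i j"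
      proof (cases i j rule: linorder_cases)
        case less
        then have *: "i \<le> j" "\<not> j \<le> i" by simp_all
        show ?thesis using False less n A[of i j] B[of i j] unfolding defs * simp_thms by linarith
      next
        case equal
        show ?thesis using False n A[of i j] B[of i j] unfolding defs equal by linarith
      next
        case greater
        then have *: "\<not> i \<le> j" "j \<le> i" by simp_all
        show ?thesis using False greater n A[of i j] B[of i j] unfolding defs * simp_thms by linarith
      qed
      then show ?thesis unfolding if_not_P[OF False] U .
    qed
  qed auto
qed

text \<open>The deficiency of a pair of compositions is the difference between \<open>n\<close> and the index of the
  corresponding subalgebra of \<open>gl(n)\<close>. The recursion is Panyushev's reduction.\<close>

function deficiency :: "nat list \<Rightarrow> nat list \<Rightarrow> nat" where
  "deficiency [] b = 0"
| "deficiency (x # a) [] = 0"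
| "deficiency (x # a) (y # b) =
    (if x = y then deficiency a b
     else if y < x then deficiency (y # b) (x # a)
     else if x = 0 then 0
     else if 2 * x < y then x + deficiency a ((y - 2 * x) # x # b)
     else if 2 * x = y then x + deficiency a (x # b)
     else (y - x) + deficiency ((2 * x - y) # a) (x # b))"
  by pat_completeness auto
termination
  \<comment> \<open>The last summand drops on a swap; in every other call the sums, or for two equal
    zero parts the lengths, drop by more than it can gain. The branch \<open>x = 0\<close> stops a
    step that would leave the sums unchanged.\<close>
  by (relation "measure (\<lambda>(a, b). 4 * (sum_list a + sum_list b) + 2 * (length a + length b)
      + (if a \<noteq> [] \<and> b \<noteq> [] \<and> hd b < hd a then 1 else 0))") auto

declare deficiency.simps(3) [simp del]

text \<open>The least dimension of a radical is \<open>m - d\<close>, split into two bounds with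
  sums so as to avoid truncated subtraction. Here \<open>m\<close> is the size of the seaweed and
  \<open>n\<close> that of the ambient matrices.\<close>

definition has_gl_index :: "nat \<Rightarrow> (nat \<Rightarrow> nat \<Rightarrow> bool) \<Rightarrow> nat \<Rightarrow> nat \<Rightarrow> bool" where
  "has_gl_index n R m d \<longleftrightarrow> (\<forall>F\<in>supported R. m \<le> cm.dim (rad n R F) + d)
     \<and> (\<exists>F\<in>supported R. cm.dim (rad n R F) + d \<le> m)"

text \<open>The step preserves the least dimension, so size and deficiency shift by the same
  \<open>k\<close>; it is applied with the number of removed indices.\<close>

lemma has_gl_index_step:
  assumes "meander_step_preorder n P M D N \<tau> \<upsilon> R R'" and ind: "has_gl_index n R' m d"
  shows "has_gl_index n R (k + m) (k + d)"
proof -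
  interpret meander_step_preorder n P M D N \<tau> \<upsilon> R R' by fact
  have "k + m \<le> cm.dim (rad n R F) + (k + d)" if "F \<in> supported R" for F
  proof -
    have "m - d \<le> cm.dim (rad n R' F')" if "F' \<in> supported R'" for F'
      using ind that unfolding has_gl_index_def by force
    then have "m - d \<le> cm.dim (rad n R F)" using dim_rad_ge that by blast
    then show ?thesis by simp
  qed
  moreover obtain F' where "F' \<in> supported R'" "cm.dim (rad n R' F') + d \<le> m"
    using ind unfolding has_gl_index_def by blast
  then have "\<exists>F\<in>supported R. cm.dim (rad n R F) + (k + d) \<le> k + m"
    by (elim dim_rad_le) force
  ultimately show ?thesis unfolding has_gl_index_def by blast
qed

lemma has_gl_index_transpose:
  assumes R: "\<And>i j. R i j \<Longrightarrow> i < n \<and> j < n" and ind: "has_gl_index n R m d"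
  shows "has_gl_index n (\<lambda>i j. R j i) m d"
proof -
  let ?R = "\<lambda>i j. R j i"
  have t: "(\<lambda>i j. F j i) \<in> supported R" if "F \<in> supported ?R" for F
    using that by (auto simp: supported_def)
  have t': "(\<lambda>i j. F j i) \<in> supported ?R" if "F \<in> supported R" for F
    using that by (auto simp: supported_def)
  have 1: "cm.dim (rad n R (\<lambda>i j. F j i)) \<le> cm.dim (rad n ?R F)" for F
    using dim_rad_transpose_le[of R n "\<lambda>i j. F j i"] R by simp
  have 2: "cm.dim (rad n ?R (\<lambda>i j. F j i)) \<le> cm.dim (rad n R F)" for F
    using dim_rad_transpose_le[of ?R n "\<lambda>i j. F j i"] R by simp
  have "m \<le> cm.dim (rad n ?R F) + d" if "F \<in> supported ?R" for F
    using ind t[OF that] 1[of F] unfolding has_gl_index_def by (meson add_le_mono1 order_trans)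
  moreover obtain F where "F \<in> supported R" "cm.dim (rad n R F) + d \<le> m"
    using ind unfolding has_gl_index_def by blast
  then have "(\<lambda>i j. F j i) \<in> supported ?R \<and> cm.dim (rad n ?R (\<lambda>i j. F j i)) + d \<le> m"
    using t' 2[of F] by force
  ultimately show ?thesis unfolding has_gl_index_def by blast
qed

lemma has_gl_index_block:
  assumes n: "s + x + sum_list a = n" "s + x + sum_list b = n"
    and ind: "has_gl_index n (seaweed_rel (s + x) a b) m d"
  shows "has_gl_index n (seaweed_rel s (x # a) (x # b)) (x + m) d"
proof -
  let ?P = "{s..<s + x}" and ?R = "seaweed_rel s (x # a) (x # b)" and ?R' = "seaweed_rel (s + x) a b"
  interpret finite_preorder n ?R by (rule finite_preorder_seaweed_rel) (use n in auto)
  have rs: "relation_sum n ?R (full_on ?P) ?R' ?P {s + x..<n}"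
  proof
    show "i \<in> {s + x..<n} \<and> j \<in> {s + x..<n}" if "?R' i j" for i j
      using that n same_block_bounds[of "s + x" a i j] same_block_bounds[of "s + x" b i j]
      by (auto simp: seaweed_rel_def)
  qed (auto simp: full_on_def seaweed_rel_def)
  have "x + m \<le> cm.dim (rad n ?R F) + d" for F
  proof -
    have "x \<le> cm.dim (rad n (full_on ?P) (clip (full_on ?P) F))"
      using n by (intro dim_rad_full_ge clip_supported) simp
    moreover have "m \<le> cm.dim (rad n ?R' (clip ?R' F)) + d"
      using ind clip_supported unfolding has_gl_index_def by blast
    ultimately show ?thesis using dim_rad_sum_ge[OF rs, of F] by linarith
  qed
  moreover obtain F2 where F2: "F2 \<in> supported ?R'" "cm.dim (rad n ?R' F2) + d \<le> m"
    using ind unfolding has_gl_index_def by blast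
  have "?P \<subseteq> {..<n}" using n by auto
  from dim_rad_full_le[OF this]
  obtain F1 where F1: "F1 \<in> supported (full_on ?P)" "cm.dim (rad n (full_on ?P) F1) \<le> x"
    by auto
  have "F1 + F2 \<in> supported ?R" "cm.dim (rad n ?R (F1 + F2)) + d \<le> x + m"
    using dim_rad_sum_le[OF rs F1(1) F2(1)] F1(2) F2(2) by auto
  ultimately show ?thesis unfolding has_gl_index_def by blast
qed

theorem gl_index_deficiency:
  assumes "composition m a" "composition m b" "s + m = n"
  shows "has_gl_index n (seaweed_rel s a b) m (deficiency a b)"
  using assms
proof (induction a b arbitrary: s m rule: deficiency.induct)
  case (1 b)
  then have b: "m = 0" "b = []" by (auto simp: composition_def) (metis gr0I list.set_intros(1) neq_Nil_conv not_gr0)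
  have z: "supported (seaweed_rel s [] []) = {0}"
    by (auto simp: supported_def seaweed_rel_def fun_eq_iff)
  have "rad n (seaweed_rel s [] []) 0 = {0}"
    using rad_subset[of n "seaweed_rel s [] []" 0] cm.subspace_0[OF subspace_rad] unfolding z by blast
  moreover have "cm.dim {0} = 0" using cm.dim_le_card[of "{0}" "{}"] by simp
  ultimately show ?case unfolding has_gl_index_def z b by simp
next
  case (2 x a)
  then show ?case by (auto simp: composition_def)
next
  case (3 x a y b)
  have pos: "0 < x" "0 < y" and n: "s + x + sum_list a = n" "s + y + sum_list b = n"
    and ab: "\<forall>z\<in>set a. 0 < z" "\<forall>z\<in>set b. 0 < z" and m: "x + sum_list a = m" "y + sum_list b = m"
    using "3.prems" by (auto simp: composition_def)
  consider "x = y" | "y < x" | "2 * x < y" | "2 * x = y" | "x < y" "y < 2 * x" by linarith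
  then show ?case
  proof cases
    case 1
    have "has_gl_index n (seaweed_rel (s + x) a b) (m - x) (deficiency a b)"
      using 1 ab m "3.prems" by (intro "3.IH"(1)) (auto simp: composition_def)
    then have "has_gl_index n (seaweed_rel s (x # a) (x # b)) (x + (m - x)) (deficiency a b)"
      using n 1 by (intro has_gl_index_block) auto
    then show ?thesis using 1 m by (simp add: deficiency.simps(3))
  next
    case 2
    interpret finite_preorder n "seaweed_rel s (y # b) (x # a)"
      by (rule finite_preorder_seaweed_rel) (use n in auto)
    have "has_gl_index n (seaweed_rel s (y # b) (x # a)) m (deficiency (y # b) (x # a))"
      using 2 "3.prems" by (intro "3.IH"(2)) auto
    then have "has_gl_index n (\<lambda>i j. seaweed_rel s (y # b) (x # a) j i) m (deficiency (y # b) (x # a))"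
      using has_gl_index_transpose[of "seaweed_rel s (y # b) (x # a)" n] R_less' by blast
    then show ?thesis using 2 by (simp add: deficiency.simps(3) seaweed_rel_transpose)
  next
    case 3
    have "has_gl_index n (seaweed_rel (s + x) a ((y - 2 * x) # x # b)) (m - x)
        (deficiency a ((y - 2 * x) # x # b))"
      using 3 ab m pos "3.prems" by (intro "3.IH"(3)) (auto simp: composition_def)
    moreover obtain e where "y = 2 * x + e" using 3 by (metis less_imp_le le_Suc_ex)
    ultimately have "has_gl_index n (seaweed_rel s (x # a) (y # b)) (x + (m - x))
        (x + deficiency a ((y - 2 * x) # x # b))"
      using has_gl_index_step[OF meander_step_disjoint[of x s a n e b]] pos n by simp
    then show ?thesis using 3 m pos by (simp add: deficiency.simps(3))
  next
    case 4
    have "has_gl_index n (seaweed_rel (s + x) a (x # b)) (m - x) (deficiency a (x # b))"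
      using 4 ab m pos "3.prems" by (intro "3.IH"(4)) (auto simp: composition_def)
    \<comment> \<open>For \<open>2 * x = y\<close> the middle block is empty, and a part 0
      contributes no positions.\<close>
    moreover have "seaweed_rel (s + x) a (0 # x # b) = seaweed_rel (s + x) a (x # b)"
      by (auto simp: seaweed_rel_def fun_eq_iff)
    ultimately have "has_gl_index n (seaweed_rel s (x # a) (y # b)) (x + (m - x))
        (x + deficiency a (x # b))"
      using has_gl_index_step[OF meander_step_disjoint[of x s a n 0 b]] 4 pos n by simp
    then show ?thesis using 4 m pos by (simp add: deficiency.simps(3))
  next
    case 5
    have "has_gl_index n (seaweed_rel (s + (y - x)) ((2 * x - y) # a) (x # b)) (m - (y - x))
        (deficiency ((2 * x - y) # a) (x # b))"
      using 5 ab m pos "3.prems" by (intro "3.IH"(5)) (auto simp: composition_def)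
    moreover obtain d e where "x = d + e" "y = 2 * d + e"
      using that[of "y - x" "2 * x - y"] 5 by simp
    ultimately have "has_gl_index n (seaweed_rel s (x # a) (y # b)) ((y - x) + (m - (y - x)))
        ((y - x) + deficiency ((2 * x - y) # a) (x # b))"
      using has_gl_index_step[OF meander_step_overlap[of s d e a n b]] n by simp
    then show ?thesis using 5 m pos by (simp add: deficiency.simps(3))
  qed
qed

text \<open>Serves to translate the flag conditions of \<open>seaweed\<close>, which speak of cuts
  at partial sums, into blocks.\<close>

lemma same_block_iff_partial_sums:
  assumes "s \<le> j" "j \<le> i" "i < s + sum_list a"
  shows "same_block s a i j \<longleftrightarrow> (\<forall>k\<le>length a. \<not> (j < s + sum_list (take k a) \<and> s + sum_list (take k a) \<le> i))"
  using assms
proof (induction a arbitrary: s)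
  case (Cons x a)
  have split: "(\<forall>k\<le>length (x # a). Q (s + sum_list (take k (x # a)))) \<longleftrightarrow>
      Q s \<and> (\<forall>k\<le>length a. Q (s + x + sum_list (take k a)))" (is "?l \<longleftrightarrow> ?r") for Q
  proof
    assume l: ?l
    show ?r
    proof (intro conjI allI impI)
      show "Q s" using l[rule_format, of 0] by simp
      show "Q (s + x + sum_list (take k a))" if "k \<le> length a" for k
        using l[rule_format, of "Suc k"] that by (simp add: add.assoc)
    qed
  next
    assume r: ?r
    show ?l
    proof (intro allI impI)
      fix k assume "k \<le> length (x # a)"
      then show "Q (s + sum_list (take k (x # a)))" using r by (cases k) (auto simp: add.assoc)
    qed
  qed
  show ?case
  proof (cases "s + x \<le> j")
    case True
    then have "same_block s (x # a) i j \<longleftrightarrow> same_block (s + x) a i j" using Cons.prems by auto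
    also have "\<dots> \<longleftrightarrow> (\<forall>k\<le>length a. \<not> (j < s + x + sum_list (take k a) \<and> s + x + sum_list (take k a) \<le> i))"
      using True Cons.prems by (intro Cons.IH) auto
    also have "\<dots> \<longleftrightarrow> (\<forall>k\<le>length (x # a). \<not> (j < s + sum_list (take k (x # a)) \<and> s + sum_list (take k (x # a)) \<le> i))"
      using split[of "\<lambda>t. \<not> (j < t \<and> t \<le> i)"] Cons.prems by simp
    finally show ?thesis .
  next
    case False
    then have "same_block s (x # a) i j \<longleftrightarrow> i < s + x"
      using Cons.prems same_block_bounds[of "s + x" a i j] by auto
    also have "\<dots> \<longleftrightarrow> (\<forall>k\<le>length a. \<not> (j < s + x + sum_list (take k a) \<and> s + x + sum_list (take k a) \<le> i))"
      using False by (auto dest: spec[of _ 0])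
    also have "\<dots> \<longleftrightarrow> (\<forall>k\<le>length (x # a). \<not> (j < s + sum_list (take k (x # a)) \<and> s + sum_list (take k (x # a)) \<le> i))"
      using split[of "\<lambda>t. \<not> (j < t \<and> t \<le> i)"] Cons.prems by simp
    finally show ?thesis .
  qed
qed simp

section \<open>From \<open>gl(n)\<close> to the traceless matrices\<close>

definition trace :: "nat \<Rightarrow> cmat \<Rightarrow> complex" where
  "trace n X = (\<Sum>i<n. X i i)"

lemma seaweed_eq_supported:
  assumes "composition n a" "composition n b"
  shows "seaweed n a b = {X \<in> supported (seaweed_rel 0 a b). trace n X = 0}"
proof -
  have n: "sum_list a = n" "sum_list b = n" using assms by (auto simp: composition_def)
  have A: "same_block 0 a i j \<longleftrightarrow> (\<forall>k\<le>length a. \<not> (j < sum_list (take k a) \<and> sum_list (take k a) \<le> i))"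
    if "j \<le> i" "i < n" for i j
    using same_block_iff_partial_sums[of 0 j i a] that n by simp
  have B: "same_block 0 b i j \<longleftrightarrow> (\<forall>k\<le>length b. \<not> (i < sum_list (take k b) \<and> sum_list (take k b) \<le> j))"
    if "i \<le> j" "j < n" for i j
    using same_block_iff_partial_sums[of 0 i j b] that n same_block_sym[of 0 b] by auto
  have R: "seaweed_rel 0 a b i j \<longleftrightarrow> \<not> n \<le> i \<and> \<not> n \<le> j \<and>
      (\<forall>k\<le>length a. \<not> (j < sum_list (take k a) \<and> sum_list (take k a) \<le> i)) \<and>
      (\<forall>k\<le>length b. \<not> (i < sum_list (take k b) \<and> sum_list (take k b) \<le> j))" for i j
  proof (cases "i < n \<and> j < n")
    case True
    show ?thesis
    proof (cases "i \<le> j")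
      case T: True
      have "\<forall>k\<le>length a. \<not> (j < sum_list (take k a) \<and> sum_list (take k a) \<le> i)" using T by auto
      moreover have "same_block 0 b i j" if "j \<le> i"
        using that T True n same_block_refl[of 0 i b] by (simp add: le_antisym)
      then have "seaweed_rel 0 a b i j \<longleftrightarrow> same_block 0 b i j" using T by (auto simp: seaweed_rel_def)
      ultimately show ?thesis using B[OF T] True by simp
    next
      case F: False
      then have "\<forall>k\<le>length b. \<not> (i < sum_list (take k b) \<and> sum_list (take k b) \<le> j)" by auto
      moreover have "seaweed_rel 0 a b i j \<longleftrightarrow> same_block 0 a i j" using F by (auto simp: seaweed_rel_def)
      ultimately show ?thesis using A[of j i] True F by simp
    qed
  next
    case False
    then have "\<not> same_block 0 a i j" "\<not> same_block 0 b i j"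
      using n same_block_bounds[of 0 a i j] same_block_bounds[of 0 b i j] by auto
    then show ?thesis using False by (auto simp: seaweed_rel_def)
  qed
  show ?thesis
    unfolding seaweed_def supported_def trace_def R by blast
qed

lemma trace_linear: "trace n (X + Y) = trace n X + trace n Y" "trace n (mscale c X) = c * trace n X"
  by (simp_all add: trace_def mscale_def sum.distrib sum_distrib_left)

lemma trace_bracket: "trace n (bracket n X Y) = 0"
proof -
  have "(\<Sum>i<n. \<Sum>k<n. X i k * Y k i) = (\<Sum>k<n. \<Sum>i<n. X i k * Y k i)" by (rule sum.swap)
  then show ?thesis by (simp add: trace_def bracket_def mmul_def sum_subtractf mult.commute)
qed

lemma bracket_eq: "bracket n X Y = mmul n X Y + mscale (- 1) (mmul n Y X)"
  by (simp add: bracket_def mscale_def fun_eq_iff)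

lemma pairing_bracket: "pairing n F (bracket n X Y) = commutator_form n F X Y"
  unfolding bracket_eq pairing_add pairing_scale commutator_form_def by simp

lemma functional_eq_pairing:
  assumes fin: "\<And>i j. R i j \<Longrightarrow> i < n \<and> j < n" and L: "lin_functional_on (supported R) L"
    and X: "X \<in> supported R"
  shows "L X = pairing n (clip R (\<lambda>i j. L (unit_mat i j))) X"
proof -
  have add: "L (X + Y) = L X + L Y" if "X \<in> supported R" "Y \<in> supported R" for X Y
    using L that by (simp add: lin_functional_on_def)
  have sc: "L (mscale c X) = c * L X" if "X \<in> supported R" for X c
    using L that by (simp add: lin_functional_on_def)
  note sp = cm.subspace_0[OF subspace_supported] cm.subspace_sum[OF subspace_supported]
    cm.subspace_scale[OF subspace_supported]
  \<comment> \<open>\<open>L\<close> is linear only on \<open>supported R\<close>; positions off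
    \<open>R\<close> therefore contribute 0 and not a matrix unit, on which \<open>L\<close> is
    arbitrary.\<close>
  define e where "e q = mscale (X (fst q) (snd q)) (if R (fst q) (snd q) then unit_mat (fst q) (snd q) else 0)" for q
  have e: "e q \<in> supported R" for q unfolding e_def using unit_mat_supported[of R "fst q" "snd q"] sp by auto
  have L0: "L 0 = 0" using sc[OF sp(1), of 0] by simp
  have Ls: "L (\<Sum>q\<in>Q. e q) = (\<Sum>q\<in>Q. L (e q))" if "finite Q" for Q
    using that
  proof induction
    case (insert q Q)
    have "L (e q + (\<Sum>q\<in>Q. e q)) = L (e q) + L (\<Sum>q\<in>Q. e q)"
      by (rule add[OF e sp(2)]) (rule e)
    then show ?case unfolding sum.insert[OF insert.hyps] insert.IH .
  qed (simp only: sum.empty L0)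
  let ?Q = "{..<n} \<times> {..<n}"
  have "X = (\<Sum>q\<in>?Q. e q)"
  proof (intro ext)
    fix i j
    have "(\<Sum>q\<in>?Q. e q) i j = (\<Sum>q\<in>?Q. if q = (i, j) then X i j else 0)"
      unfolding sum_cmat_apply using supported_zero[OF X]
      by (intro sum.cong) (auto simp: e_def mscale_def unit_mat_apply)
    also have "\<dots> = X i j" using supported_zero[OF X, of i j] fin[of i j] by (auto simp: sum.delta)
    finally show "X i j = (\<Sum>q\<in>?Q. e q) i j" by simp
  qed
  then have "L X = (\<Sum>q\<in>?Q. L (e q))" using Ls[of ?Q] by simp
  also have "\<dots> = (\<Sum>q\<in>?Q. clip R (\<lambda>i j. L (unit_mat i j)) (fst q) (snd q) * X (fst q) (snd q))"
    using sc unit_mat_supported[of R] L0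
    by (intro sum.cong) (auto simp: e_def clip_def)
  finally show ?thesis by (simp add: pairing_def sum.cartesian_product split_beta)
qed

context finite_preorder
begin

definition sl :: "cmat set" where "sl = {X \<in> supported R. trace n X = 0}"

lemma bracket_sl:
  assumes "X \<in> supported R" "Y \<in> supported R"
  shows "bracket n X Y \<in> sl"
proof -
  have "mmul n A B \<in> supported R" if "A \<in> supported R" "B \<in> supported R" for A B
    using that by (rule mmul_supported) (rule R_trans)
  then have "bracket n X Y \<in> supported R" unfolding bracket_eq
    using assms by (intro cm.subspace_add[OF subspace_supported] cm.subspace_scale[OF subspace_supported])
  then show ?thesis by (simp add: sl_def trace_bracket)
qed

context
  assumes n: "0 < n" and all: "\<And>i. i < n \<Longrightarrow> R i i"
begin

lemma trace_unit: "trace n (restrict_unit R) = of_nat n"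
  unfolding trace_def restrict_unit_def using all by simp

lemma commutator_form_unit:
  "X \<in> supported R \<Longrightarrow> commutator_form n F X (restrict_unit R) = 0"
  using mmul_restrict_unit[of R n X] R_less' R_refl by (simp add: commutator_form_def)

lemma traceless_part:
  assumes "X \<in> supported R"
  shows "X + mscale (- trace n X / of_nat n) (restrict_unit R) \<in> sl"
proof -
  have "X + mscale (- trace n X / of_nat n) (restrict_unit R) \<in> supported R"
    by (intro cm.subspace_add[OF subspace_supported] cm.subspace_scale[OF subspace_supported]
        restrict_unit_supported assms)
  moreover have "trace n (X + mscale (- trace n X / of_nat n) (restrict_unit R)) = 0"
    unfolding trace_linear trace_unit using n by simp
  ultimately show ?thesis by (simp only: sl_def mem_Collect_eq simp_thms)
qed

text \<open>The unit pairs to 0 with everything and spans a complement of the traceless matrices, so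
  testing against these is the same as testing against the whole algebra.\<close>

lemma kerB_pairing: "kerB n sl (pairing n F) = {X \<in> rad n R F. trace n X = 0}"
proof -
  have "commutator_form n F X Y = 0"
    if X: "X \<in> sl" and z: "\<forall>Y\<in>sl. commutator_form n F X Y = 0" and Y: "Y \<in> supported R" for X Y
  proof -
    let ?c = "- trace n Y / of_nat n"
    have "commutator_form n F X (Y + mscale ?c (restrict_unit R)) = 0"
      using z traceless_part[OF Y] by blast
    then show ?thesis using X commutator_form_unit[of X F]
      unfolding commutator_form_bilinear by (simp add: sl_def)
  qed
  then show ?thesis
    unfolding kerB_def rad_commutator_form pairing_bracket by (auto simp: sl_def)
qed

text \<open>The unit lies in the radical and has nonzero trace, so the trace cuts off exactly one
  dimension.\<close>

lemma dim_rad_eq_kerB: "cm.dim (rad n R F) = cm.dim (kerB n sl (pairing n F)) + 1"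
proof (rule antisym)
  show "cm.dim (rad n R F) \<le> cm.dim (kerB n sl (pairing n F)) + 1"
    unfolding kerB_pairing
    by (rule cm.dim_le_kernel_functional[OF subspace_rad findim_rad_R]) (simp_all add: trace_linear)
  let ?u = "restrict_unit R"
  have "commutator_form n F ?u Y = 0" if "Y \<in> supported R" for Y
    using commutator_form_unit[OF that, of F] by (simp add: commutator_form_def)
  then have u: "?u \<in> rad n R F" using restrict_unit_supported by (simp add: rad_commutator_form)
  have u0: "?u \<noteq> 0" using trace_unit n by (auto simp: trace_def)
  have "cm.dim (kerB n sl (pairing n F)) + cm.dim (cm.span {?u}) \<le> cm.dim (rad n R F)"
    unfolding kerB_pairing
  proof (rule cm.dim_sum_le_disjoint[OF findim_rad_R])
    show "cm.span {?u} \<subseteq> rad n R F" using u by (intro cm.span_minimal subspace_rad) auto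
    show "cm.subspace {X \<in> rad n R F. trace n X = 0}"
      using subspace_rad[of n R F] by (auto simp: cm.subspace_def trace_linear) (simp add: trace_def)
    show "{X \<in> rad n R F. trace n X = 0} \<inter> cm.span {?u} \<subseteq> {0}"
      using trace_unit n by (auto simp: cm.span_singleton trace_linear)
  qed auto
  moreover have "cm.dim (cm.span {?u}) = 1"
    using cm.dim_span_eq_card_independent[of "{?u}"] u0 by simp
  ultimately show "cm.dim (kerB n sl (pairing n F)) + 1 \<le> cm.dim (rad n R F)" by simp
qed

text \<open>Removing the scalar part of the argument first extends \<open>f\<close> to the whole
  algebra; brackets are traceless, so \<open>B_f\<close> is unchanged.\<close>

lemma kerB_eq_pairing:
  assumes f: "lin_functional_on sl f"
  obtains F where "F \<in> supported R" "kerB n sl f = kerB n sl (pairing n F)"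
proof -
  let ?p = "\<lambda>X. X + mscale (- trace n X / of_nat n) (restrict_unit R)"
  define L where "L = (\<lambda>X. f (?p X))"
  have p: "?p (X + Y) = ?p X + ?p Y" "?p (mscale c X) = mscale c (?p X)" for X Y c
    unfolding trace_linear using n by (simp_all add: mscale_def fun_eq_iff field_simps)
  have "lin_functional_on (supported R) L"
    using f traceless_part unfolding lin_functional_on_def L_def p by blast
  then have LF: "L X = pairing n (clip R (\<lambda>i j. L (unit_mat i j))) X" if "X \<in> supported R" for X
    using functional_eq_pairing[OF R_less'] that by blast
  have "L X = f X" if "X \<in> sl" for X
    using that by (simp add: L_def sl_def mscale_def zero_fun_def[symmetric])
  then have "f (bracket n X Y) = pairing n (clip R (\<lambda>i j. L (unit_mat i j))) (bracket n X Y)"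
    if "X \<in> sl" "Y \<in> sl" for X Y
    using LF bracket_sl[of X Y] that unfolding sl_def by force
  then have "kerB n sl f = kerB n sl (pairing n (clip R (\<lambda>i j. L (unit_mat i j))))"
    unfolding kerB_def by auto
  then show ?thesis using that clip_supported by blast
qed

lemma lie_index_sl:
  assumes ind: "has_gl_index n R n d"
  shows "lie_index n sl + 1 + d = n"
proof -
  have cdim: "cdim S = cm.dim S" for S by (simp add: cdim_def)
  have low: "n \<le> cdim (kerB n sl f) + 1 + d" if "lin_functional_on sl f" for f
  proof -
    obtain F where "F \<in> supported R" "kerB n sl f = kerB n sl (pairing n F)"
      using kerB_eq_pairing[OF \<open>lin_functional_on sl f\<close>] .
    then show ?thesis using ind dim_rad_eq_kerB[of F] unfolding has_gl_index_def cdim by auto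
  qed
  obtain F where F: "F \<in> supported R" "cm.dim (rad n R F) + d \<le> n"
    using ind unfolding has_gl_index_def by blast
  have lin: "lin_functional_on sl (pairing n F)"
    by (simp add: lin_functional_on_def pairing_add pairing_scale)
  have "cdim (kerB n sl (pairing n F)) + 1 + d = n"
    using F(2) low[OF lin] unfolding dim_rad_eq_kerB cdim by simp
  moreover have "lie_index n sl = cdim (kerB n sl (pairing n F))"
    unfolding lie_index_def
  proof (rule Least_equality)
    show "\<exists>f. lin_functional_on sl f \<and> cdim (kerB n sl f) = cdim (kerB n sl (pairing n F))"
      using lin by blast
    fix k assume "\<exists>f. lin_functional_on sl f \<and> cdim (kerB n sl f) = k"
    then show "cdim (kerB n sl (pairing n F)) \<le> k"
      using low F(2) unfolding dim_rad_eq_kerB cdim by fastforce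
  qed
  ultimately show ?thesis by simp
qed

end

end

theorem lie_index_seaweed:
  assumes "0 < n" "composition n a" "composition n b"
  shows "lie_index n (seaweed n a b) + 1 + deficiency a b = n"
proof -
  have n: "sum_list a = n" "sum_list b = n" using assms by (auto simp: composition_def)
  interpret finite_preorder n "seaweed_rel 0 a b"
    by (rule finite_preorder_seaweed_rel) (use n in auto)
  have "lie_index n sl + 1 + deficiency a b = n"
  proof (rule lie_index_sl[OF assms(1)])
    show "seaweed_rel 0 a b i i" if "i < n" for i
      using same_block_refl[of 0 i a] that n by (simp add: seaweed_rel_def)
  qed (use gl_index_deficiency[OF assms(2,3), of 0] in simp)
  then show ?thesis using seaweed_eq_supported[OF assms(2,3)] by (simp add: sl_def)
qed

section \<open>Counting pairs of small deficiency\<close>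

definition comps :: "nat \<Rightarrow> nat list set" where
  "comps n = {a. composition n a}"

lemma composition_Nil [simp]: "composition n [] \<longleftrightarrow> n = 0"
  by (auto simp: composition_def)

lemma composition_Cons [simp]: "composition n (x # a) \<longleftrightarrow> 0 < x \<and> x \<le> n \<and> composition (n - x) a"
  by (auto simp: composition_def)

lemma composition_0 [simp]: "composition 0 a \<longleftrightarrow> a = []"
  by (cases a) auto

lemma composition_pos: "composition n a \<Longrightarrow> 0 < n \<Longrightarrow> \<exists>x a'. a = x # a' \<and> 0 < x \<and> x \<le> n \<and> composition (n - x) a'"
  by (cases a) auto

lemma comps_0: "comps 0 = {[]}"
  by (auto simp: comps_def)

lemma comps_eq_image: "0 < n \<Longrightarrow> comps n = (\<lambda>(k, a). k # a) ` (SIGMA k:{1..n}. comps (n - k))"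
  unfolding comps_def by (force dest: composition_pos)

lemma finite_comps: "finite (comps n)"
proof (induction n rule: less_induct)
  case (less n)
  show ?case
  proof (cases "n = 0")
    case False
    then have "finite (comps (n - k))" if "k \<in> {1..n}" for k using that by (intro less) auto
    then show ?thesis using False by (subst comps_eq_image) (auto intro!: finite_imageI finite_SigmaI)
  qed (simp add: comps_0)
qed

lemma sum_diff_eq: "(\<Sum>k\<in>{i + 1..n}. f (n - k)) = (\<Sum>j<n - i. f j)" for f :: "nat \<Rightarrow> nat"
  by (rule sum.reindex_bij_witness[of _ "\<lambda>j. n - j" "\<lambda>k. n - k"]) auto

text \<open>Removing the first part \<open>k\<close> leaves a composition of \<open>n - k\<close>.
  It follows that the numbers double from size 1 on.\<close>

lemma sum_card_comps: "0 < n \<Longrightarrow> (\<Sum>j<n. card (comps j)) = card (comps n)"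
proof -
  assume n: "0 < n"
  have "card (comps n) = card (SIGMA k:{1..n}. comps (n - k))"
    unfolding comps_eq_image[OF n] by (rule card_image) (auto simp: inj_on_def)
  also have "\<dots> = (\<Sum>k\<in>{1..n}. card (comps (n - k)))" by (simp add: finite_comps)
  also have "\<dots> = (\<Sum>j<n. card (comps j))" using sum_diff_eq[of "\<lambda>j. card (comps j)" n 0] by simp
  finally show ?thesis by simp
qed

lemma card_comps: "card (comps (Suc n)) = 2 ^ n"
proof (induction n)
  case 0
  then show ?case using sum_card_comps[of 1] by (simp add: comps_0)
next
  case (Suc n)
  then show ?case using sum_card_comps[of "Suc (Suc n)"] sum_card_comps[of "Suc n"] by simp
qed

lemma deficiency_self: "deficiency a a = 0"
  by (induction a) (auto simp: deficiency.simps(3))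

text \<open>Unequal first parts contribute \<open>min x (y - x)\<close>, which is positive.\<close>

lemma deficiency_eq_0:
  "composition n a \<Longrightarrow> composition n b \<Longrightarrow> deficiency a b = 0 \<longleftrightarrow> a = b"
proof (induction a b arbitrary: n rule: deficiency.induct)
  case (3 x a y b)
  consider "x = y" | "y < x" | "x < y" by linarith
  then show ?case
  proof cases
    case 1
    then show ?thesis using "3.IH"(1)[OF 1, of "n - x"] "3.prems" by (simp add: deficiency.simps(3))
  next
    case 2
    then show ?thesis using "3.IH"(2)[of n] "3.prems" by (auto simp: deficiency.simps(3))
  next
    case 3
    then show ?thesis using "3.prems" by (simp add: deficiency.simps(3))
  qed
qed auto

text \<open>The first composition of a pair of deficiency one is determined by the second one, \<open>y # r\<close>,
  if its first part is the smaller one.\<close>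

definition partner1 :: "nat \<Rightarrow> nat list \<Rightarrow> nat list" where
  "partner1 y r = (if y = 2 then 1 # 1 # r else 1 # (y - 2) # 1 # r)"

text \<open>The analogue for a step with first parts 2 and \<open>y\<close> after which both
  compositions agree; the case distinction avoids a part 0.\<close>

definition partner2 :: "nat \<Rightarrow> nat list \<Rightarrow> nat list" where
  "partner2 y r = (if y = 4 then 2 # 2 # r else 2 # (y - 4) # 2 # r)"

text \<open>What a step with first parts 1 and \<open>y\<close> makes of the second
  composition.\<close>

definition reduct1 :: "nat \<Rightarrow> nat list \<Rightarrow> nat list" where
  "reduct1 y r = (if y = 2 then 1 # r else (y - 2) # 1 # r)"

lemma composition_partner1: "2 \<le> y \<Longrightarrow> composition n (partner1 y r) \<longleftrightarrow> composition n (y # r)"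
  by (auto simp: partner1_def composition_def simp del: composition_Cons)

lemma composition_partner2: "4 \<le> y \<Longrightarrow> composition n (partner2 y r) \<longleftrightarrow> composition n (y # r)"
  by (auto simp: partner2_def composition_def simp del: composition_Cons)

lemma composition_reduct1: "2 \<le> y \<Longrightarrow> composition (n - 1) (reduct1 y r) \<longleftrightarrow> composition n (y # r)"
  by (auto simp: reduct1_def composition_def simp del: composition_Cons)

text \<open>The step must contribute 1 and leave equal compositions. For \<open>y < 2 * x\<close> it
  leaves the unequal first parts \<open>2 * x - y\<close> and \<open>x\<close>, so more deficiency
  follows.\<close>

lemma deficiency_eq_1:
  assumes xy: "x < y" and c: "composition n (x # a)" "composition n (y # b)"
  shows "deficiency (x # a) (y # b) = 1 \<longleftrightarrow> x # a = partner1 y b"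
proof -
  have pos: "0 < x" using c by simp
  have ca: "composition (n - x) a" using c by simp
  consider "2 * x < y" | "2 * x = y" | "y < 2 * x" by linarith
  then show ?thesis
  proof cases
    case 1
    have "composition (n - x) ((y - 2 * x) # x # b)" using c 1 by (auto simp: composition_def simp del: composition_Cons)
    then have "deficiency a ((y - 2 * x) # x # b) = 0 \<longleftrightarrow> a = (y - 2 * x) # x # b"
      by (rule deficiency_eq_0[OF ca])
    then show ?thesis using 1 xy pos by (auto simp: deficiency.simps(3) partner1_def)
  next
    case 2
    have "composition (n - x) (x # b)" using c 2 by (auto simp: composition_def simp del: composition_Cons)
    then have "deficiency a (x # b) = 0 \<longleftrightarrow> a = x # b"
      by (rule deficiency_eq_0[OF ca])
    then show ?thesis using 2 xy pos by (auto simp: deficiency.simps(3) partner1_def)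
  next
    case 3
    have "composition (n - (y - x)) ((2 * x - y) # a)" "composition (n - (y - x)) (x # b)"
      using c 3 xy by (auto simp: composition_def simp del: composition_Cons)
    then have "deficiency ((2 * x - y) # a) (x # b) \<noteq> 0"
      using deficiency_eq_0 xy by fastforce
    moreover have "deficiency (x # a) (y # b) = (y - x) + deficiency ((2 * x - y) # a) (x # b)"
      using 3 xy pos by (simp add: deficiency.simps(3))
    ultimately have "deficiency (x # a) (y # b) \<noteq> 1" using xy by linarith
    moreover have "x \<noteq> 1" using 3 xy by linarith
    ultimately show ?thesis by (simp add: partner1_def)
  qed
qed

text \<open>Either 2 + 0 or 1 + 1. The first needs \<open>x = 2\<close> and
  \<open>4 \<le> y\<close>, since an overlapping step never leaves equal compositions. In the
  second, the 1 comes from \<open>x = 1\<close> or from an overlap with \<open>y = x + 1\<close>;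
  there the remainder \<open>(x - 1) # a\<close> must be a \<open>partner1\<close>, which starts
  with 1, so \<open>x = 2\<close> and \<open>y = 3\<close>.\<close>

lemma deficiency_eq_2:
  assumes xy: "x < y" and c: "composition n (x # a)" "composition n (y # b)"
  shows "deficiency (x # a) (y # b) = 2 \<longleftrightarrow>
    (4 \<le> y \<and> x # a = partner2 y b) \<or> (y = 3 \<and> x # a = 2 # 1 # b)
    \<or> (x = 1 \<and> deficiency a (reduct1 y b) = 1)"
proof -
  have pos: "0 < x" using c by simp
  have ca: "composition (n - x) a" using c by simp
  have neq: "deficiency ((2 * x - y) # a) (x # b) \<noteq> 0" if "y < 2 * x"
  proof -
    have "composition (n - (y - x)) ((2 * x - y) # a)" "composition (n - (y - x)) (x # b)"
      using c that xy by (auto simp: composition_def simp del: composition_Cons)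
    then show ?thesis using deficiency_eq_0 xy by fastforce
  qed
  have eq1: "deficiency ((2 * x - y) # a) (x # b) = 1 \<longleftrightarrow> (2 * x - y) # a = partner1 x b" if "y < 2 * x"
  proof (rule deficiency_eq_1)
    show "composition (n - (y - x)) ((2 * x - y) # a)" "composition (n - (y - x)) (x # b)"
      using c that xy by (auto simp: composition_def simp del: composition_Cons)
  qed (use xy that in linarith)
  have "x = 1 \<or> x = 2 \<or> 2 < x" "x = 1 \<Longrightarrow> y = 2 \<or> 2 < y" "x = 2 \<Longrightarrow> y = 3 \<or> y = 4 \<or> 4 < y"
    "2 * x \<le> y \<or> y < 2 * x"
    using pos xy by linarith+
  then consider "x = 1" "y = 2" | "x = 1" "2 < y" | "x = 2" "y = 3" | "x = 2" "y = 4" | "x = 2" "4 < y"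
    | "2 < x" "2 * x \<le> y" | "2 < x" "y < 2 * x" "y = x + 1" | "2 < x" "y < 2 * x" "y \<noteq> x + 1"
    by blast
  then show ?thesis
  proof cases
    case 1 then show ?thesis by (simp add: deficiency.simps(3) partner2_def reduct1_def)
  next
    case 2 then show ?thesis by (simp add: deficiency.simps(3) partner2_def reduct1_def)
  next
    case 3 then show ?thesis using eq1 by (simp add: deficiency.simps(3) partner1_def)
  next
    case 4
    have "deficiency a (2 # b) = 0 \<longleftrightarrow> a = 2 # b"
      using c 4 by (intro deficiency_eq_0[OF ca]) (auto simp: composition_def simp del: composition_Cons)
    then show ?thesis using 4 by (simp add: deficiency.simps(3) partner2_def)
  next
    case 5
    have "deficiency a ((y - 4) # 2 # b) = 0 \<longleftrightarrow> a = (y - 4) # 2 # b"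
      using c 5 by (intro deficiency_eq_0[OF ca]) (auto simp: composition_def simp del: composition_Cons)
    then show ?thesis using 5 by (simp add: deficiency.simps(3) partner2_def)
  next
    case 6 then show ?thesis using xy by (auto simp: deficiency.simps(3) partner2_def)
  next
    case 7 then show ?thesis using eq1 by (auto simp: deficiency.simps(3) partner1_def partner2_def)
  next
    case 8
    then have "2 \<le> y - x" using xy by linarith
    moreover have "deficiency (x # a) (y # b) = (y - x) + deficiency ((2 * x - y) # a) (x # b)"
      using 8 xy by (simp add: deficiency.simps(3))
    ultimately have "deficiency (x # a) (y # b) \<noteq> 2" using neq[OF 8(2)] by linarith
    then show ?thesis using 8(1) by (simp add: partner2_def)
  qed
qed

section \<open>Recurrences from comparing first parts\<close>

definition deficient :: "nat \<Rightarrow> nat \<Rightarrow> (nat list \<times> nat list) set" where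
  "deficient d n = {(a, b). composition n a \<and> composition n b \<and> deficiency a b = d}"

definition deficient_less :: "nat \<Rightarrow> nat \<Rightarrow> (nat list \<times> nat list) set" where
  "deficient_less d n = {(a, b) \<in> deficient d n. a \<noteq> [] \<and> b \<noteq> [] \<and> hd a < hd b}"

lemma finite_deficient: "finite (deficient d n)"
  by (rule finite_subset[of _ "comps n \<times> comps n"]) (auto simp: deficient_def comps_def finite_comps[unfolded comps_def])

lemma finite_deficient_less: "finite (deficient_less d n)"
  using finite_deficient[of d n] by (rule finite_subset[rotated]) (auto simp: deficient_less_def)

lemma card_deficient_0: "card (deficient 0 n) = card (comps n)"
proof -
  have "deficient 0 n = (\<lambda>a. (a, a)) ` comps n"
    using deficiency_eq_0 by (auto simp: deficient_def comps_def deficiency_self)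
  then show ?thesis by (simp add: card_image inj_on_def)
qed

text \<open>Equal first parts cancel without changing the deficiency, which gives the sum; the other
  pairs form two classes exchanged by swapping the compositions.\<close>

lemma card_deficient:
  assumes n: "0 < n"
  shows "card (deficient d n) = (\<Sum>j<n. card (deficient d j)) + 2 * card (deficient_less d n)"
proof -
  let ?E = "(\<lambda>(k, a, b). (k # a, k # b)) ` (SIGMA k:{0 + 1..n}. deficient d (n - k))"
  let ?L = "deficient_less d n" and ?G = "prod.swap ` deficient_less d n"
  have sym: "deficiency (y # b) (x # a) = deficiency (x # a) (y # b)" if "x < y" for x y a b
    using that by (simp add: deficiency.simps(3)[of y])
  have "(a, b) \<in> ?E \<union> ?L \<union> ?G" if ab: "(a, b) \<in> deficient d n" for a b
  proof -
    have "composition n a" "composition n b" using ab by (auto simp: deficient_def)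
    then obtain x a' y b' where *: "a = x # a'" "b = y # b'" using n by (metis composition_pos)
    consider "x = y" | "x < y" | "y < x" by linarith
    then show ?thesis
    proof cases
      case 1
      then have "(x, a', b') \<in> (SIGMA k:{0 + 1..n}. deficient d (n - k))"
        using ab * by (auto simp: deficient_def deficiency.simps(3))
      then show ?thesis using 1 * by force
    next
      case 2 then show ?thesis using ab * by (auto simp: deficient_less_def)
    next
      case 3
      then have "(b, a) \<in> ?L" using ab * sym[OF 3] by (auto simp: deficient_less_def deficient_def)
      then have "(a, b) \<in> ?G" by (intro image_eqI[of _ _ "(b, a)"]) simp_all
      then show ?thesis by blast
    qed
  qed
  then have "deficient d n \<subseteq> ?E \<union> ?L \<union> ?G" by (rule subrelI)
  moreover have "?E \<subseteq> deficient d n" by (auto simp: deficient_def deficiency.simps(3))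
  moreover have "?L \<subseteq> deficient d n" by (auto simp: deficient_less_def)
  moreover have "(b, a) \<in> deficient d n" if ab: "(a, b) \<in> ?L" for a b
  proof -
    obtain x a' y b' where "a = x # a'" "b = y # b'" "x < y" "(a, b) \<in> deficient d n"
      using ab by (cases a; cases b) (auto simp: deficient_less_def)
    then show ?thesis using sym[of x y] by (auto simp: deficient_def)
  qed
  then have "?G \<subseteq> deficient d n" by auto
  ultimately have eq: "deficient d n = ?E \<union> ?L \<union> ?G" by blast
  have "?E \<inter> ?L = {}" "(?E \<union> ?L) \<inter> ?G = {}" by (auto simp: deficient_less_def)
  moreover have "finite ?E" by (auto simp: finite_deficient)
  ultimately have "card (deficient d n) = card ?E + card ?L + card ?G"
    unfolding eq using finite_deficient_less[of d n] by (simp add: card_Un_disjoint)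
  moreover have "card ?G = card ?L" by (rule card_image) (auto simp: inj_on_def)
  moreover have "card ?E = card (SIGMA k:{0 + 1..n}. deficient d (n - k))"
    by (rule card_image) (auto simp: inj_on_def)
  moreover have "\<dots> = (\<Sum>k\<in>{0 + 1..n}. card (deficient d (n - k)))"
    by (simp add: finite_deficient)
  moreover have "\<dots> = (\<Sum>j<n. card (deficient d j))"
    using sum_diff_eq[of "\<lambda>j. card (deficient d j)" n 0] by simp
  ultimately show ?thesis by simp
qed

lemma deficient_lessE:
  assumes "(a, b) \<in> deficient_less d n"
  obtains x a' y b' where "a = x # a'" "b = y # b'" "x < y" "composition n (x # a')" "composition n (y # b')"
    "deficiency (x # a') (y # b') = d"
  using assms by (cases a; cases b) (auto simp: deficient_less_def deficient_def)

lemma deficient_less_1: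
  "deficient_less 1 n = (\<lambda>(y, r). (partner1 y r, y # r)) ` (SIGMA y:{2..n}. comps (n - y))"
proof (intro equalityI subrelI)
  fix a b assume "(a, b) \<in> deficient_less 1 n"
  then obtain x a' y b' where *: "a = x # a'" "b = y # b'" "x < y" "composition n (x # a')" "composition n (y # b')"
    "deficiency (x # a') (y # b') = 1" by (rule deficient_lessE)
  then have "a = partner1 y b'" "2 \<le> y" using deficiency_eq_1 by auto
  then show "(a, b) \<in> (\<lambda>(y, r). (partner1 y r, y # r)) ` (SIGMA y:{2..n}. comps (n - y))"
    using * by (auto simp: comps_def)
next
  fix a b assume "(a, b) \<in> (\<lambda>(y, r). (partner1 y r, y # r)) ` (SIGMA y:{2..n}. comps (n - y))"
  then obtain y r where y: "a = partner1 y r" "b = y # r" "2 \<le> y" "composition n (y # r)" by (auto simp: comps_def)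
  obtain a' where a': "partner1 y r = 1 # a'" by (cases "y = 2") (auto simp: partner1_def)
  have "composition n (1 # a')" using y composition_partner1[of y n r] a' by simp
  then have "deficiency (1 # a') (y # r) = 1"
    using deficiency_eq_1[of 1 y n a' r] y a' by simp
  then show "(a, b) \<in> deficient_less 1 n"
    using y a' \<open>composition n (1 # a')\<close> by (simp add: deficient_less_def deficient_def)
qed

lemma card_deficient_less_1: "card (deficient_less 1 n) = (\<Sum>j<n - 1. card (comps j))"
proof -
  have "card (deficient_less 1 n) = card (SIGMA y:{2..n}. comps (n - y))"
    unfolding deficient_less_1 by (rule card_image) (auto simp: inj_on_def)
  also have "\<dots> = (\<Sum>k\<in>{1 + 1..n}. card (comps (n - k)))" by (simp add: finite_comps numeral_2_eq_2)
  also have "\<dots> = (\<Sum>j<n - 1. card (comps j))" by (rule sum_diff_eq)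
  finally show ?thesis .
qed

text \<open>The pairs \<open>(a, b)\<close> for which \<open>(1 # a, y # b)\<close> reduces to a pair of deficiency one.\<close>

definition reduces :: "nat \<Rightarrow> nat \<Rightarrow> (nat list \<times> nat list) set" where
  "reduces y m = {(a, b). (a, reduct1 y b) \<in> deficient 1 m}"

lemma finite_reduces: "finite (reduces y m)"
proof (rule finite_imageD)
  show "finite ((\<lambda>(a, b). (a, reduct1 y b)) ` reduces y m)"
    by (rule finite_subset[OF _ finite_deficient[of 1 m]]) (auto simp: reduces_def)
  show "inj_on (\<lambda>(a, b). (a, reduct1 y b)) (reduces y m)"
    by (auto simp: inj_on_def reduct1_def split: if_splits)
qed

lemma deficient_less_2:
  "deficient_less 2 n = (\<lambda>(y, r). (partner2 y r, y # r)) ` (SIGMA y:{4..n}. comps (n - y))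
     \<union> (\<lambda>r. (2 # 1 # r, 3 # r)) ` {r. composition n (3 # r)}
     \<union> (\<lambda>(y, a, b). (1 # a, y # b)) ` (SIGMA y:{2..n}. reduces y (n - 1))"
    (is "_ = ?A \<union> ?B \<union> ?C")
proof (intro equalityI subrelI)
  fix a b assume "(a, b) \<in> deficient_less 2 n"
  then obtain x a' y b' where *: "a = x # a'" "b = y # b'" "x < y" and c: "composition n (x # a')" "composition n (y # b')"
    and d: "deficiency (x # a') (y # b') = 2" by (rule deficient_lessE)
  from d consider "4 \<le> y" "a = partner2 y b'" | "y = 3" "a = 2 # 1 # b'"
    | "x = 1" "deficiency a' (reduct1 y b') = 1"
    using deficiency_eq_2[OF *(3) c] *(1) by auto
  then show "(a, b) \<in> ?A \<union> ?B \<union> ?C"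
  proof cases
    case 1 then show ?thesis using * c by (auto simp: comps_def)
  next
    case 2 then show ?thesis using * c by auto
  next
    case 3
    then have "(y, a', b') \<in> (SIGMA y:{2..n}. reduces y (n - 1))"
      using * c composition_reduct1[of y n b'] by (simp add: reduces_def deficient_def)
    then have "(\<lambda>(y, a, b). (1 # a, y # b)) (y, a', b') \<in> ?C" by (rule imageI)
    then show ?thesis using 3 * by simp
  qed
next
  have mem: "(x # a', y # b') \<in> deficient_less 2 n"
    if "x < y" "composition n (x # a')" "composition n (y # b')"
      "(4 \<le> y \<and> x # a' = partner2 y b') \<or> (y = 3 \<and> x # a' = 2 # 1 # b')
        \<or> (x = 1 \<and> deficiency a' (reduct1 y b') = 1)" for x a' y b'
    using deficiency_eq_2[OF that(1-3)] that by (simp add: deficient_less_def deficient_def)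
  fix a b assume "(a, b) \<in> ?A \<union> ?B \<union> ?C"
  then consider "(a, b) \<in> ?A" | "(a, b) \<in> ?B" | "(a, b) \<in> ?C" by blast
  then show "(a, b) \<in> deficient_less 2 n"
  proof cases
    case 1
    then obtain y r where y: "a = partner2 y r" "b = y # r" "4 \<le> y" "composition n (y # r)"
      by (auto simp: comps_def)
    obtain a' where a': "partner2 y r = 2 # a'" by (cases "y = 4") (auto simp: partner2_def)
    have "composition n (2 # a')" using y composition_partner2[of y n r] a' by simp
    then show ?thesis using mem[of 2 y a' r] y a' by simp
  next
    case 2
    then obtain r where r: "a = 2 # 1 # r" "b = 3 # r" "composition n (3 # r)" by blast
    then have "composition n (2 # 1 # r)" by (auto simp: composition_def simp del: composition_Cons)
    then show ?thesis using mem[of 2 3 "1 # r" r] r by simp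
  next
    case 3
    then obtain y a' b' where y: "a = 1 # a'" "b = y # b'" "2 \<le> y" "y \<le> n" "(a', b') \<in> reduces y (n - 1)"
      by auto
    then have "composition (n - 1) a'" "composition n (y # b')" "deficiency a' (reduct1 y b') = 1"
      using composition_reduct1[of y n b'] by (auto simp: reduces_def deficient_def)
    then show ?thesis using mem[of 1 y a' b'] y by simp
  qed
qed

lemma card_deficient_less_2:
  "card (deficient_less 2 n) = (\<Sum>j<n - 3. card (comps j)) + (if 3 \<le> n then card (comps (n - 3)) else 0)
     + (\<Sum>y\<in>{2..n}. card (reduces y (n - 1)))"
proof -
  let ?A = "(\<lambda>(y, r). (partner2 y r, y # r)) ` (SIGMA y:{4..n}. comps (n - y))"
    and ?B = "(\<lambda>r. (2 # 1 # r, 3 # r)) ` {r. composition n (3 # r)}"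
    and ?C = "(\<lambda>(y, a, b). (1 # a, y # b)) ` (SIGMA y:{2..n}. reduces y (n - 1))"
  have B: "{r. composition n (3 # r)} = (if 3 \<le> n then comps (n - 3) else {})" by (auto simp: comps_def)
  have "?A \<inter> ?B = {}" "(?A \<union> ?B) \<inter> ?C = {}" by (auto simp: partner2_def split: if_splits)
  moreover have "finite {r. composition n (3 # r)}" unfolding B by (simp add: finite_comps)
  then have "finite ?A" "finite ?B" "finite ?C"
    by (intro finite_imageI finite_SigmaI; simp add: finite_comps finite_reduces)+
  ultimately have "card (deficient_less 2 n) = card ?A + card ?B + card ?C"
    unfolding deficient_less_2 by (simp add: card_Un_disjoint)
  moreover have "card ?A = card (SIGMA y:{4..n}. comps (n - y))" by (rule card_image) (auto simp: inj_on_def)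
  moreover have "\<dots> = (\<Sum>k\<in>{3 + 1..n}. card (comps (n - k)))" by (simp add: finite_comps)
  moreover have "\<dots> = (\<Sum>j<n - 3. card (comps j))" by (rule sum_diff_eq)
  moreover have "card ?B = (if 3 \<le> n then card (comps (n - 3)) else 0)"
    unfolding B by (subst card_image) (auto simp: inj_on_def)
  moreover have "card ?C = card (SIGMA y:{2..n}. reduces y (n - 1))" by (rule card_image) (auto simp: inj_on_def)
  moreover have "\<dots> = (\<Sum>y\<in>{2..n}. card (reduces y (n - 1)))" by (simp add: finite_reduces)
  ultimately show ?thesis by simp
qed

lemma deficient_1_greater:
  assumes "y < x"
  shows "(x # a, y # b) \<in> deficient 1 m \<longleftrightarrow> composition m (x # a) \<and> composition m (y # b) \<and> y # b = partner1 x a"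
  using assms deficiency_eq_1[of y x m b a]
  by (auto simp: deficient_def deficiency.simps(3)[of x] simp del: composition_Cons)

lemma deficient_1_less:
  assumes "x < y"
  shows "(x # a, y # b) \<in> deficient 1 m \<longleftrightarrow> composition m (x # a) \<and> composition m (y # b) \<and> x # a = partner1 y b"
  using assms deficiency_eq_1[of x y m a b] by (auto simp: deficient_def simp del: composition_Cons)

lemma deficient_same_head:
  "(x # a, x # b) \<in> deficient d m \<longleftrightarrow> 0 < x \<and> x \<le> m \<and> (a, b) \<in> deficient d (m - x)"
  by (auto simp: deficient_def deficiency.simps(3))

text \<open>Here \<open>(a, 1 # b)\<close> has deficiency 1. If \<open>a\<close> starts with 1, this
  part cancels; otherwise \<open>(1 # b, a)\<close> lies in \<open>deficient_less 1 m\<close>, and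
  every pair of that set has a first composition starting with 1.\<close>

lemma card_reduces_2:
  assumes m: "0 < m"
  shows "card (reduces 2 m) = card (deficient 1 (m - 1)) + card (deficient_less 1 m)"
proof -
  let ?A = "(\<lambda>(a, b). (1 # a, b)) ` deficient 1 (m - 1)" and ?B = "(\<lambda>(u, v). (v, tl u)) ` deficient_less 1 m"
  have u: "u = 1 # tl u" if "(u, v) \<in> deficient_less 1 m" for u v
    using that unfolding deficient_less_1 by (auto simp: partner1_def)
  have "reduces 2 m = ?A \<union> ?B"
  proof (intro equalityI subrelI)
    fix a b assume "(a, b) \<in> reduces 2 m"
    then have ab: "(a, 1 # b) \<in> deficient 1 m" by (simp add: reduces_def reduct1_def)
    then obtain x a' where a: "a = x # a'" "0 < x" using m by (metis (mono_tags, lifting) case_prodD composition_pos deficient_def mem_Collect_eq)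
    show "(a, b) \<in> ?A \<union> ?B"
    proof (cases "x = 1")
      case True
      then show ?thesis using ab a deficient_same_head[of 1 a' b 1 m] by auto
    next
      case False
      then have x: "1 < x" using a by simp
      then have "(1 # b, a) \<in> deficient_less 1 m"
        using ab a deficiency.simps(3)[of x a' 1 b] by (auto simp: deficient_less_def deficient_def)
      then show ?thesis by force
    qed
  next
    fix a b assume "(a, b) \<in> ?A \<union> ?B"
    then show "(a, b) \<in> reduces 2 m"
    proof
      assume "(a, b) \<in> ?A"
      then obtain a' where "a = 1 # a'" "(a', b) \<in> deficient 1 (m - 1)" by auto
      then show ?thesis using m deficient_same_head[of 1 a' b 1 m] by (simp add: reduces_def reduct1_def)
    next
      assume "(a, b) \<in> ?B"
      then obtain w where w: "(w, a) \<in> deficient_less 1 m" "b = tl w" by auto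
      then have ww: "(1 # b, a) \<in> deficient_less 1 m" using u by metis
      then obtain x a' where "a = x # a'" "1 < x" by (cases a) (auto simp: deficient_less_def)
      then show ?thesis using ww deficiency.simps(3)[of x a' 1 b]
        by (auto simp: deficient_less_def deficient_def reduces_def reduct1_def)
    qed
  qed
  moreover have "hd v \<noteq> 1" if "(w, v) \<in> deficient_less 1 m" for w v
  proof -
    have "hd w = 1" using u[OF that] by (metis list.sel(1))
    then show ?thesis using that by (auto simp: deficient_less_def)
  qed
  then have "?A \<inter> ?B = {}" by fastforce
  moreover have "finite ?A" "finite ?B" by (auto simp: finite_deficient finite_deficient_less)
  ultimately have "card (reduces 2 m) = card ?A + card ?B" by (simp add: card_Un_disjoint)
  moreover have "card ?A = card (deficient 1 (m - 1))" by (rule card_image) (auto simp: inj_on_def)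
  moreover have "card ?B = card (deficient_less 1 m)"
  proof (rule card_image, rule inj_onI)
    fix p q assume pq: "p \<in> deficient_less 1 m" "q \<in> deficient_less 1 m"
      "(\<lambda>(u, v). (v, tl u)) p = (\<lambda>(u, v). (v, tl u)) q"
    obtain w v w' v' where *: "p = (w, v)" "q = (w', v')" by (metis surj_pair)
    have "w = 1 # tl w" "w' = 1 # tl w'" using u pq * by blast+
    moreover have "tl w = tl w'" "v = v'" using pq * by auto
    ultimately show "p = q" using * by metis
  qed
  ultimately show ?thesis by simp
qed

text \<open>Here \<open>(a, z # 1 # b)\<close> has deficiency 1. Equal heads cancel. A smaller head
  of \<open>a\<close> forces \<open>a = partner1 z (1 # b)\<close> and \<open>z \<ge> 2\<close>. A
  larger head \<open>x\<close> makes \<open>z # 1 # b\<close> a \<open>partner1\<close>, so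
  \<open>z = 1\<close>, and its second part 1 leaves \<open>x = 2\<close> or
  \<open>x = 3\<close>.\<close>

lemma card_reduces:
  assumes z: "0 < z" "z < m"
  shows "card (reduces (z + 2) m) = card (reduces 2 (m - z)) +
    (if z = 1 then card (comps (m - 2)) + (if 3 \<le> m then card (comps (m - 3)) else 0)
     else card (comps (m - z - 1)))"
proof -
  let ?A = "(\<lambda>(a, b). (z # a, b)) ` reduces 2 (m - z)"
  let ?B = "if z = 1 then (\<lambda>b. (2 # b, b)) ` comps (m - 2) \<union> (\<lambda>r. (3 # r, 1 # r)) ` {r. composition m (3 # r)}
    else (\<lambda>b. (partner1 z (1 # b), b)) ` comps (m - z - 1)"
  have mem: "(a, b) \<in> reduces (z + 2) m \<longleftrightarrow> (a, z # 1 # b) \<in> deficient 1 m" for a b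
  proof -
    have "reduct1 (z + 2) b = z # 1 # b" using z by (simp add: reduct1_def)
    then show ?thesis by (simp only: reduces_def mem_Collect_eq prod.case)
  qed
  have mem2: "(a, b) \<in> reduces 2 (m - z) \<longleftrightarrow> (z # a, z # 1 # b) \<in> deficient 1 m" for a b
    using z deficient_same_head[of z a "1 # b" 1 m] by (simp add: reduces_def reduct1_def)
  have C: "composition m (z # 1 # b) \<longleftrightarrow> composition (m - z - 1) b" for b using z by auto
  have eq: "reduces (z + 2) m = ?A \<union> ?B"
  proof (intro equalityI subrelI)
    fix a b assume "(a, b) \<in> reduces (z + 2) m"
    then have ab: "(a, z # 1 # b) \<in> deficient 1 m" using mem by blast
    then have c: "composition m a" "composition m (z # 1 # b)" by (auto simp: deficient_def)
    obtain x a' where a: "a = x # a'" "0 < x" using composition_pos[OF c(1)] z by auto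
    consider "x = z" | "x < z" | "z < x" by linarith
    then show "(a, b) \<in> ?A \<union> ?B"
    proof cases
      case 1
      then have "(a', b) \<in> reduces 2 (m - z)" using ab a mem2 by simp
      then show ?thesis using 1 a by force
    next
      case 2
      then have "a = partner1 z (1 # b)" using ab a deficient_1_less[OF 2] by blast
      moreover have "z \<noteq> 1" using 2 a by simp
      ultimately show ?thesis using c C by (auto simp: comps_def)
    next
      case 3
      then have p: "z # 1 # b = partner1 x a'" and ca: "composition m (x # a')" using ab a deficient_1_greater[OF 3] by blast+
      then consider "z = 1" "x = 2" "b = a'" | "z = 1" "x = 3" "b = 1 # a'"
      proof (cases "x = 2")
        case True then show ?thesis using that(1) p by (simp add: partner1_def)
      next
        case False
        then have "z = 1" "x - 2 = 1" "b = 1 # a'" using p by (simp_all add: partner1_def)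
        then show ?thesis using that(2) by simp
      qed
      then show ?thesis
      proof cases
        case 1
        then have "b \<in> comps (m - 2)" using ca by (simp add: comps_def)
        then show ?thesis using 1 a by simp
      next
        case 2
        then have "a' \<in> {r. composition m (3 # r)}" using ca by simp
        then show ?thesis using 2 a by (simp del: composition_Cons)
      qed
    qed
  next
    fix a b assume "(a, b) \<in> ?A \<union> ?B"
    then consider "(a, b) \<in> ?A" | "z = 1" "(a, b) \<in> (\<lambda>b. (2 # b, b)) ` comps (m - 2)"
      | "z = 1" "(a, b) \<in> (\<lambda>r. (3 # r, 1 # r)) ` {r. composition m (3 # r)}"
      | "z \<noteq> 1" "(a, b) \<in> (\<lambda>b. (partner1 z (1 # b), b)) ` comps (m - z - 1)"
      by (cases "z = 1") (simp_all only: if_True if_False Un_iff simp_thms, blast+)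
    then consider a' where "a = z # a'" "(a', b) \<in> reduces 2 (m - z)"
      | "z = 1" "a = 2 # b" "composition (m - 2) b" | r where "z = 1" "a = 3 # r" "b = 1 # r" "composition m (3 # r)"
      | "z \<noteq> 1" "a = partner1 z (1 # b)" "composition (m - z - 1) b"
    proof cases
      case 1 then show ?thesis using that(1) by auto
    next
      case 2 then show ?thesis using that(2) by (auto simp: comps_def)
    next
      case 3 then show ?thesis using that(3) by blast
    next
      case 4 then show ?thesis using that(4) by (auto simp: comps_def)
    qed
    then show "(a, b) \<in> reduces (z + 2) m"
    proof cases
      case 1 then show ?thesis using mem mem2 by blast
    next
      case 2
      then show ?thesis unfolding mem using z deficient_1_greater[of z 2 b "1 # b" m]
        by (simp add: partner1_def numeral_2_eq_2)
    next
      case 3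
      have "composition m (1 # 1 # 1 # r)"
        using 3(4) by (auto simp: composition_def simp del: composition_Cons)
      then show ?thesis unfolding mem using 3 z deficient_1_greater[of z 3 r "1 # 1 # r" m]
        by (simp add: partner1_def del: composition_Cons)
    next
      case 4
      then have z2: "2 \<le> z" using z by simp
      obtain a' where a': "partner1 z (1 # b) = 1 # a'" by (cases "z = 2") (auto simp: partner1_def)
      have c: "composition m (z # 1 # b)" using C 4 by blast
      have "composition m (1 # a')" using composition_partner1[OF z2, of m "1 # b"] c a' by simp
      then show ?thesis unfolding mem using z2 c 4 a' deficient_1_less[of 1 z a' "1 # b" m]
        by (simp del: composition_Cons)
    qed
  qed
  have fin: "finite ?A" "finite ?B"
  proof -
    have "{r. composition m (3 # r)} \<subseteq> comps (m - 3)" by (auto simp: comps_def)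
    then have "finite {r. composition m (3 # r)}" using finite_comps finite_subset by blast
    then show "finite ?A" "finite ?B" by (auto simp: finite_comps finite_reduces)
  qed
  have "?A \<inter> ?B = {}" by (auto simp: partner1_def split: if_splits)
  then have "card (reduces (z + 2) m) = card ?A + card ?B" unfolding eq by (rule card_Un_disjoint[OF fin])
  moreover have "card ?A = card (reduces 2 (m - z))" by (rule card_image) (auto simp: inj_on_def)
  moreover have "card ?B = (if z = 1 then card (comps (m - 2)) + (if 3 \<le> m then card (comps (m - 3)) else 0)
     else card (comps (m - z - 1)))"
  proof (cases "z = 1")
    case True
    let ?X = "(\<lambda>b. (2 # b, b)) ` comps (m - 2)" and ?Y = "(\<lambda>r. (3 # r, 1 # r)) ` {r. composition m (3 # r)}"
    have "card ?X = card (comps (m - 2))" by (rule card_image) (auto simp: inj_on_def)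
    moreover have "card ?Y = card {r. composition m (3 # r)}" by (rule card_image) (auto simp: inj_on_def)
    moreover have "{r. composition m (3 # r)} = (if 3 \<le> m then comps (m - 3) else {})" by (auto simp: comps_def)
    moreover have "?X \<inter> ?Y = {}" by auto
    then have "card (?X \<union> ?Y) = card ?X + card ?Y"
      using fin(2) True by (intro card_Un_disjoint) auto
    ultimately show ?thesis using True by simp
  next
    case False
    then show ?thesis by (simp, subst card_image) (auto simp: inj_on_def)
  qed
  ultimately show ?thesis by simp
qed

lemma reduces_0: "reduces 2 0 = {}"
  by (auto simp: reduces_def reduct1_def deficient_def)

text \<open>The four copies of \<open>card (comps (n - 3))\<close> stem from the pairs with
  \<open>partner2\<close>, from first parts 2 and 3, and from the reductions with
  \<open>y = 3\<close> and with \<open>y \<ge> 4\<close>; the single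
  \<open>card (comps (n - 4))\<close> also stems from \<open>y = 3\<close>.\<close>

lemma card_deficient_less_2_eq:
  assumes n: "4 \<le> n"
  shows "card (deficient_less 2 n) = 4 * card (comps (n - 3)) + card (comps (n - 4)) + (\<Sum>j<n. card (reduces 2 j))"
proof -
  obtain m where m: "n = m + 4" using n by (metis add.commute le_Suc_ex)
  let ?H = "\<lambda>j. card (reduces 2 j)" and ?c = "\<lambda>j. card (comps j)"
  have "(\<Sum>y\<in>{2..n}. card (reduces y (n - 1))) = (\<Sum>z\<in>{0..m + 2}. card (reduces (z + 2) (m + 3)))"
  proof -
    have "{2..n} = {0 + 2..m + 2 + 2}" "n - 1 = m + 3" by (auto simp: m)
    then show ?thesis by (simp only: sum.shift_bounds_cl_nat_ivl)
  qed
  also have "\<dots> = ?H (m + 3) + card (reduces 3 (m + 3)) + (\<Sum>z\<in>{2..m + 2}. card (reduces (z + 2) (m + 3)))"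
    by (simp add: sum.atLeast_Suc_atMost numeral_2_eq_2 numeral_3_eq_3)
  also have "card (reduces 3 (m + 3)) = ?H (m + 2) + ?c (m + 1) + ?c m"
    using card_reduces[of 1 "m + 3"] by (simp add: numeral_3_eq_3)
  also have "(\<Sum>z\<in>{2..m + 2}. card (reduces (z + 2) (m + 3))) = (\<Sum>z\<in>{2..m + 2}. ?H (m + 3 - z) + ?c (m + 2 - z))"
  proof (rule sum.cong)
    fix z assume "z \<in> {2..m + 2}"
    then show "card (reduces (z + 2) (m + 3)) = ?H (m + 3 - z) + ?c (m + 2 - z)"
      using card_reduces[of z "m + 3"] by auto
  qed simp
  also have "\<dots> = (\<Sum>z\<in>{2..m + 2}. ?H (m + 3 - z)) + (\<Sum>z\<in>{1 + 1..m + 2}. ?c (m + 2 - z))"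
    by (simp add: sum.distrib numeral_2_eq_2)
  also have "(\<Sum>z\<in>{1 + 1..m + 2}. ?c (m + 2 - z)) = (\<Sum>j<m + 1. ?c j)" using sum_diff_eq[of ?c "m + 2" 1] by simp
  also have "\<dots> = ?c (m + 1)" by (rule sum_card_comps) simp
  \<comment> \<open>The added term \<open>z = m + 3\<close> counts \<open>reduces 2 0\<close>, which
    is empty.\<close>
  also have "(\<Sum>z\<in>{2..m + 2}. ?H (m + 3 - z)) = (\<Sum>z\<in>{1 + 1..m + 3}. ?H (m + 3 - z))"
    by (rule sum.mono_neutral_left) (auto simp: reduces_0[unfolded numeral_2_eq_2] not_le less_Suc_eq numeral_3_eq_3 numeral_2_eq_2)
  also have "\<dots> = (\<Sum>j<m + 2. ?H j)" using sum_diff_eq[of ?H "m + 3" 1] by simp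
  finally show ?thesis
    using card_deficient_less_2[of n] sum_card_comps[of "m + 1"] by (simp add: m numeral_eq_Suc)
qed

section \<open>Closed forms and the final recurrence\<close>

lemma card_deficient_less_1_Suc: "card (deficient_less 1 (n + 2)) = 2 ^ n"
  using card_deficient_less_1[of "n + 2"] sum_card_comps[of "n + 1"] card_comps[of n] by simp

lemma card_deficient_1: "card (deficient 1 (n + 2)) = (n + 2) * 2 ^ n"
proof -
  have empty: "deficient 1 0 = {}" by (auto simp: deficient_def)
  have one: "card (deficient 1 1) = 0"
    using card_deficient[of 1 1] card_deficient_less_1[of 1] empty by simp
  show ?thesis
  proof (induction n)
    case 0
    show ?case using card_deficient[of 2 1] card_deficient_less_1_Suc[of 0] empty one
      by (simp add: numeral_2_eq_2)
  next
    case (Suc n)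
    \<comment> \<open>Two consecutive instances of \<open>card_deficient\<close> eliminate the sum:
      the number for \<open>n + 3\<close> is twice that for \<open>n + 2\<close> plus
      \<open>2 * 2 ^ n\<close>.\<close>
    then show ?case
      using card_deficient[of "n + 3" 1] card_deficient[of "n + 2" 1] card_deficient_less_1_Suc[of n]
        card_deficient_less_1_Suc[of "Suc n"]
      by (simp add: numeral_3_eq_3 algebra_simps)
  qed
qed

lemma card_deficient_2_recurrence:
  "card (deficient 2 (m + 6)) = 2 * card (deficient 2 (m + 5)) + 50 * 2 ^ m + 8 * card (deficient 1 (m + 2))"
proof -
  have H: "card (reduces 2 (m + 5)) = (m + 4) * 2 ^ (m + 2) + 2 ^ (m + 3)"
    using card_reduces_2[of "m + 5"] card_deficient_1[of "m + 2"] card_deficient_less_1_Suc[of "m + 3"]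
    by (simp add: eval_nat_numeral)
  \<comment> \<open>Written without subtraction: the counts differ by \<open>9 * 2 ^ m\<close> from
    compositions plus \<open>card (reduces 2 (m + 5))\<close>, which is
    \<open>16 * 2 ^ m + 4 * card (deficient 1 (m + 2))\<close>. Doubling gives 50 and 8.\<close>
  have L: "card (deficient_less 2 (m + 6)) + 5 * 2 ^ (m + 1) + 2 ^ m * 3
      = card (deficient_less 2 (m + 5)) + 8 * 2 ^ (m + 1) + 2 ^ m * 2 + 2 ^ m * 2 + 2 ^ m * 2 + (m + 4) * 2 ^ (m + 2) + 2 ^ (m + 3)"
    using card_deficient_less_2_eq[of "m + 6"] card_deficient_less_2_eq[of "m + 5"] H
      card_comps[of "m + 2"] card_comps[of "m + 1"] card_comps[of m]
    by (simp add: eval_nat_numeral)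
  have "card (deficient 2 (m + 6)) + 2 * card (deficient_less 2 (m + 5))
      = 2 * card (deficient 2 (m + 5)) + 2 * card (deficient_less 2 (m + 6))"
    using card_deficient[of "m + 6" 2] card_deficient[of "m + 5" 2] by (simp add: eval_nat_numeral)
  then show ?thesis using L card_deficient_1[of m] by (simp add: power_add algebra_simps)
qed

lemma C_eq_card_deficient:
  assumes "0 < n"
  shows "C n (int n - 1 - int d) = card (deficient d n)"
proof -
  have "int (lie_index n (seaweed n a b)) = int n - 1 - int d \<longleftrightarrow> deficiency a b = d"
    if "composition n a" "composition n b" for a b
    using lie_index_seaweed[OF assms that] by linarith
  then show ?thesis unfolding C_def deficient_def by (intro arg_cong[of _ _ card]) blast
qed

theorem mainTheorem5:
  fixes n :: nat
  assumes "1 \<le> n"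
  shows "50 * C n (int n - 1) + 8 * C (n + 1) (int n - 1) + 2 * C (n + 4) (int n + 1)
         = C (n + 5) (int n + 2)"
proof -
  obtain m where m: "n = m + 1" using assms by (metis add.commute le_Suc_ex)
  \<comment> \<open>Each index is written as size minus 1 minus deficiency, with deficiencies 0, 1,
    2 and 2.\<close>
  have idx: "int n - 1 = int (m + 1) - 1 - int 0" "int n - 1 = int (m + 2) - 1 - int 1"
    "int n + 1 = int (m + 5) - 1 - int 2" "int n + 2 = int (m + 6) - 1 - int 2"
    and len: "n + 1 = m + 2" "n + 4 = m + 5" "n + 5 = m + 6"
    by (simp_all add: m)
  have "C n (int n - 1) = 2 ^ m"
    unfolding idx(1) using C_eq_card_deficient[of "m + 1" 0] card_deficient_0[of "m + 1"] card_comps[of m]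
    by (simp add: m)
  moreover have "C (n + 1) (int n - 1) = card (deficient 1 (m + 2))"
    unfolding idx(2) len by (rule C_eq_card_deficient) simp
  moreover have "C (n + 4) (int n + 1) = card (deficient 2 (m + 5))"
    unfolding idx(3) len by (rule C_eq_card_deficient) simp
  moreover have "C (n + 5) (int n + 2) = card (deficient 2 (m + 6))"
    unfolding idx(4) len by (rule C_eq_card_deficient) simp
  ultimately show ?thesis using card_deficient_2_recurrence[of m] by simp
qed

end
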